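(* Let $(S,i,\ell)$ be the Brownian spider on $\mathcal J$ whose spinning measure $\alpha(t,l)$ depends on the current time and on its local time at the junction (see context). For $0\le s<t\le T$, its transition kernel from time $s$ to time $t$ is given as follows. (1) Starting at time $s$ from the junction $\mathbf 0$ with local time value $k\ge0$, the law at time $t$ of (distance, branch, local time) gives to $\{y\in dy,\ \text{branch}=j,\ \text{local time}\in k+d\ell\}$ ($y>0$, $j\in[I]$, $\ell>0$) the mass $$p^{\alpha}(s,t;(\mathbf 0,k),(y,j,k+d\ell))\,dy=\Big(\int_0^{t-s}\alpha_j(s+u,k+\ell)\,g_{t-s}(y,\ell,u)\,du\Big)\,dy\,d\ell .$$ (2) Starting at time $s$ from $(x,i)$ with $x>0$ and local time value $l\ge0$, the corresponding mass of $\{y\in dy,\ \text{branch}=j,\ \text{local time}\in l+d\ell\}$ is $$p^{\alpha}(s,t;(x,i,l),(y,j,l+d\ell))\,dy=\int_0^{t-s}\frac{x\,e^{-x^2/(2u)}}{\sqrt{2\pi u^3}}\Big(\int_0^{t-(s+u)}\alpha_j(s+u+v,l+\ell)\,g_{t-s-u}(y,\ell,v)\,dv\Big)du\;dy\,d\ell$$ $$+\mathbf 1_{i=j}\frac1{\sqrt{2\pi(t-s)}}\Big[\exp\Big(-\frac{(y-x)^2}{2(t-s)}\Big)-\exp\Big(-\frac{(y+x)^2}{2(t-s)}\Big)\Big]dy\,\delta_{\{0\}}(d\ell).$$ Here, for $r>0$, $$g_r(x,\ell,v)=\mathbf 1_{0<v<r}\,\frac{2\,\ell}{\sqrt{2\pi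 v^3}}\exp\Big(-\frac{\ell^2}{2v}\Big)\frac{x}{\sqrt{2\pi(r-v)^3}}\exp\Big(-\frac{x^2}{2(r-v)}\Big)\mathbf 1_{x>0}\mathbf 1_{\ell>0}.$$
   Context: Fix an integer $I\ge2$, $[I]=\{1,\dots,I\}$, $T>0$. $\mathcal J=\{\mathbf 0\}\cup((0,\infty)\times[I])$ is the star-shaped network with points $(x,i)\in[0,\infty)\times[I]$, all $(0,i)$ identified with the junction $\mathbf 0$, with metric $|x-y|$ on the same branch and $x+y$ across different branches. Let $\alpha=(\alpha_i)_{i\in[I]}$ be continuous on $[0,T]\times[0,\infty)$ with $\alpha_i\ge\underline a>0$, $\sum_i\alpha_i=1$, and each $\alpha_i(t,l)$ Lipschitz in $t$ (uniformly in $l$) and in $l$ (uniformly in $t$). The Brownian spider started at time $s$ from $(x_\ast,i_\ast,l_\ast)\in\mathcal J\times[0,\infty)$ is the (unique in law) continuous $\mathcal J\times[0,\infty)$-valued process $(S_u,i(u),\ell_u)_{u\in[s,T]}$ such that $(S_s,i(s),\ell_s)=(x_\ast,i_\ast,l_\ast)$, $\ell$ is non-decreasing with $\int_s^T\mathbf 1_{\{S_u>0\}}d\ell_u=0$ a.s., and, for every $f:(t,(x,i))\mapsto f_i(t,x)$ with each $f_i\in\mathcal C^{1,2}_b([0,T]\times[0,\infty))$ and $f_i(t,0)=f_j(t,0)$ for all $i,j,t$, the process $$f_{i(r)}(r,S_r)-f_{i_\ast}(s,x_\ast)-\int_s^r\Big(\partial_tf_{i(u)}(u,S_u)+\tfrac12\partial^2_{xx}f_{i(u)}(u,S_u)\Big)du-\sum_{j=1}^I\int_s^r\alpha_j(u,\ell_u)\partial_xf_j(u,0)\,d\ell_u,\quad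 r\in[s,T],$$ is a martingale in the filtration generated by $(S,i,\ell)$. "Transition kernel from time $s$ to time $t$" means the law of $(S_t,i(t),\ell_t)$ for this process, as a function of the starting point at time $s$. (For a standard Brownian motion $W$ from $0$, $g_r$ is the joint density of $|W_r|$, its local time at $0$ up to $r$, and its last zero before $r$.) *)

theory Defs
  imports "HOL-Probability.Probability"
begin

section \<open>The star-shaped network\<close>

text \<open>
  The branches are indexed by a type \<open>'i\<close>, so that \<open>[I]\<close> is \<open>UNIV :: 'i set\<close> and \<open>I = CARD('i)\<close>.
  A point is a distance to the junction together with a label, which is \<open>Some i\<close> in the interior of
  branch \<open>i\<close> and \<open>None\<close> at the junction only.
\<close>

typedef 'i network =
  "{(0 :: real, None :: 'i option)} \<union> {(x, Some i) | x i. 0 < x}"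
  by blast

setup_lifting type_definition_network

lift_definition radius :: "'i network \<Rightarrow> real" is fst .

lift_definition label :: "'i network \<Rightarrow> 'i option" is snd .

lift_definition junction :: "'i network" is "(0, None)"
  by simp

text \<open>\<open>point x i\<close> is the point \<open>(x, i)\<close> for \<open>x \<ge> 0\<close>; all \<open>(0, i)\<close> are the junction.\<close>

lift_definition point :: "real \<Rightarrow> 'i \<Rightarrow> 'i network" is
  "\<lambda>x i. if 0 < x then (x, Some i) else (0, None)"
  by auto

text \<open>
  The value of \<open>branch\<close> at the junction is a fixed but unspecified branch. This choice is immaterial:
  network functions and their time derivatives do not depend on the branch at the junction, and the
  second space derivative only enters through a Lebesgue integral in time, for which the time spent
  by the process at the junction is negligible.
\<close>

definition branch :: "'i network \<Rightarrow> 'i" where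
  "branch p = (case label p of Some i \<Rightarrow> i | None \<Rightarrow> undefined)"

lemma radius_nonneg: "0 \<le> radius p"
  by transfer auto

lemma network_eqI: "radius p = radius q \<Longrightarrow> label p = label q \<Longrightarrow> p = q"
  by transfer auto

lemma label_eq_None_iff: "label p = None \<longleftrightarrow> radius p = 0"
  by transfer auto

lemma radius_junction [simp]: "radius junction = 0"
  by transfer simp

lemma point_zero [simp]: "point 0 i = junction"
  by transfer simp

lemma radius_point [simp]: "0 \<le> x \<Longrightarrow> radius (point x i) = x"
  by transfer auto

lemma branch_point [simp]: "0 < x \<Longrightarrow> branch (point x i) = i"
  unfolding branch_def by transfer auto

instantiation network :: (type) metric_space
begin

definition dist_network :: "'a network \<Rightarrow> 'a network \<Rightarrow> real" where
  "dist p q = (if label p = label q then \<bar>radius p - radius q\<bar> else radius p + radius q)"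

definition uniformity_network :: "('a network \<times> 'a network) filter" where
  "uniformity_network = (INF e\<in>{0<..}. principal {(p, q). dist p q < e})"

definition open_network :: "'a network set \<Rightarrow> bool" where
  "open_network U \<longleftrightarrow> (\<forall>p\<in>U. eventually (\<lambda>(p', q). p' = p \<longrightarrow> q \<in> U) uniformity)"

instance
proof
  fix p q r :: "'a network"
  show "dist p q = 0 \<longleftrightarrow> p = q"
    using radius_nonneg[of p] radius_nonneg[of q] label_eq_None_iff[of p] label_eq_None_iff[of q]
    by (auto simp: dist_network_def intro: network_eqI split: if_splits)
  show "dist p q \<le> dist p r + dist q r"
    using radius_nonneg[of p] radius_nonneg[of q] radius_nonneg[of r]
    by (auto simp: dist_network_def)
qed (fact uniformity_network_def open_network_def)+

end

section \<open>Spinning measures and test functions\<close>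

definition spinning_measure :: "real \<Rightarrow> ('i::finite \<Rightarrow> real \<Rightarrow> real \<Rightarrow> real) \<Rightarrow> bool" where
  "spinning_measure T \<alpha> \<longleftrightarrow>
     (\<forall>i. continuous_on ({0..T} \<times> {0..}) (\<lambda>(t, l). \<alpha> i t l)) \<and>
     (\<exists>a>0. \<forall>i. \<forall>t\<in>{0..T}. \<forall>l\<ge>0. a \<le> \<alpha> i t l) \<and>
     (\<forall>t\<in>{0..T}. \<forall>l\<ge>0. (\<Sum>i\<in>UNIV. \<alpha> i t l) = 1) \<and>
     (\<forall>i. \<exists>K. \<forall>l\<ge>0. K-lipschitz_on {0..T} (\<lambda>t. \<alpha> i t l)) \<and>
     (\<forall>i. \<exists>K. \<forall>t\<in>{0..T}. K-lipschitz_on {0..} (\<lambda>l. \<alpha> i t l))"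

text \<open>
  \<open>C12b T f ft fx fxx\<close>: \<open>f\<close> is of class \<open>C\<^sup>1\<^sup>,\<^sup>2\<close> on \<open>[0,T] \<times> [0,\<infinity>)\<close>, bounded together with its
  derivatives \<open>ft = \<partial>\<^sub>t f\<close>, \<open>fx = \<partial>\<^sub>x f\<close>, \<open>fxx = \<partial>\<^sub>x\<^sub>x f\<close>, which are one-sided at the boundary.
\<close>

definition C12b ::
  "real \<Rightarrow> (real \<Rightarrow> real \<Rightarrow> real) \<Rightarrow> (real \<Rightarrow> real \<Rightarrow> real) \<Rightarrow> (real \<Rightarrow> real \<Rightarrow> real)
    \<Rightarrow> (real \<Rightarrow> real \<Rightarrow> real) \<Rightarrow> bool" where
  "C12b T f ft fx fxx \<longleftrightarrow>
     (\<forall>t\<in>{0..T}. \<forall>x\<ge>0.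
        ((\<lambda>t. f t x) has_real_derivative ft t x) (at t within {0..T}) \<and>
        (f t has_real_derivative fx t x) (at x within {0..}) \<and>
        (fx t has_real_derivative fxx t x) (at x within {0..})) \<and>
     (\<forall>h\<in>{f, ft, fx, fxx}.
        continuous_on ({0..T} \<times> {0..}) (\<lambda>(t, x). h t x) \<and>
        bounded ((\<lambda>(t, x). h t x) ` ({0..T} \<times> {0..})))"

definition on_network ::
  "('i \<Rightarrow> real \<Rightarrow> real \<Rightarrow> real) \<Rightarrow> real \<Rightarrow> 'i network \<Rightarrow> real" where
  "on_network f t p = f (branch p) t (radius p)"

section \<open>The Brownian spider\<close>

text \<open>
  The Lebesgue-Stieltjes measure of \<open>a\<close> on \<open>[s,r]\<close>, for \<open>a\<close> continuous and non-decreasing there: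
  \<open>a\<close> is extended by constants outside \<open>[s,r]\<close>.
\<close>

definition stieltjes :: "real \<Rightarrow> real \<Rightarrow> (real \<Rightarrow> real) \<Rightarrow> real measure" where
  "stieltjes s r a = interval_measure (\<lambda>u. a (max s (min r u)))"

definition generated_filtration ::
  "'w measure \<Rightarrow> real \<Rightarrow> (real \<Rightarrow> 'w \<Rightarrow> 'i network) \<Rightarrow> (real \<Rightarrow> 'w \<Rightarrow> real) \<Rightarrow> real \<Rightarrow> 'w measure"
  where
  "generated_filtration M s X L r =
     sigma (space M) {(\<lambda>\<omega>. (X u \<omega>, L u \<omega>)) -` A \<inter> space M | u A.
       u \<in> {s..r} \<and> A \<in> sets (borel \<Otimes>\<^sub>M borel)}"

definition martingale ::
  "'w measure \<Rightarrow> (real \<Rightarrow> 'w measure) \<Rightarrow> real set \<Rightarrow> (real \<Rightarrow> 'w \<Rightarrow> real) \<Rightarrow> bool" where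
  "martingale M F J Z \<longleftrightarrow>
     (\<forall>r\<in>J. Z r \<in> borel_measurable (F r) \<and> integrable M (Z r)) \<and>
     (\<forall>q\<in>J. \<forall>r\<in>J. q \<le> r \<longrightarrow> (AE \<omega> in M. real_cond_exp M (F q) (Z r) \<omega> = Z q \<omega>))"

text \<open>
  \<open>brownian_spider M T \<alpha> s p l X L\<close>: on the probability space \<open>M\<close>, the process
  \<open>(S\<^sub>u, i(u)) = X u\<close>, \<open>\<ell>\<^sub>u = L u\<close>, \<open>u \<in> [s,T]\<close>, is a Brownian spider with spinning measure \<open>\<alpha>\<close>
  started at time \<open>s\<close> from the point \<open>p\<close> of the network with local time \<open>l\<close>.
\<close>

definition brownian_spider ::
  "'w measure \<Rightarrow> real \<Rightarrow> ('i::finite \<Rightarrow> real \<Rightarrow> real \<Rightarrow> real) \<Rightarrow> real \<Rightarrow> 'i network \<Rightarrow> real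
    \<Rightarrow> (real \<Rightarrow> 'w \<Rightarrow> 'i network) \<Rightarrow> (real \<Rightarrow> 'w \<Rightarrow> real) \<Rightarrow> bool" where
  "brownian_spider M T \<alpha> s p l X L \<longleftrightarrow>
     prob_space M \<and>
     (\<forall>u\<in>{s..T}. X u \<in> borel_measurable M \<and> L u \<in> borel_measurable M) \<and>
     (\<forall>\<omega>\<in>space M. continuous_on {s..T} (\<lambda>u. X u \<omega>) \<and> continuous_on {s..T} (\<lambda>u. L u \<omega>) \<and>
        (\<forall>u\<in>{s..T}. 0 \<le> L u \<omega>)) \<and>
     (AE \<omega> in M. X s \<omega> = p \<and> L s \<omega> = l) \<and>
     (AE \<omega> in M. mono_on {s..T} (\<lambda>u. L u \<omega>) \<and>
        (\<integral>\<^sup>+u. indicator {u \<in> {s..T}. 0 < radius (X u \<omega>)} u \<partial>stieltjes s T (\<lambda>u. L u \<omega>)) = 0) \<and>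
     (\<forall>f ft fx fxx.
        (\<forall>i. C12b T (f i) (ft i) (fx i) (fxx i)) \<longrightarrow>
        (\<forall>i j. \<forall>t\<in>{0..T}. f i t 0 = f j t 0) \<longrightarrow>
        martingale M (generated_filtration M s X L) {s..T}
          (\<lambda>r \<omega>. on_network f r (X r \<omega>) - on_network f s p
             - (LBINT u:{s..r}. on_network ft u (X u \<omega>) + 1/2 * on_network fxx u (X u \<omega>))
             - (\<Sum>j\<in>UNIV. LINT u:{s..r}|stieltjes s r (\<lambda>u. L u \<omega>). \<alpha> j u (L u \<omega>) * fx j u 0)))"

section \<open>Densities of the transition kernel\<close>

definition g :: "real \<Rightarrow> real \<Rightarrow> real \<Rightarrow> real \<Rightarrow> real" where
  "g r x l v =
     (if 0 < v \<and> v < r \<and> 0 < x \<and> 0 < l then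
        2 * l / sqrt (2 * pi * v^3) * exp (- (l^2 / (2 * v))) *
        (x / sqrt (2 * pi * (r - v)^3)) * exp (- (x^2 / (2 * (r - v))))
      else 0)"

text \<open>In the next two densities \<open>m\<close> is the increment of the local time over \<open>[s,t]\<close>.\<close>

definition junction_density ::
  "('i \<Rightarrow> real \<Rightarrow> real \<Rightarrow> real) \<Rightarrow> real \<Rightarrow> real \<Rightarrow> real \<Rightarrow> 'i \<Rightarrow> real \<Rightarrow> real \<Rightarrow> real" where
  "junction_density \<alpha> s t k j y m =
     (LBINT u:{0..t - s}. \<alpha> j (s + u) (k + m) * g (t - s) y m u)"

definition branch_density ::
  "('i \<Rightarrow> real \<Rightarrow> real \<Rightarrow> real) \<Rightarrow> real \<Rightarrow> real \<Rightarrow> real \<Rightarrow> real \<Rightarrow> 'i \<Rightarrow> real \<Rightarrow> real \<Rightarrow> real" where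
  "branch_density \<alpha> s t x l j y m =
     (LBINT u:{0..t - s}. x * exp (- (x^2 / (2 * u))) / sqrt (2 * pi * u^3) *
        (LBINT v:{0..t - (s + u)}. \<alpha> j (s + u + v) (l + m) * g (t - s - u) y m v))"

definition absorbed_density :: "real \<Rightarrow> real \<Rightarrow> real \<Rightarrow> real" where
  "absorbed_density r x y =
     1 / sqrt (2 * pi * r) * (exp (- ((y - x)^2 / (2 * r))) - exp (- ((y + x)^2 / (2 * r))))"

end

theory Submission
  imports Defs "HOL-Real_Asymp.Real_Asymp"
begin

text \<open>
  Let \<open>q\<^sub>b\<close> be the density of the hitting time of \<open>b\<close> by a Brownian motion. Laws on a branch are
  identified by their sine transform in the distance and their Laplace transform in the local time, so
  that it suffices to use the test functions \<open>exp (\<theta>\<^sup>2 r / 2) sin (\<theta> x)\<close> on one branch \<open>j\<close> and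
  \<open>exp (\<theta>\<^sup>2 r / 2) cos (\<theta> x)\<close> on all branches; they solve the backward heat equation, hence have no
  drift. Writing \<open>dL\<close>-integrals as Lebesgue integrals along the inverse \<open>\<tau>\<^sub>l\<close> of the local time and
  integrating by parts against \<open>exp (- n L)\<close>, the transform of the law at time \<open>t\<close> becomes
  the absorbed part plus the expectation of
  \<open>\<integral> exp (- n l) \<alpha>\<^sub>j(\<tau>\<^sub>l, l) \<theta> exp (- \<theta>\<^sup>2 (t - \<tau>\<^sub>l) / 2) dl\<close>,
  and \<open>\<theta> exp (- \<theta>\<^sup>2 r / 2)\<close> is the sine transform of \<open>y \<mapsto> 2 q\<^sub>y(r)\<close>.

  The law of \<open>\<tau>\<^sub>l\<close> does not depend on \<open>\<alpha>\<close>: in \<open>n sin (\<theta> R) + \<theta> cos (\<theta> R)\<close> the local time terms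
  cancel, and up to a constant this is the sine transform of \<open>R + V\<close> with \<open>V\<close> exponential of rate \<open>n\<close>.
  This yields the Laplace transform of \<open>L\<^sub>t\<close>, hence \<open>P(\<tau>\<^sub>l \<le> u) = P(l \<le> L\<^sub>u)\<close>; the density of
  \<open>\<tau>\<^sub>l\<close> is \<open>q\<close> at \<open>x\<close> plus the increment of the local time. The identity \<open>q\<^sub>x * q\<^sub>m = q\<^bsub>x+m\<^esub>\<close>
  splits off the first visit of the junction and gives the stated densities.
\<close>

section \<open>Uniqueness of transforms\<close>

text \<open>The test functions of the martingale problem depend on time and position only, so the
  local time has to enter from outside, as a weight \<open>exp (- n * (L q - l0))\<close> known at
  time \<open>q\<close>; integration by parts in expectation replaces an Ito formula in all three
  coordinates. Passing to levels is what tames \<open>\<alpha>\<close>: at time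
  \<open>\<tau>\<^sub>l\<close> the local time equals \<open>l\<close>, so the second argument of
  \<open>\<alpha> j\<close> is deterministic. After Fubini only the law of
  \<open>\<tau>\<^sub>l\<close> at each single level matters, never a joint law over several levels,
  and it can be read off from \<open>L\<close> at fixed times. The sine vanishes at the junction, so
  it may live on one branch and isolate \<open>\<alpha> j\<close>; the cosine is flat there, so it
  produces no local time term. The price is that a sine transform determines only the odd part of a
  law. This is harmless for nonnegative distances, apart from an atom at 0, and the radius at time
  \<open>t\<close> is almost surely positive. Neither the Markov property nor uniqueness in law is
  invoked: every process that solves the martingale problem is shown to have the stated law.\<close>

lemma finite_measure_eq_if_cos_sin_eq:
  fixes M N :: "real measure"
  assumes M: "finite_measure M" "sets M = sets borel" and N: "finite_measure N" "sets N = sets borel"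
    and cos: "\<And>\<theta>. (\<integral>x. cos (\<theta> * x) \<partial>M) = (\<integral>x. cos (\<theta> * x) \<partial>N)"
    and sin: "\<And>\<theta>. (\<integral>x. sin (\<theta> * x) \<partial>M) = (\<integral>x. sin (\<theta> * x) \<partial>N)"
  shows "M = N"
proof -
  interpret M: finite_measure M by fact
  interpret N: finite_measure N by fact
  note [measurable_cong] = M(2) N(2)
  have sp: "space M = UNIV" "space N = UNIV"
    using sets_eq_imp_space_eq[OF M(2)] sets_eq_imp_space_eq[OF N(2)] by auto
  define c where "c = measure M UNIV"
  have cN: "c = measure N UNIV"
    using cos[of 0] by (simp add: c_def sp)
  have intM: "integrable M (\<lambda>x. iexp (t * x))" for t
    by (rule M.integrable_const_bound[where B=1]) (auto simp: M(2))
  have intN: "integrable N (\<lambda>x. iexp (t * x))" for t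
    by (rule N.integrable_const_bound[where B=1]) (auto simp: N(2))
  have ch: "(CLINT x|M. iexp (t * x)) = (CLINT x|N. iexp (t * x))" for t
  proof (rule complex_eqI)
    show "Re (CLINT x|M. iexp (t * x)) = Re (CLINT x|N. iexp (t * x))"
      using cos[of t] integral_Re[OF intM[of t]] integral_Re[OF intN[of t]] by (simp add: Re_exp)
    show "Im (CLINT x|M. iexp (t * x)) = Im (CLINT x|N. iexp (t * x))"
      using sin[of t] integral_Im[OF intM[of t]] integral_Im[OF intN[of t]] by (simp add: Im_exp)
  qed
  \<comment> \<open>Levy uniqueness concerns probability measures, so both measures are divided by
    their common mass \<open>c\<close>, the cosine transform at \<open>\<theta> = 0\<close>; the
    zero measure is handled apart.\<close>
  show ?thesis
  proof (cases "c = 0")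
    case True
    then have "emeasure M UNIV = 0" "emeasure N UNIV = 0"
      using cN by (auto simp: c_def M.emeasure_eq_measure N.emeasure_eq_measure)
    then have "emeasure M A = 0" "emeasure N A = 0" for A
      using emeasure_mono[of A UNIV M] emeasure_mono[of A UNIV N] M(2) N(2) by auto
    then show ?thesis by (intro measure_eqI) (auto simp: M(2) N(2))
  next
    case False
    then have c: "0 < c" by (simp add: c_def less_le)
    let ?M = "density M (\<lambda>_. ennreal (1/c))" and ?N = "density N (\<lambda>_. ennreal (1/c))"
    have e: "emeasure ?M A = ennreal (1/c) * emeasure M A" "emeasure ?N A = ennreal (1/c) * emeasure N A"
      if "A \<in> sets borel" for A
      using that by (simp_all add: emeasure_density nn_integral_cmult_indicator M(2) N(2))
    have "real_distribution ?M"
      using c by (auto simp: real_distribution_def real_distribution_axioms_def M(2) sp e intro!: prob_spaceI)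
        (simp add: M.emeasure_eq_measure flip: c_def ennreal_mult)
    moreover have "real_distribution ?N"
      using c by (auto simp: real_distribution_def real_distribution_axioms_def N(2) sp e intro!: prob_spaceI)
        (simp add: N.emeasure_eq_measure flip: cN ennreal_mult)
    moreover have "char ?M = char ?N"
    proof
      fix t
      have "char ?M t = (1/c) *\<^sub>R (CLINT x|M. iexp (t * x))"
        unfolding char_def using c by (subst integral_density) (auto simp: M(2))
      also have "\<dots> = char ?N t"
        unfolding char_def ch using c by (subst integral_density) (auto simp: N(2))
      finally show "char ?M t = char ?N t" .
    qed
    ultimately have eq: "?M = ?N" by (rule Levy_uniqueness)
    show ?thesis
    proof (rule measure_eqI)
      fix A assume "A \<in> sets M"
      then have A: "A \<in> sets borel" by (simp add: M(2))
      have "ennreal c * (ennreal (1/c) * emeasure M A) = ennreal c * (ennreal (1/c) * emeasure N A)"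
        using e[OF A] eq by simp
      then show "emeasure M A = emeasure N A"
        using c by (simp add: mult.assoc[symmetric] ennreal_mult[symmetric])
    qed (simp add: M(2) N(2))
  qed
qed

text \<open>Sums allow identities between differences of measures to be written without signed
  measures. Reflections are moved to the other side, an atom is added to a law, and a law is split
  into a part with a density and a part carried by a line.\<close>

definition plus_measure :: "'a measure \<Rightarrow> 'a measure \<Rightarrow> 'a measure" where
  "plus_measure M N = measure_of (space M) (sets M) (\<lambda>A. emeasure M A + emeasure N A)"

context
  fixes M N :: "'a measure"
  assumes N: "sets N = sets M"
begin

lemma sets_plus_measure: "sets (plus_measure M N) = sets M"
  unfolding plus_measure_def by (simp add: sets.space_closed sets.sigma_sets_eq)

lemma emeasure_plus_measure:
  assumes "A \<in> sets M"
  shows "emeasure (plus_measure M N) A = emeasure M A + emeasure N A"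
proof (rule emeasure_measure_of[OF plus_measure_def])
  show "countably_additive (sets (plus_measure M N)) (\<lambda>A. emeasure M A + emeasure N A)"
    unfolding countably_additive_def sets_plus_measure
  proof safe
    fix A :: "nat \<Rightarrow> 'a set"
    assume A: "range A \<subseteq> sets M" "disjoint_family A"
    show "(\<Sum>i. emeasure M (A i) + emeasure N (A i)) = emeasure M (\<Union> (range A)) + emeasure N (\<Union> (range A))"
      using suminf_emeasure[of A M] suminf_emeasure[of A N] A N
      by (simp add: suminf_add[symmetric])
  qed
qed (auto simp: positive_def sets_plus_measure assms dest: sets.sets_into_space)

lemma nn_integral_plus_measure:
  assumes "f \<in> borel_measurable M"
  shows "nn_integral (plus_measure M N) f = nn_integral M f + nn_integral N f"
  using assms
proof (induction rule: borel_measurable_induct)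
  case (cong f g)
  have "space (plus_measure M N) = space M" "space N = space M"
    using sets_eq_imp_space_eq[OF sets_plus_measure] sets_eq_imp_space_eq[OF N] by auto
  with cong(3) have "nn_integral K f = nn_integral K g" if "K \<in> {plus_measure M N, M, N}" for K
    using that by (intro nn_integral_cong) auto
  with cong(4) show ?case by simp
next
  case (set A)
  then show ?case by (simp add: sets_plus_measure N emeasure_plus_measure)
next
  case (mult u c)
  then show ?case
    by (simp add: nn_integral_cmult sets_plus_measure N distrib_left
        measurable_cong_sets[OF sets_plus_measure refl] measurable_cong_sets[OF N refl])
next
  case (add u v)
  then show ?case
    by (simp add: nn_integral_add ac_simps
        measurable_cong_sets[OF sets_plus_measure refl] measurable_cong_sets[OF N refl])
next
  case (seq U)
  have "nn_integral K (SUP i. U i) = (SUP i. nn_integral K (U i))" if "sets K = sets M" for K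
  proof -
    have "U i \<in> borel_measurable K" for i
      using seq(1) by (simp add: measurable_cong_sets[OF that refl])
    moreover have "(SUP i. U i) = (\<lambda>x. SUP i. U i x)"
      by (simp add: fun_eq_iff image_comp)
    ultimately show ?thesis
      by (simp only: nn_integral_monotone_convergence_SUP[OF seq(3)])
  qed
  note sup = this[OF refl] this[OF N] this[OF sets_plus_measure]
  have "nn_integral (plus_measure M N) (SUP i. U i) = (SUP i. nn_integral M (U i) + nn_integral N (U i))"
    using sup(3) by (rule trans) (rule SUP_cong[OF refl seq.IH])
  also have "\<dots> = (SUP i. nn_integral M (U i)) + (SUP i. nn_integral N (U i))"
    using seq(3) by (intro ennreal_SUP_add) (auto simp: incseq_def le_fun_def intro!: nn_integral_mono)
  finally show ?case
    by (rule trans) (rule arg_cong2[OF sup(1,2)[symmetric], of "(+)"])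
qed

lemma finite_measure_plus_measure:
  assumes "finite_measure M" "finite_measure N"
  shows "finite_measure (plus_measure M N)"
proof (rule finite_measureI)
  have "space (plus_measure M N) = space M" "space N = space M"
    using sets_eq_imp_space_eq[OF sets_plus_measure] sets_eq_imp_space_eq[OF N] by auto
  then show "emeasure (plus_measure M N) (space (plus_measure M N)) \<noteq> \<infinity>"
    using finite_measure.emeasure_finite[OF assms(1), of "space M"] finite_measure.emeasure_finite[OF assms(2), of "space M"]
    by (simp add: emeasure_plus_measure)
qed

lemma integral_plus_measure:
  fixes f :: "'a \<Rightarrow> real"
  assumes "integrable M f" "integrable N f"
  shows "integral\<^sup>L (plus_measure M N) f = integral\<^sup>L M f + integral\<^sup>L N f"
proof -
  have [measurable]: "f \<in> borel_measurable M"
    using assms(1) by (rule borel_measurable_integrable)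
  have int: "integrable (plus_measure M N) f"
    using assms by (auto simp: integrable_iff_bounded nn_integral_plus_measure measurable_cong_sets[OF sets_plus_measure refl])
  have fin: "nn_integral K (\<lambda>x. ennreal (f x)) < \<infinity>" "nn_integral K (\<lambda>x. ennreal (- f x)) < \<infinity>" if "integrable K f" for K
    using that by (auto simp: real_integrable_def top.not_eq_extremum)
  show ?thesis
    using fin[OF assms(1)] fin[OF assms(2)]
    by (simp add: real_lebesgue_integral_def[OF assms(1)] real_lebesgue_integral_def[OF assms(2)]
        real_lebesgue_integral_def[OF int] nn_integral_plus_measure enn2real_plus)
qed

end

text \<open>The sine transform sees only the odd part of a measure. Adding to each measure the
  reflection of the other yields two measures whose cosine transforms agree by symmetry and whose
  sine transforms are both 0, so they coincide.\<close>

lemma sine_transform_unique: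
  fixes M N :: "real measure"
  assumes M: "finite_measure M" "sets M = sets borel" and N: "finite_measure N" "sets N = sets borel"
    and sin: "\<And>\<theta>. (\<integral>x. sin (\<theta> * x) \<partial>M) = (\<integral>x. sin (\<theta> * x) \<partial>N)"
    and A: "A \<in> sets borel"
  shows "emeasure M A + emeasure N (uminus -` A) = emeasure N A + emeasure M (uminus -` A)"
proof -
  let ?M = "distr M borel uminus" and ?N = "distr N borel uminus"
  have um: "uminus \<in> measurable M borel" "uminus \<in> measurable N borel"
    by (auto simp: measurable_cong_sets[OF M(2) refl] measurable_cong_sets[OF N(2) refl])
  have fin: "finite_measure ?M" "finite_measure ?N"
    using um M N by (auto intro: finite_measure.finite_measure_distr)
  have i: "integrable K (\<lambda>x. sin (\<theta> * x))" "integrable K (\<lambda>x. cos (\<theta> * x))"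
    if "finite_measure K" "sets K = sets borel" for K :: "real measure" and \<theta> :: real
    using finite_measure.integrable_const_bound[OF that(1), of "\<lambda>x. sin (\<theta> * x)" 1]
      finite_measure.integrable_const_bound[OF that(1), of "\<lambda>x. cos (\<theta> * x)" 1]
    by (simp_all add: measurable_cong_sets[OF that(2) refl])
  have "plus_measure M ?N = plus_measure N ?M"
  proof (rule finite_measure_eq_if_cos_sin_eq)
    fix \<theta> :: real
    show "(\<integral>x. cos (\<theta> * x) \<partial>plus_measure M ?N) = (\<integral>x. cos (\<theta> * x) \<partial>plus_measure N ?M)"
      using M N fin um by (simp add: integral_plus_measure i integral_distr)
    show "(\<integral>x. sin (\<theta> * x) \<partial>plus_measure M ?N) = (\<integral>x. sin (\<theta> * x) \<partial>plus_measure N ?M)"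
      using M N fin um sin[of \<theta>] by (simp add: integral_plus_measure i integral_distr)
  qed (simp_all add: finite_measure_plus_measure sets_plus_measure M N fin)
  from arg_cong[OF this, of "\<lambda>K. emeasure K A"] show ?thesis
    using A M N um sets_eq_imp_space_eq[OF M(2)] sets_eq_imp_space_eq[OF N(2)]
    by (simp add: emeasure_plus_measure emeasure_distr)
qed

text \<open>The cosine sees only even parts, so here each measure is symmetrised with its own
  reflection.\<close>

lemma cosine_transform_unique:
  fixes M N :: "real measure"
  assumes M: "finite_measure M" "sets M = sets borel" and N: "finite_measure N" "sets N = sets borel"
    and cos: "\<And>\<theta>. (\<integral>x. cos (\<theta> * x) \<partial>M) = (\<integral>x. cos (\<theta> * x) \<partial>N)"
    and A: "A \<in> sets borel"
  shows "emeasure M A + emeasure M (uminus -` A) = emeasure N A + emeasure N (uminus -` A)"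
proof -
  let ?M = "distr M borel uminus" and ?N = "distr N borel uminus"
  have um: "uminus \<in> measurable M borel" "uminus \<in> measurable N borel"
    by (auto simp: measurable_cong_sets[OF M(2) refl] measurable_cong_sets[OF N(2) refl])
  have fin: "finite_measure ?M" "finite_measure ?N"
    using um M N by (auto intro: finite_measure.finite_measure_distr)
  have i: "integrable K (\<lambda>x. sin (\<theta> * x))" "integrable K (\<lambda>x. cos (\<theta> * x))"
    if "finite_measure K" "sets K = sets borel" for K :: "real measure" and \<theta> :: real
    using finite_measure.integrable_const_bound[OF that(1), of "\<lambda>x. sin (\<theta> * x)" 1]
      finite_measure.integrable_const_bound[OF that(1), of "\<lambda>x. cos (\<theta> * x)" 1]
    by (simp_all add: measurable_cong_sets[OF that(2) refl])
  have "plus_measure M ?M = plus_measure N ?N"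
  proof (rule finite_measure_eq_if_cos_sin_eq)
    fix \<theta> :: real
    show "(\<integral>x. cos (\<theta> * x) \<partial>plus_measure M ?M) = (\<integral>x. cos (\<theta> * x) \<partial>plus_measure N ?N)"
      using M N fin um cos[of \<theta>] by (simp add: integral_plus_measure i integral_distr)
    show "(\<integral>x. sin (\<theta> * x) \<partial>plus_measure M ?M) = (\<integral>x. sin (\<theta> * x) \<partial>plus_measure N ?N)"
      using M N fin um by (simp add: integral_plus_measure i integral_distr)
  qed (simp_all add: finite_measure_plus_measure sets_plus_measure M N fin)
  from arg_cong[OF this, of "\<lambda>K. emeasure K A"] show ?thesis
    using A M N um sets_eq_imp_space_eq[OF M(2)] sets_eq_imp_space_eq[OF N(2)]
    by (simp add: emeasure_plus_measure emeasure_distr)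
qed

text \<open>The power series of cosine and sine may be integrated term by term, since for
  \<open>\<bar>x\<bar> \<le> 1\<close> the terms are dominated by those of an exponential series;
  equal moments thus give equal trigonometric transforms.\<close>

lemma moments_unique:
  fixes M N :: "real measure"
  assumes M: "finite_measure M" "sets M = sets borel" "AE x in M. \<bar>x\<bar> \<le> 1"
    and N: "finite_measure N" "sets N = sets borel" "AE x in N. \<bar>x\<bar> \<le> 1"
    and mom: "\<And>n::nat. (\<integral>x. x ^ n \<partial>M) = (\<integral>x. x ^ n \<partial>N)"
  shows "M = N"
proof (rule finite_measure_eq_if_cos_sin_eq)
  have sums: "(\<lambda>n. c n * t ^ n * (\<integral>x. x ^ n \<partial>K)) sums (\<integral>x. f (t * x) \<partial>K)"
    if K: "finite_measure K" "sets K = sets borel" "AE x in K. \<bar>x\<bar> \<le> 1"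
    and f: "\<And>y::real. (\<lambda>n. c n * y ^ n) sums f y"
    and c: "\<And>n. \<bar>c n\<bar> \<le> inverse (fact n)" for K :: "real measure" and c :: "nat \<Rightarrow> real" and f and t :: real
  proof -
    interpret finite_measure K by fact
    have pw: "AE x in K. \<bar>x\<bar> ^ n \<le> 1" for n :: nat
      using K(3) by eventually_elim (simp add: power_le_one)
    have int: "integrable K (\<lambda>x. x ^ n)" for n :: nat
      using pw[of n] by (intro integrable_const_bound[where B=1]) (auto simp: power_abs measurable_cong_sets[OF K(2) refl])
    have sumexp: "summable (\<lambda>n. \<bar>t\<bar> ^ n /\<^sub>R fact n)" using summable_exp_generic[of "\<bar>t\<bar>"] .
    have bd: "\<bar>c n * t ^ n\<bar> \<le> \<bar>t\<bar> ^ n /\<^sub>R fact n" for n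
      using mult_right_mono[OF c[of n], of "\<bar>t\<bar> ^ n"] by (simp add: abs_mult power_abs)
    have "(\<lambda>n. \<integral>x. (c n * t ^ n) * x ^ n \<partial>K) sums (\<integral>x. (\<Sum>n. (c n * t ^ n) * x ^ n) \<partial>K)"
    proof (rule sums_integral)
      show "AE x in K. summable (\<lambda>n. norm (c n * t ^ n * x ^ n))"
        using K(3)
      proof eventually_elim
        case (elim x)
        have "norm (norm (c n * t ^ n * x ^ n)) \<le> \<bar>t\<bar> ^ n /\<^sub>R fact n" for n
          using mult_mono[OF bd[of n] power_le_one[OF abs_ge_zero elim, of n]]
          by (simp add: abs_mult power_abs)
        then show ?case by (intro summable_comparison_test'[OF sumexp])
      qed
      have "(\<integral>x. norm (x ^ n) \<partial>K) \<le> measure K (space K)" for n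
      proof -
        have "(\<integral>x. norm (x ^ n) \<partial>K) \<le> (\<integral>x. 1 \<partial>K)"
          using pw[of n] integrable_norm[OF int[of n]] by (intro integral_mono_AE) (auto simp: power_abs)
        then show ?thesis by simp
      qed
      then have "norm (\<integral>x. norm (c n * t ^ n * x ^ n) \<partial>K) \<le> \<bar>t\<bar> ^ n /\<^sub>R fact n * measure K (space K)" for n
        using mult_mono[OF bd[of n], of "\<integral>x. norm (x ^ n) \<partial>K" "measure K (space K)"]
        by (simp add: abs_mult[of "c n * t ^ n"] integral_nonneg_AE)
      then show "summable (\<lambda>n. \<integral>x. norm (c n * t ^ n * x ^ n) \<partial>K)"
        by (intro summable_comparison_test'[OF summable_mult2[OF sumexp, of "measure K (space K)"]]) auto
    qed (use int in auto)
    moreover have "(\<Sum>n. c n * t ^ n * x ^ n) = f (t * x)" for x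
      using sums_unique[OF f[of "t * x"]] by (simp add: power_mult_distrib mult.assoc)
    ultimately show ?thesis by simp
  qed
  have cc: "\<bar>cos_coeff n\<bar> \<le> inverse (fact n)" "\<bar>sin_coeff n\<bar> \<le> inverse (fact n)" for n
    by (auto simp: cos_coeff_def sin_coeff_def abs_mult power_abs inverse_eq_divide)
  have cs: "(\<lambda>n. cos_coeff n * y ^ n) sums cos y" "(\<lambda>n. sin_coeff n * y ^ n) sums sin y" for y :: real
    using cos_converges[of y] sin_converges[of y] by auto
  fix \<theta> :: real
  show "(\<integral>x. cos (\<theta> * x) \<partial>M) = (\<integral>x. cos (\<theta> * x) \<partial>N)"
    using sums[OF M cs(1) cc(1), of \<theta>] sums[OF N cs(1) cc(1), of \<theta>] mom
    by (auto intro: sums_unique2)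
  show "(\<integral>x. sin (\<theta> * x) \<partial>M) = (\<integral>x. sin (\<theta> * x) \<partial>N)"
    using sums[OF M cs(2) cc(2), of \<theta>] sums[OF N cs(2) cc(2), of \<theta>] mom
    by (auto intro: sums_unique2)
qed (use M N in auto)

text \<open>The map \<open>x \<mapsto> exp (- x)\<close> carries the half line into
  \<open>(0, 1]\<close> and turns the Laplace transform at \<open>n\<close> into the
  \<open>n\<close>-th moment, which is why integer arguments suffice. It is undone by
  \<open>- ln\<close>.\<close>

lemma laplace_transform_unique:
  fixes M N :: "real measure"
  assumes M: "finite_measure M" "sets M = sets borel" "AE x in M. 0 \<le> x"
    and N: "finite_measure N" "sets N = sets borel" "AE x in N. 0 \<le> x"
    and lap: "\<And>n::nat. (\<integral>x. exp (- real n * x) \<partial>M) = (\<integral>x. exp (- real n * x) \<partial>N)"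
  shows "M = N"
proof -
  let ?h = "\<lambda>x::real. exp (- x)"
  have hm: "?h \<in> measurable M borel" "?h \<in> measurable N borel"
    by (auto simp: measurable_cong_sets[OF M(2) refl] measurable_cong_sets[OF N(2) refl])
  have p: "exp (- x) ^ n = exp (- (real n * x))" for x :: real and n
    by (simp flip: exp_of_nat_mult)
  have ae: "AE x in distr K borel ?h. \<bar>x\<bar> \<le> 1" if "?h \<in> measurable K borel" "AE x in K. 0 \<le> x" for K
    using that(2) by (subst AE_distr_iff[OF that(1)]) auto
  have eq: "distr M borel ?h = distr N borel ?h"
  proof (rule moments_unique)
    fix n
    show "(\<integral>x. x ^ n \<partial>distr M borel ?h) = (\<integral>x. x ^ n \<partial>distr N borel ?h)"
      using lap[of n] by (simp add: integral_distr hm p)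
  qed (use M N hm ae in \<open>auto intro: finite_measure.finite_measure_distr\<close>)
  have recover: "distr (distr K borel ?h) borel (\<lambda>x. - ln x) = K" if "sets K = sets borel" "?h \<in> measurable K borel" for K
    using that by (subst distr_distr) (auto simp: comp_def intro: distr_id2)
  show ?thesis using recover[OF M(2) hm(1)] recover[OF N(2) hm(2)] eq by metis
qed

text \<open>The variables are treated one after the other. Weighting by
  \<open>exp (- n * snd z)\<close> and projecting to the first coordinate leaves a sine transform,
  which is decisive on sets of positive numbers because their reflections are null. Restricting to
  such a set and projecting to the second coordinate leaves a Laplace transform. An atom at
  \<open>fst z = 0\<close> is invisible to the sine, whence the restriction on
  \<open>B\<close>.\<close>

lemma sine_laplace_transform_unique:
  fixes M N :: "(real \<times> real) measure"
  assumes M: "finite_measure M" "sets M = sets (borel \<Otimes>\<^sub>M borel)" "AE z in M. 0 \<le> fst z" "AE z in M. 0 \<le> snd z"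
    and N: "finite_measure N" "sets N = sets (borel \<Otimes>\<^sub>M borel)" "AE z in N. 0 \<le> fst z" "AE z in N. 0 \<le> snd z"
    and tr: "\<And>(n::nat) \<theta>. (\<integral>z. exp (- real n * snd z) * sin (\<theta> * fst z) \<partial>M) =
                           (\<integral>z. exp (- real n * snd z) * sin (\<theta> * fst z) \<partial>N)"
    and B: "B \<in> sets (borel \<Otimes>\<^sub>M borel)" "\<And>z. z \<in> B \<Longrightarrow> 0 < fst z"
  shows "emeasure M B = emeasure N B"
proof -
  note mc = measurable_cong_sets[OF M(2) refl] measurable_cong_sets[OF N(2) refl]
  let ?E = "\<lambda>(n::nat) z::real\<times>real. exp (- real n * snd z)"
  have Em: "?E n \<in> borel_measurable (borel \<Otimes>\<^sub>M borel)" for n by measurable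
  have step1: "(\<integral>z. indicator A (fst z) * ?E n z \<partial>M) = (\<integral>z. indicator A (fst z) * ?E n z \<partial>N)"
    if A: "A \<in> sets borel" "A \<subseteq> {0<..}" for A n
  proof -
    let ?P = "\<lambda>K. distr (density K (\<lambda>z. ennreal (?E n z))) borel fst"
    have fm: "fst \<in> measurable (density K (\<lambda>z. ennreal (?E n z))) borel" if "sets K = sets (borel \<Otimes>\<^sub>M borel)" for K
      using that by (simp add: measurable_cong_sets[OF that refl])
    have fin: "finite_measure (?P K)" if K: "finite_measure K" "sets K = sets (borel \<Otimes>\<^sub>M borel)" "AE z in K. 0 \<le> snd z" for K
    proof (rule finite_measure.finite_measure_distr[OF _ fm[OF K(2)]], rule finite_measureI)
      interpret finite_measure K by fact
      have "(\<integral>\<^sup>+z. ennreal (?E n z) \<partial>K) \<le> (\<integral>\<^sup>+z. 1 \<partial>K)"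
        using K(3) by (intro nn_integral_mono_AE) (auto elim!: eventually_mono)
      then show "emeasure (density K (\<lambda>z. ennreal (?E n z))) (space (density K (\<lambda>z. ennreal (?E n z)))) \<noteq> \<infinity>"
        using K(2) by (auto simp: emeasure_density measurable_cong_sets[OF K(2) refl] top_unique)
    qed
    have em: "emeasure (?P K) C = (\<integral>\<^sup>+z. ennreal (indicator C (fst z) * ?E n z) \<partial>K)"
      if "sets K = sets (borel \<Otimes>\<^sub>M borel)" "C \<in> sets borel" for K C
    proof -
      have "emeasure (?P K) C = (\<integral>\<^sup>+z. indicator C z \<partial>?P K)" using that by simp
      also have "\<dots> = (\<integral>\<^sup>+z. indicator C (fst z) \<partial>density K (\<lambda>z. ennreal (?E n z)))"
        by (subst nn_integral_distr[OF fm[OF that(1)]]) (use that in auto)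
      also have "\<dots> = (\<integral>\<^sup>+z. ennreal (?E n z) * indicator C (fst z) \<partial>K)"
        using that by (subst nn_integral_density) (auto simp: measurable_cong_sets[OF that(1) refl])
      finally show ?thesis by (auto simp: intro!: nn_integral_cong split: split_indicator)
    qed
    have i: "(\<integral>x. sin (\<theta> * x) \<partial>?P K) = (\<integral>z. ?E n z * sin (\<theta> * fst z) \<partial>K)" if K: "sets K = sets (borel \<Otimes>\<^sub>M borel)" for K \<theta>
    proof -
      have "(\<integral>x. sin (\<theta> * x) \<partial>?P K) = (\<integral>z. sin (\<theta> * fst z) \<partial>density K (\<lambda>z. ennreal (?E n z)))"
        by (rule integral_distr[OF fm[OF K]]) simp
      also have "\<dots> = (\<integral>z. ?E n z * sin (\<theta> * fst z) \<partial>K)"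
        by (subst integral_density) (auto simp: measurable_cong_sets[OF K refl])
      finally show ?thesis .
    qed
    have neg: "emeasure (?P K) (uminus -` A) = 0" if K: "sets K = sets (borel \<Otimes>\<^sub>M borel)" "AE z in K. 0 \<le> fst z" for K
    proof -
      have A': "uminus -` A \<in> sets borel" using measurable_sets[of uminus borel borel A] A(1) by simp
      have "AE z in K. ennreal (indicator (uminus -` A) (fst z) * ?E n z) = 0"
        using K(2) A(2) by (auto elim!: eventually_mono split: split_indicator)
      then show ?thesis unfolding em[OF K(1) A'] by (subst nn_integral_0_iff_AE) (use A' in \<open>auto simp: measurable_cong_sets[OF K(1) refl]\<close>)
    qed
    have "emeasure (?P M) A = emeasure (?P N) A"
    proof -
      have "(\<integral>x. sin (\<theta> * x) \<partial>?P M) = (\<integral>x. sin (\<theta> * x) \<partial>?P N)" for \<theta>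
        unfolding i[OF M(2)] i[OF N(2)] by (rule tr)
      from sine_transform_unique[OF fin[OF M(1,2,4)] _ fin[OF N(1,2,4)] _ this A(1)]
      show ?thesis unfolding neg[OF M(2,3)] neg[OF N(2,3)] by simp
    qed
    then have "enn2real (\<integral>\<^sup>+z. ennreal (indicator A (fst z) * ?E n z) \<partial>M) = enn2real (\<integral>\<^sup>+z. ennreal (indicator A (fst z) * ?E n z) \<partial>N)"
      unfolding em[OF M(2) A(1)] em[OF N(2) A(1)] by simp
    then show ?thesis
      using A(1) by (subst (1 2) integral_eq_nn_integral) (auto simp: mc split: split_indicator)
  qed
  have step2: "emeasure M (A \<times> C) = emeasure N (A \<times> C)"
    if A: "A \<in> sets borel" "A \<subseteq> {0<..}" and C: "C \<in> sets borel" for A C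
  proof -
    let ?Q = "\<lambda>K. distr (density K (\<lambda>z. ennreal (indicator A (fst z)))) borel snd"
    have sm: "snd \<in> measurable (density K (\<lambda>z. ennreal (indicator A (fst z)))) borel" if "sets K = sets (borel \<Otimes>\<^sub>M borel)" for K
      using that by (simp add: measurable_cong_sets[OF that refl])
    have fin: "finite_measure (?Q K)" if K: "finite_measure K" "sets K = sets (borel \<Otimes>\<^sub>M borel)" for K
    proof (rule finite_measure.finite_measure_distr[OF _ sm[OF K(2)]], rule finite_measureI)
      interpret finite_measure K by fact
      have "(\<integral>\<^sup>+z. ennreal (indicator A (fst z)) \<partial>K) \<le> (\<integral>\<^sup>+z. 1 \<partial>K)"
        by (intro nn_integral_mono) (auto split: split_indicator)
      then show "emeasure (density K (\<lambda>z. ennreal (indicator A (fst z)))) (space (density K (\<lambda>z. ennreal (indicator A (fst z))))) \<noteq> \<infinity>"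
        using A K(2) by (auto simp: emeasure_density measurable_cong_sets[OF K(2) refl] top_unique)
    qed
    have ae: "AE x in ?Q K. 0 \<le> x" if K: "sets K = sets (borel \<Otimes>\<^sub>M borel)" "AE z in K. 0 \<le> snd z" for K :: "(real \<times> real) measure"
      using that A by (subst AE_distr_iff[OF sm[OF K(1)]]) (auto simp: AE_density measurable_cong_sets[OF K(1) refl] elim: eventually_mono)
    have i: "(\<integral>x. exp (- real n * x) \<partial>?Q K) = (\<integral>z. indicator A (fst z) * ?E n z \<partial>K)" if K: "sets K = sets (borel \<Otimes>\<^sub>M borel)" for K n
    proof -
      have "(\<integral>x. exp (- real n * x) \<partial>?Q K) = (\<integral>z. ?E n z \<partial>density K (\<lambda>z. ennreal (indicator A (fst z))))"
        by (rule integral_distr[OF sm[OF K]]) simp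
      also have "\<dots> = (\<integral>z. indicator A (fst z) * ?E n z \<partial>K)"
        using A by (subst integral_density) (auto simp: measurable_cong_sets[OF K refl])
      finally show ?thesis .
    qed
    have QQ: "?Q M = ?Q N"
    proof (rule laplace_transform_unique[OF fin[OF M(1,2)] _ ae[OF M(2,4)] fin[OF N(1,2)] _ ae[OF N(2,4)]])
      show "(\<integral>x. exp (- real n * x) \<partial>?Q M) = (\<integral>x. exp (- real n * x) \<partial>?Q N)" for n
        unfolding i[OF M(2)] i[OF N(2)] by (rule step1[OF A])
    qed simp_all
    have eC: "emeasure (?Q K) C = emeasure K (A \<times> C)" if "sets K = sets (borel \<Otimes>\<^sub>M borel)" for K
    proof -
      have "emeasure (?Q K) C = (\<integral>\<^sup>+z. indicator C z \<partial>?Q K)" using C by simp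
      also have "\<dots> = (\<integral>\<^sup>+z. indicator C (snd z) \<partial>density K (\<lambda>z. ennreal (indicator A (fst z))))"
        by (subst nn_integral_distr[OF sm[OF that(1)]]) (use C in auto)
      also have "\<dots> = (\<integral>\<^sup>+z. ennreal (indicator A (fst z)) * indicator C (snd z) \<partial>K)"
        using that A C by (subst nn_integral_density) (auto simp: measurable_cong_sets[OF that(1) refl])
      also have "\<dots> = (\<integral>\<^sup>+z. indicator (A \<times> C) z \<partial>K)"
        by (auto simp: intro!: nn_integral_cong split: split_indicator)
      finally show ?thesis using A C by (simp add: that)
    qed
    show ?thesis
      unfolding eC[OF M(2), symmetric] eC[OF N(2), symmetric] QQ ..
  qed
  \<comment> \<open>\<open>step2\<close> covers only rectangles with positive first side. Cutting
    both measures down to positive first coordinates makes the equality hold on all rectangles,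
    which generate the product algebra.\<close>
  let ?D = "{0::real<..} \<times> (UNIV :: real set)"
  have D: "?D \<in> sets (borel \<Otimes>\<^sub>M borel)" by simp
  let ?R = "\<lambda>K. density K (indicator ?D)"
  have eR: "emeasure (?R K) C = emeasure K (?D \<inter> C)" if "sets K = sets (borel \<Otimes>\<^sub>M borel)" "C \<in> sets (borel \<Otimes>\<^sub>M borel)" for K C
    using that D by (simp add: emeasure_density indicator_inter_arith[symmetric] measurable_cong_sets[OF that(1) refl])
  have "?R M = ?R N"
  proof (rule measure_eqI_generator_eq[where E="{A \<times> C | A C. A \<in> sets borel \<and> C \<in> sets borel}" and \<Omega>=UNIV and A="\<lambda>_. UNIV"])
    show "Int_stable {A \<times> C | A C. A \<in> sets (borel::real measure) \<and> C \<in> sets (borel::real measure)}"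
      using Int_stable_pair_measure_generator[of "borel::real measure" "borel :: real measure"] by simp
    show "emeasure (?R M) Y = emeasure (?R N) Y" if Y: "Y \<in> {A \<times> C | A C. A \<in> sets borel \<and> C \<in> sets borel}" for Y
    proof -
      obtain A C where AC: "Y = A \<times> C" "A \<in> sets borel" "C \<in> sets borel" using Y by auto
      have "emeasure (?R K) Y = emeasure K (({0<..} \<inter> A) \<times> C)" if "sets K = sets (borel \<Otimes>\<^sub>M borel)" for K
        using eR[OF that, of Y] AC by (simp add: Times_Int_Times)
      then show ?thesis using step2[of "{0<..} \<inter> A" C] AC M(2) N(2) by simp
    qed
    show "sets (?R M) = sigma_sets UNIV {A \<times> C | A C. A \<in> sets borel \<and> C \<in> sets borel}"
      "sets (?R N) = sigma_sets UNIV {A \<times> C | A C. A \<in> sets borel \<and> C \<in> sets borel}"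
      by (simp_all add: M(2) N(2) sets_pair_measure)
    have "(UNIV :: (real \<times> real) set) \<in> {A \<times> C | A C. A \<in> sets borel \<and> C \<in> sets borel}"
      by (rule CollectI, rule exI[of _ UNIV], rule exI[of _ UNIV]) simp
    then show "range (\<lambda>_::nat. UNIV) \<subseteq> {A \<times> C | A C. A \<in> sets (borel::real measure) \<and> C \<in> sets (borel::real measure)}"
      by (simp add: image_subset_iff)
    have U: "UNIV \<in> sets (borel \<Otimes>\<^sub>M borel :: (real \<times> real) measure)"
      using sets.top[of "borel \<Otimes>\<^sub>M borel :: (real \<times> real) measure"] by (simp add: space_pair_measure)
    then show "emeasure (?R M) UNIV \<noteq> \<infinity>" for i :: nat
      unfolding eR[OF M(2) U] using M(1) by (simp add: finite_measure.emeasure_finite)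
  qed auto
  moreover have "?D \<inter> B = B" using B(2) by force
  ultimately show ?thesis using eR[OF M(2) B(1)] eR[OF N(2) B(1)] by simp
qed

section \<open>Hitting time densities\<close>

text \<open>As a function of \<open>b\<close> this is also minus the derivative of the centred
  normal density of variance \<open>v\<close>, and both readings are used. At \<open>v = 0\<close>
  division by zero gives the value 0.\<close>

definition hitting_density :: "real \<Rightarrow> real \<Rightarrow> real" where
  "hitting_density b v = b / sqrt (2 * pi * v ^ 3) * exp (- (b\<^sup>2 / (2 * v)))"

lemma hitting_density_measurable [measurable (raw)]:
  assumes [measurable]: "f \<in> borel_measurable M" "h \<in> borel_measurable M"
  shows "(\<lambda>x. hitting_density (f x) (h x)) \<in> borel_measurable M"
  unfolding hitting_density_def by measurable

lemma hitting_density_nonneg: "0 \<le> b \<Longrightarrow> 0 < v \<Longrightarrow> 0 \<le> hitting_density b v"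
  unfolding hitting_density_def by simp

lemma sqrt_cube: "0 < v \<Longrightarrow> sqrt (v ^ 3) = v * sqrt (v::real)"
  by (simp add: power3_eq_cube real_sqrt_mult)

lemma hitting_density_eq_normal:
  assumes "0 < v"
  shows "hitting_density b v = (b / v) * normal_density 0 (sqrt v) b"
  using assms by (simp add: hitting_density_def normal_density_def real_sqrt_mult sqrt_cube field_simps)

lemma integrable_hitting_density: "0 < v \<Longrightarrow> integrable lborel (\<lambda>b. hitting_density b v)"
  using integrable_mult_right[OF integrable_normal_moment_nz_1[of "sqrt v" 0], of "1 / v"]
  by (simp add: hitting_density_eq_normal field_simps)

section \<open>Gaussian transforms and the sine transforms of the two spatial densities\<close>

lemma normal_density_transform:
  assumes "0 < \<sigma>"
  shows "(LBINT y. normal_density \<mu> \<sigma> y * cos (\<theta> * y)) = exp (- (\<theta>\<^sup>2 * \<sigma>\<^sup>2 / 2)) * cos (\<theta> * \<mu>)"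
    and "(LBINT y. normal_density \<mu> \<sigma> y * sin (\<theta> * y)) = exp (- (\<theta>\<^sup>2 * \<sigma>\<^sup>2 / 2)) * sin (\<theta> * \<mu>)"
proof -
  interpret real_distribution std_normal_distribution by (rule real_dist_normal_dist)
  have c: "(CLINT x|std_normal_distribution. iexp (t * x)) = of_real (exp (- (t\<^sup>2) / 2))" for t
    using fun_cong[OF char_std_normal_distribution, of t] by (simp add: char_def)
  have i: "integrable std_normal_distribution (\<lambda>x. iexp (t * x))" for t
    by (rule integrable_iexp) auto
  have C: "(LBINT z. std_normal_density z * cos (t * z)) = exp (- (t\<^sup>2) / 2)" for t
    using integral_Re[OF i[of t]] c[of t] by (simp add: Re_exp integral_density)
  have S: "(LBINT z. std_normal_density z * sin (t * z)) = 0" for t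
    using integral_Im[OF i[of t]] c[of t] by (simp add: Im_exp integral_density)
  have iC: "integrable lborel (\<lambda>z. std_normal_density z * cos (t * z))" for t
    by (rule Bochner_Integration.integrable_bound[OF integrable_normal_density[of 1 0]])
      (auto simp: abs_mult intro!: mult_left_le)
  have iS: "integrable lborel (\<lambda>z. std_normal_density z * sin (t * z))" for t
    by (rule Bochner_Integration.integrable_bound[OF integrable_normal_density[of 1 0]])
      (auto simp: abs_mult intro!: mult_left_le)
  have n: "\<sigma> * normal_density \<mu> \<sigma> (\<mu> + \<sigma> * z) = std_normal_density z" for z
    using assms by (simp add: normal_density_def real_sqrt_mult power_mult_distrib field_simps)
  have "(LBINT y. normal_density \<mu> \<sigma> y * cos (\<theta> * y)) =
      (LBINT z. \<sigma> * (normal_density \<mu> \<sigma> (\<mu> + \<sigma> * z) * cos (\<theta> * (\<mu> + \<sigma> * z))))"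
    using assms by (subst lborel_integral_real_affine[where c=\<sigma> and t=\<mu>]) auto
  also have "\<dots> = (LBINT z. cos (\<theta> * \<mu>) * (std_normal_density z * cos ((\<theta> * \<sigma>) * z)) -
      sin (\<theta> * \<mu>) * (std_normal_density z * sin ((\<theta> * \<sigma>) * z)))"
    by (rule Bochner_Integration.integral_cong[OF refl]) (simp add: n[symmetric] distrib_left cos_add algebra_simps)
  also have "\<dots> = exp (- (\<theta>\<^sup>2 * \<sigma>\<^sup>2 / 2)) * cos (\<theta> * \<mu>)"
    using iC iS C S by (simp add: power_mult_distrib)
  finally show "(LBINT y. normal_density \<mu> \<sigma> y * cos (\<theta> * y)) = exp (- (\<theta>\<^sup>2 * \<sigma>\<^sup>2 / 2)) * cos (\<theta> * \<mu>)" .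
  have "(LBINT y. normal_density \<mu> \<sigma> y * sin (\<theta> * y)) =
      (LBINT z. \<sigma> * (normal_density \<mu> \<sigma> (\<mu> + \<sigma> * z) * sin (\<theta> * (\<mu> + \<sigma> * z))))"
    using assms by (subst lborel_integral_real_affine[where c=\<sigma> and t=\<mu>]) auto
  also have "\<dots> = (LBINT z. sin (\<theta> * \<mu>) * (std_normal_density z * cos ((\<theta> * \<sigma>) * z)) +
      cos (\<theta> * \<mu>) * (std_normal_density z * sin ((\<theta> * \<sigma>) * z)))"
    by (rule Bochner_Integration.integral_cong[OF refl]) (simp add: n[symmetric] distrib_left sin_add algebra_simps)
  also have "\<dots> = exp (- (\<theta>\<^sup>2 * \<sigma>\<^sup>2 / 2)) * sin (\<theta> * \<mu>)"
    using iC iS C S by (simp add: power_mult_distrib)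
  finally show "(LBINT y. normal_density \<mu> \<sigma> y * sin (\<theta> * y)) = exp (- (\<theta>\<^sup>2 * \<sigma>\<^sup>2 / 2)) * sin (\<theta> * \<mu>)" .
qed

lemma integrable_normal_density_mult:
  assumes "0 < \<sigma>" "f \<in> borel_measurable borel" "\<And>y. \<bar>f y\<bar> \<le> 1"
  shows "integrable lborel (\<lambda>y. normal_density \<mu> \<sigma> y * f y)"
  using assms by (intro Bochner_Integration.integrable_bound[OF integrable_normal_density[of \<sigma> \<mu>]])
      (auto simp: abs_mult intro!: mult_left_le)

lemma integral_half_line_even:
  fixes f :: "real \<Rightarrow> real"
  assumes f: "integrable lborel f" and even: "\<And>y. f (- y) = f y"
  shows "(LBINT y:{0<..}. f y) = (LBINT y. f y) / 2"
proof -
  have "set_integrable lborel {0..} f"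
    using integrable_mult_indicator[OF _ f, of "{0..}"] by (simp add: set_integrable_def)
  then have "has_bochner_integral lborel (\<lambda>x. indicator {0..} x *\<^sub>R f x) (LBINT y:{0..}. f y)"
    by (simp add: has_bochner_integral_iff set_integrable_def set_lebesgue_integral_def)
  from has_bochner_integral_even_function[OF this even]
  have "(LBINT y. f y) = 2 * (LBINT y:{0..}. f y)"
    by (simp add: has_bochner_integral_iff)
  moreover have "(LBINT y:{0..}. f y) = (LBINT y:{0<..}. f y)"
    unfolding set_lebesgue_integral_def
    using f AE_lborel_singleton[of "0::real"]
    by (intro integral_cong_AE) (auto elim!: eventually_mono split: split_indicator)
  ultimately show ?thesis by simp
qed

text \<open>In \<open>y\<close> the hitting density is minus the derivative of a Gaussian density,
  so integration by parts turns the sine into \<open>\<theta>\<close> times a cosine, whose Gaussian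
  transform is known. The integrand is even, so the half line carries half of the full integral,
  which the factor 2 compensates.\<close>

lemma hitting_density_sine_transform:
  assumes r: "0 < r"
  shows "(LBINT y:{0<..}. 2 * hitting_density y r * sin (\<theta> * y)) = \<theta> * exp (- (\<theta>\<^sup>2 * r / 2))"
proof -
  let ?n = "normal_density 0 (sqrt r)"
  let ?f = "\<lambda>y. hitting_density y r * sin (\<theta> * y) - \<theta> * (?n y * cos (\<theta> * y))"
  let ?F = "\<lambda>y. - (?n y * sin (\<theta> * y))"
  have i1: "integrable lborel (\<lambda>y. hitting_density y r * sin (\<theta> * y))"
    by (rule Bochner_Integration.integrable_bound[OF integrable_norm[OF integrable_hitting_density[OF r]]])
      (auto simp: abs_mult intro!: mult_left_le)
  have i2: "integrable lborel (\<lambda>y. ?n y * cos (\<theta> * y))"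
    using r by (intro integrable_normal_density_mult) auto
  have i: "integrable lborel ?f" using i1 i2 by simp
  have "(LBINT y=-\<infinity>..\<infinity>. ?f y) = 0 - 0"
  proof (rule interval_integral_FTC_integrable)
    fix y :: real
    define c where "c = 1 / sqrt (2 * pi * r)"
    have c: "?n = (\<lambda>y. c * exp (- (y\<^sup>2 / (2 * r))))"
      using r by (auto simp: normal_density_def fun_eq_iff c_def)
    have "(?n has_real_derivative - (y / r * ?n y)) (at y)"
      unfolding c using r by (auto intro!: derivative_eq_intros simp: field_simps)
    then have "(?F has_real_derivative ?f y) (at y)"
      using r by (auto simp: hitting_density_eq_normal intro!: derivative_eq_intros)
    then show "(?F has_vector_derivative ?f y) (at y)"
      by (simp add: has_real_derivative_iff_has_vector_derivative)
    show "isCont ?f y"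
      using r by (auto simp: hitting_density_eq_normal normal_density_def intro!: continuous_intros)
  next
    have n1: "(?n \<longlongrightarrow> 0) at_top" "(?n \<longlongrightarrow> 0) at_bot"
      using r unfolding normal_density_def by real_asymp+
    have "((\<lambda>y. - (?n y * sin (\<theta> * y))) \<longlongrightarrow> 0) F" if "(?n \<longlongrightarrow> 0) F" for F
    proof -
      have "((\<lambda>y. ?n y * sin (\<theta> * y)) \<longlongrightarrow> 0) F"
        by (rule tendsto_0_le[OF that, of _ 1]) (auto simp: abs_mult intro!: always_eventually mult_left_le)
      from tendsto_minus[OF this] show ?thesis by simp
    qed
    from this[OF n1(1)] this[OF n1(2)]
    show "((?F \<circ> real_of_ereal) \<longlongrightarrow> 0) (at_right (-\<infinity>))" "((?F \<circ> real_of_ereal) \<longlongrightarrow> 0) (at_left \<infinity>)"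
      unfolding ereal_tendsto_simps by auto
  qed (use i in \<open>auto simp: set_integrable_def\<close>)
  then have "(LBINT y. ?f y) = 0" by (simp add: interval_integral_eq_integral' interval_lebesgue_integral_def set_lebesgue_integral_def)
  then have "(LBINT y. hitting_density y r * sin (\<theta> * y)) = \<theta> * (LBINT y. ?n y * cos (\<theta> * y))"
    using i1 i2 by simp
  also have "\<dots> = \<theta> * exp (- (\<theta>\<^sup>2 * r / 2))"
    using normal_density_transform(1)[of "sqrt r" 0 \<theta>] r by simp
  finally have tot: "(LBINT y. 2 * hitting_density y r * sin (\<theta> * y)) = 2 * (\<theta> * exp (- (\<theta>\<^sup>2 * r / 2)))"
    by (simp add: mult.assoc)
  have i3: "integrable lborel (\<lambda>y. 2 * hitting_density y r * sin (\<theta> * y))"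
    using integrable_mult_right[OF i1, of 2] by (simp add: mult.assoc)
  show ?thesis
    by (subst integral_half_line_even[OF i3]) (use tot in \<open>auto simp: hitting_density_def\<close>)
qed

lemma absorbed_density_eq_normal:
  "0 < r \<Longrightarrow> absorbed_density r x y = normal_density x (sqrt r) y - normal_density (-x) (sqrt r) y"
  by (simp add: absorbed_density_def normal_density_def right_diff_distrib)

lemma absorbed_density_nonneg: "0 < r \<Longrightarrow> 0 \<le> x \<Longrightarrow> 0 \<le> y \<Longrightarrow> 0 \<le> absorbed_density r x y"
  by (simp add: absorbed_density_def divide_right_mono abs_le_square_iff[symmetric])

text \<open>The density is the difference of Gaussians centred at \<open>x\<close> and
  \<open>- x\<close>, hence odd in \<open>y\<close>. Its product with the sine is even, and the two
  Gaussian contributions are equal, so halving the full integral leaves one of them.\<close>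

lemma absorbed_density_sine_transform:
  assumes r: "0 < r"
  shows "(LBINT y:{0<..}. absorbed_density r x y * sin (\<theta> * y)) = exp (- (\<theta>\<^sup>2 * r / 2)) * sin (\<theta> * x)"
proof -
  have e: "absorbed_density r x y * sin (\<theta> * y) =
     normal_density x (sqrt r) y * sin (\<theta> * y) - normal_density (-x) (sqrt r) y * sin (\<theta> * y)" for y
    using r by (simp add: absorbed_density_eq_normal left_diff_distrib)
  have i: "integrable lborel (\<lambda>y. normal_density \<mu> (sqrt r) y * sin (\<theta> * y))" for \<mu>
    using r by (intro integrable_normal_density_mult) auto
  have "(LBINT y. absorbed_density r x y * sin (\<theta> * y)) = 2 * (exp (- (\<theta>\<^sup>2 * r / 2)) * sin (\<theta> * x))"
    unfolding e using i r normal_density_transform(2)[of "sqrt r" x \<theta>] normal_density_transform(2)[of "sqrt r" "-x" \<theta>]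
    by simp
  moreover have "integrable lborel (\<lambda>y. absorbed_density r x y * sin (\<theta> * y))"
    unfolding e using i by simp
  moreover have "absorbed_density r x (- y) * sin (\<theta> * - y) = absorbed_density r x y * sin (\<theta> * y)" for y
  proof -
    have "(- y - x)\<^sup>2 = (y + x)\<^sup>2" "(- y + x)\<^sup>2 = (y - x)\<^sup>2" by (simp_all add: power2_eq_square algebra_simps)
    then show ?thesis by (simp add: absorbed_density_def algebra_simps)
  qed
  ultimately show ?thesis
    by (subst integral_half_line_even) auto
qed

section \<open>Integrals of the hitting density over time\<close>

lemma nn_integral_FTC_open_interval:
  fixes f F :: "real \<Rightarrow> real"
  assumes "a < b"
    and "\<And>x. a < x \<Longrightarrow> x < b \<Longrightarrow> (F has_real_derivative f x) (at x)"
    and "\<And>x. a < x \<Longrightarrow> x < b \<Longrightarrow> isCont f x"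
    and nonneg: "\<And>x. a < x \<Longrightarrow> x < b \<Longrightarrow> 0 \<le> f x"
    and "(F \<longlongrightarrow> A) (at_right a)" "(F \<longlongrightarrow> B) (at_left b)"
  shows "(\<integral>\<^sup>+x\<in>{a<..<b}. ennreal (f x) \<partial>lborel) = ennreal (B - A)"
proof -
  have 1: "set_integrable lborel (einterval (ereal a) (ereal b)) f"
    and 2: "(LBINT x=ereal a..ereal b. f x) = B - A"
    using assms by (intro interval_integral_FTC_nonneg[of a b F f A B]; simp add: ereal_tendsto_simps)+
  have "(\<integral>\<^sup>+x\<in>{a<..<b}. ennreal (f x) \<partial>lborel) = (\<integral>\<^sup>+x. ennreal (indicator {a<..<b} x *\<^sub>R f x) \<partial>lborel)"
    by (intro nn_integral_cong) (auto split: split_indicator)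
  also have "\<dots> = ennreal (LBINT x:{a<..<b}. f x)"
    using 1 nonneg unfolding set_lebesgue_integral_def set_integrable_def
    by (intro nn_integral_eq_integral) (auto split: split_indicator)
  also have "(LBINT x:{a<..<b}. f x) = B - A"
    using 2 \<open>a < b\<close> by (simp add: interval_lebesgue_integral_def)
  finally show ?thesis .
qed

abbreviation std_normal_cdf :: "real \<Rightarrow> real" where
  "std_normal_cdf \<equiv> cdf std_normal_distribution"

lemma has_real_derivative_std_normal_cdf:
  "(std_normal_cdf has_real_derivative std_normal_density x) (at x)"
proof -
  interpret real_distribution std_normal_distribution by (rule real_dist_normal_dist)
  \<comment> \<open>Any point below \<open>x\<close> would do as base point: near \<open>x\<close>
    the distribution function is then a constant plus an integral with variable upper limit.\<close>
  let ?a = "x - 1" and ?b = "x + 1"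
  have eq: "std_normal_cdf u = std_normal_cdf ?a + (LBINT y=?a..u. std_normal_density y)" if "?a < u" for u
  proof -
    have "std_normal_cdf u - std_normal_cdf ?a = measure std_normal_distribution {?a<..u}"
      using that by (rule cdf_diff_eq)
    also have "\<dots> = (LINT y|std_normal_distribution. indicator {?a<..u} y)" by simp
    also have "\<dots> = (LBINT y. std_normal_density y * indicator {?a<..u} y)"
      by (subst integral_density) auto
    also have "\<dots> = (LBINT y=?a..u. std_normal_density y)"
      using that by (simp add: interval_integral_Ioc set_lebesgue_integral_def mult.commute)
    finally show ?thesis by simp
  qed
  have "((\<lambda>u. LBINT y=?a..u. std_normal_density y) has_vector_derivative std_normal_density x) (at x within {?a..?b})"
    by (rule interval_integral_FTC2) (auto simp: normal_density_def intro!: continuous_intros)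
  then have "((\<lambda>u. LBINT y=?a..u. std_normal_density y) has_real_derivative std_normal_density x) (at x)"
    by (simp add: has_real_derivative_iff_has_vector_derivative at_within_Icc_at)
  then have "((\<lambda>u. std_normal_cdf ?a + (LBINT y=?a..u. std_normal_density y)) has_real_derivative std_normal_density x) (at x)"
    by (auto intro!: derivative_eq_intros)
  then show ?thesis
  proof (rule DERIV_cong_ev[THEN iffD1, rotated -1])
    have "\<forall>\<^sub>F u in nhds x. ?a < u" by (intro eventually_nhds_in_open[of "{?a<..}", simplified]) auto
    then show "\<forall>\<^sub>F u in nhds x. std_normal_cdf ?a + (LBINT y=?a..u. std_normal_density y) = std_normal_cdf u"
      by eventually_elim (use eq in auto)
  qed auto
qed

lemma DERIV_std_normal_cdf_chain [derivative_intros]: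
  assumes "(f has_real_derivative d) (at x within S)"
  shows "((\<lambda>x. std_normal_cdf (f x)) has_real_derivative std_normal_density (f x) * d) (at x within S)"
  using DERIV_chain2[OF has_real_derivative_std_normal_cdf assms] .

lemma std_normal_cdf_limits:
  "(std_normal_cdf \<longlongrightarrow> 1) at_top" "(std_normal_cdf \<longlongrightarrow> 0) at_bot"
proof -
  interpret real_distribution std_normal_distribution by (rule real_dist_normal_dist)
  show "(std_normal_cdf \<longlongrightarrow> 1) at_top" "(std_normal_cdf \<longlongrightarrow> 0) at_bot"
    using cdf_lim_at_top_prob cdf_lim_at_bot by auto
qed

text \<open>This is the reflection principle: level \<open>b\<close> is reached before
  \<open>r\<close> with twice the probability that the Gaussian endpoint exceeds \<open>b\<close>.
  Analytically, the same formula with \<open>v\<close> in place of \<open>r\<close> is a primitive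
  that tends to 0 at time 0.\<close>

lemma nn_integral_hitting_density_time:
  assumes b: "0 < b" and r: "0 < r"
  shows "(\<integral>\<^sup>+v\<in>{0<..<r}. ennreal (hitting_density b v) \<partial>lborel) = ennreal (2 * (1 - std_normal_cdf (b / sqrt r)))"
proof -
  let ?F = "\<lambda>v. 2 * (1 - std_normal_cdf (b / sqrt v))"
  have D: "(?F has_real_derivative hitting_density b v) (at v)" if v: "0 < v" for v
  proof -
    have "((\<lambda>v. b / sqrt v) has_real_derivative - (b / (2 * v * sqrt v))) (at v)"
      using v by (auto intro!: derivative_eq_intros simp: field_simps)
    then have "(?F has_real_derivative 2 * (0 - std_normal_density (b / sqrt v) * - (b / (2 * v * sqrt v)))) (at v)"
      by (intro DERIV_cmult DERIV_diff DERIV_const DERIV_std_normal_cdf_chain)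
    also have "2 * (0 - std_normal_density (b / sqrt v) * - (b / (2 * v * sqrt v))) = hitting_density b v"
      using v by (simp add: hitting_density_def std_normal_density_def sqrt_cube real_sqrt_mult power_divide mult.commute)
    finally show ?thesis .
  qed
  have "(\<integral>\<^sup>+v\<in>{0<..<r}. ennreal (hitting_density b v) \<partial>lborel) = ennreal (?F r - 0)"
  proof (rule nn_integral_FTC_open_interval[OF r D])
    show "isCont (hitting_density b) v" if "0 < v" for v
      using that unfolding hitting_density_def by (auto intro!: continuous_intros)
    show "(?F \<longlongrightarrow> ?F r) (at_left r)"
      using DERIV_isCont[OF D[OF r]] by (simp add: isCont_def filterlim_at_split)
    have "filterlim (\<lambda>v. b / sqrt v) at_top (at_right 0)"
      using b by real_asymp
    then have "((\<lambda>v. std_normal_cdf (b / sqrt v)) \<longlongrightarrow> 1) (at_right 0)"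
      by (rule filterlim_compose[OF std_normal_cdf_limits(1)])
    from tendsto_mult[OF tendsto_const tendsto_diff[OF tendsto_const this], of 2 1]
    show "(?F \<longlongrightarrow> 0) (at_right 0)" by simp
  qed (use b in \<open>auto intro: hitting_density_nonneg\<close>)
  then show ?thesis by simp
qed

text \<open>
  The primitive in the first argument comes from completing squares: with \<open>p\<close> and \<open>p'\<close> below,
  \<open>a\<^sup>2/u + b\<^sup>2/(w-u) = (a+b)\<^sup>2/w + p\<^sup>2 = (a-b)\<^sup>2/w + p'\<^sup>2\<close>.
\<close>
lemma hitting_density_convolution:
  assumes a: "0 < a" and b: "0 < b" and w: "0 < w"
  shows "(\<integral>\<^sup>+u\<in>{0<..<w}. ennreal (hitting_density a u * hitting_density b (w - u)) \<partial>lborel) =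
    ennreal (hitting_density (a + b) w)"
proof -
  define D where "D u = u * (w - u) * w" for u
  define p where "p u = (a * (w - u) - b * u) / sqrt (D u)" for u
  define p' where "p' u = (a * (w - u) + b * u) / sqrt (D u)" for u
  define E where "E c = exp (- (c\<^sup>2 / (2 * w)))" for c
  define S where "S = sqrt (2 * pi)"
  define K where "K = - (1 / (S * w * sqrt w))"
  have S: "0 < S" "2 * pi = S * S" by (simp_all add: S_def)
  have h: "hitting_density c v = c / (S * (v * sqrt v)) * exp (- (c\<^sup>2 / (2 * v)))" if "0 < v" for c v
    using that by (simp add: hitting_density_def S_def real_sqrt_mult sqrt_cube)
  let ?F = "\<lambda>u. K * ((a + b) * E (a + b) * std_normal_cdf (p u) + (b - a) * E (a - b) * std_normal_cdf (p' u))"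
  have D: "(?F has_real_derivative hitting_density a u * hitting_density b (w - u)) (at u)"
    if u: "0 < u" "u < w" for u
  proof -
    define r where "r = sqrt (D u)"
    have Dpos: "0 < D u" using u w by (simp add: D_def)
    have r: "0 < r" "r\<^sup>2 = D u" using Dpos by (auto simp: r_def)
    define d where "d = (-(a + b) * D u - (a * (w - u) - b * u) * (w * (w - 2 * u)) / 2) / (r * D u)"
    define d' where "d' = (-(a - b) * D u - (a * (w - u) + b * u) * (w * (w - 2 * u)) / 2) / (r * D u)"
    have dD: "(D has_real_derivative w * (w - 2 * u)) (at u)"
      unfolding D_def by (auto intro!: derivative_eq_intros simp: algebra_simps)
    have dr: "((\<lambda>u. sqrt (D u)) has_real_derivative w * (w - 2 * u) / (2 * r)) (at u)"
      using DERIV_chain2[OF DERIV_real_sqrt[OF Dpos] dD] by (simp add: r_def field_simps)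
    have rr: "r * r = D u" using r(2) by (simp add: power2_eq_square)
    have dp: "(p has_real_derivative d) (at u)"
    proof -
      have "(p has_real_derivative ((- (a + b)) * r - (a * (w - u) - b * u) * (w * (w - 2 * u) / (2 * r))) / (r * r)) (at u)"
        unfolding p_def r_def
        by (rule DERIV_divide) (use dr r in \<open>auto intro!: derivative_eq_intros simp: r_def\<close>)
      also have "((- (a + b)) * r - (a * (w - u) - b * u) * (w * (w - 2 * u) / (2 * r))) / (r * r) = d"
        unfolding d_def rr[symmetric] using r(1) by (simp add: field_simps)
      finally show ?thesis .
    qed
    have dp': "(p' has_real_derivative d') (at u)"
    proof -
      have "(p' has_real_derivative ((- (a - b)) * r - (a * (w - u) + b * u) * (w * (w - 2 * u) / (2 * r))) / (r * r)) (at u)"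
        unfolding p'_def r_def
        by (rule DERIV_divide) (use dr r in \<open>auto intro!: derivative_eq_intros simp: r_def\<close>)
      also have "((- (a - b)) * r - (a * (w - u) + b * u) * (w * (w - 2 * u) / (2 * r))) / (r * r) = d'"
        unfolding d'_def rr[symmetric] using r(1) by (simp add: field_simps)
      finally show ?thesis .
    qed
    define G where "G = exp (- (a\<^sup>2 / (2 * u))) * exp (- (b\<^sup>2 / (2 * (w - u))))"
    have G: "G = exp (- ((a\<^sup>2 / u + b\<^sup>2 / (w - u)) / 2))"
      by (simp add: G_def exp_add[symmetric] add_divide_distrib mult.commute)
    have sq: "(p u)\<^sup>2 = (a * (w - u) - b * u)\<^sup>2 / D u" "(p' u)\<^sup>2 = (a * (w - u) + b * u)\<^sup>2 / D u"
      using Dpos by (simp_all add: p_def p'_def power_divide)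
    have "(a + b)\<^sup>2 / w + (p u)\<^sup>2 = a\<^sup>2 / u + b\<^sup>2 / (w - u)"
      unfolding sq D_def using u w by (simp add: divide_simps) algebra
    moreover have "E (a + b) * std_normal_density (p u) = exp (- (((a + b)\<^sup>2 / w + (p u)\<^sup>2) / 2)) / sqrt (2 * pi)"
      by (simp add: E_def std_normal_density_def exp_add[symmetric] add_divide_distrib mult.commute)
    ultimately have e1: "E (a + b) * std_normal_density (p u) = G / sqrt (2 * pi)"
      by (simp only: G)
    have "(a - b)\<^sup>2 / w + (p' u)\<^sup>2 = a\<^sup>2 / u + b\<^sup>2 / (w - u)"
      unfolding sq D_def using u w by (simp add: divide_simps) algebra
    moreover have "E (a - b) * std_normal_density (p' u) = exp (- (((a - b)\<^sup>2 / w + (p' u)\<^sup>2) / 2)) / sqrt (2 * pi)"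
      by (simp add: E_def std_normal_density_def exp_add[symmetric] add_divide_distrib mult.commute)
    ultimately have e2: "E (a - b) * std_normal_density (p' u) = G / sqrt (2 * pi)"
      by (simp only: G)
    \<comment> \<open>Once the Gaussian factors have merged into the common factor \<open>G\<close>,
      the weights \<open>a + b\<close> and \<open>b - a\<close> make the polynomial parts of
      \<open>d\<close> and \<open>d'\<close> collapse into a single monomial. This is the purpose of
      the weights.\<close>
    have "(?F has_real_derivative K * ((a + b) * E (a + b) * (std_normal_density (p u) * d) + (b - a) * E (a - b) * (std_normal_density (p' u) * d'))) (at u)"
      using dp dp' by (auto intro!: derivative_eq_intros)
    also have "K * ((a + b) * E (a + b) * (std_normal_density (p u) * d) + (b - a) * E (a - b) * (std_normal_density (p' u) * d')) =
        K * ((a + b) * (E (a + b) * std_normal_density (p u)) * d + (b - a) * (E (a - b) * std_normal_density (p' u)) * d')"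
      by simp
    also have "\<dots> = K * G / sqrt (2 * pi) * ((a + b) * d + (b - a) * d')"
      unfolding e1 e2 by (simp add: field_simps)
    also have "(a + b) * d + (b - a) * d' = - a * b * w ^ 3 / (r * D u)"
    proof -
      have "(a + b) * d + (b - a) * d' = ((a + b) * (-(a + b) * D u - (a * (w - u) - b * u) * (w * (w - 2 * u)) / 2)
         + (b - a) * (-(a - b) * D u - (a * (w - u) + b * u) * (w * (w - 2 * u)) / 2)) / (r * D u)"
        unfolding d_def d'_def by (simp add: add_divide_distrib)
      also have "(a + b) * (-(a + b) * D u - (a * (w - u) - b * u) * (w * (w - 2 * u)) / 2)
         + (b - a) * (-(a - b) * D u - (a * (w - u) + b * u) * (w * (w - 2 * u)) / 2) = - a * b * w ^ 3"
        unfolding D_def by (simp add: field_simps power2_eq_square power3_eq_cube)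
      finally show ?thesis .
    qed
    also have "K * G / sqrt (2 * pi) * (- a * b * w ^ 3 / (r * D u)) = hitting_density a u * hitting_density b (w - u)"
    proof -
      have rs: "r = sqrt u * sqrt (w - u) * sqrt w" by (simp add: r_def D_def real_sqrt_mult)
      have hK: "K * G / sqrt (2 * pi) = - (G / (S * S * w * sqrt w))"
        by (simp add: K_def S_def[symmetric])
      have hh: "hitting_density a u * hitting_density b (w - u) =
          a * b * G / (S * S * (u * sqrt u) * ((w - u) * sqrt (w - u)))"
        using u by (simp add: h G_def mult_ac)
      have "sqrt w * sqrt w = w" using w by simp
      then show ?thesis
        unfolding hK hh rs D_def using u w S(1) by (simp add: divide_simps power3_eq_cube)
    qed
    finally show ?thesis .
  qed
  \<comment> \<open>\<open>p'\<close> tends to infinity at both ends, so the second summand of the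
    primitive contributes equally to \<open>?A\<close> and \<open>?B\<close> and cancels.
    \<open>p\<close> runs from plus to minus infinity, and the first summand alone gives the
    result.\<close>
  have "filterlim p at_top (at_right 0)" "filterlim p at_bot (at_left w)"
    "filterlim p' at_top (at_right 0)" "filterlim p' at_top (at_left w)"
    unfolding p_def p'_def D_def using a b w by real_asymp+
  note lims = filterlim_compose[OF std_normal_cdf_limits(1) this(1)] filterlim_compose[OF std_normal_cdf_limits(2) this(2)]
    filterlim_compose[OF std_normal_cdf_limits(1) this(3)] filterlim_compose[OF std_normal_cdf_limits(1) this(4)]
  let ?A = "K * ((a + b) * E (a + b) * 1 + (b - a) * E (a - b) * 1)"
  let ?B = "K * ((a + b) * E (a + b) * 0 + (b - a) * E (a - b) * 1)"
  have "(\<integral>\<^sup>+u\<in>{0<..<w}. ennreal (hitting_density a u * hitting_density b (w - u)) \<partial>lborel) = ennreal (?B - ?A)"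
  proof (rule nn_integral_FTC_open_interval[OF w D])
    show "isCont (\<lambda>u. hitting_density a u * hitting_density b (w - u)) u" if "0 < u" "u < w" for u
      using that unfolding hitting_density_def by (auto intro!: continuous_intros)
    show "(?F \<longlongrightarrow> ?A) (at_right 0)"
      using lims by (intro tendsto_intros)
    show "(?F \<longlongrightarrow> ?B) (at_left w)"
      using lims by (intro tendsto_intros)
  qed (use a b in \<open>auto intro!: mult_nonneg_nonneg hitting_density_nonneg\<close>)
  also have "?B - ?A = - K * (a + b) * E (a + b)"
    by (simp add: algebra_simps)
  also have "\<dots> = hitting_density (a + b) w"
    unfolding h[OF w] by (simp add: K_def E_def mult_ac)
  finally show ?thesis .
qed

section \<open>The inverse of the local time\<close>

locale local_time_paths = prob_space M for M :: "'w measure" +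
  fixes s t l0 :: real and L :: "real \<Rightarrow> 'w \<Rightarrow> real"
  assumes s_less_t: "s < t"
    and L_measurable [measurable]: "L u \<in> borel_measurable M"
    and L_continuous: "\<omega> \<in> space M \<Longrightarrow> continuous_on {s..t} (\<lambda>u. L u \<omega>)"
    and L_mono: "\<omega> \<in> space M \<Longrightarrow> s \<le> u \<Longrightarrow> u \<le> v \<Longrightarrow> v \<le> t \<Longrightarrow> L u \<omega> \<le> L v \<omega>"
    and L_start: "\<omega> \<in> space M \<Longrightarrow> L s \<omega> = l0"
begin

definition clock_region :: "('w \<times> real) set" where
  "clock_region = {z \<in> space (M \<Otimes>\<^sub>M lborel). l0 < snd z \<and> snd z \<le> L t (fst z)}"

text \<open>The value \<open>t\<close> off the region is a convention that keeps the function within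
  \<open>{s..t}\<close>, so that the bound by \<open>t\<close> holds everywhere.\<close>

definition inverse_clock :: "'w \<times> real \<Rightarrow> real" where
  "inverse_clock z = (if z \<in> clock_region then Inf {u \<in> {s..t}. snd z \<le> L u (fst z)} else t)"

text \<open>Integrating against this measure means taking the expectation of an integral over the
  levels passed by the local time. By the substitution \<open>l = L u\<close> it stands for the
  expectation of a \<open>dL\<close>-integral over \<open>{s..t}\<close>.\<close>

definition clock_measure :: "('w \<times> real) measure" where
  "clock_measure = density (M \<Otimes>\<^sub>M lborel) (indicator clock_region)"

lemma clock_region_sets [measurable]: "clock_region \<in> sets (M \<Otimes>\<^sub>M lborel)"
  unfolding clock_region_def by measurable

text \<open>Continuity makes the set of times at which the level has been reached closed, so the
  infimum is attained. With monotonicity this yields the Galois connection in the last item, the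
  link between statements about times and statements about levels.\<close>

lemma inverse_clock_mem:
  assumes z: "z \<in> clock_region"
  shows "inverse_clock z \<in> {s..t}" "snd z \<le> L (inverse_clock z) (fst z)"
    and "u \<in> {s..t} \<Longrightarrow> inverse_clock z \<le> u \<longleftrightarrow> snd z \<le> L u (fst z)"
proof -
  let ?S = "{u \<in> {s..t}. snd z \<le> L u (fst z)}"
  have \<omega>: "fst z \<in> space M" using z by (auto simp: clock_region_def space_pair_measure)
  have "closed ?S"
    using continuous_closed_preimage[OF L_continuous[OF \<omega>] closed_atLeastAtMost closed_atLeast[of "snd z"]]
    by (simp add: vimage_def Int_def conj_commute)
  moreover have "t \<in> ?S" using z s_less_t by (auto simp: clock_region_def)
  moreover have bd: "bdd_below ?S" by (rule bdd_belowI[of _ s]) auto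
  ultimately have "Inf ?S \<in> ?S" by (intro closed_contains_Inf) auto
  then have m: "inverse_clock z \<in> ?S" using z by (simp add: inverse_clock_def)
  then show "inverse_clock z \<in> {s..t}" "snd z \<le> L (inverse_clock z) (fst z)" by auto
  show "inverse_clock z \<le> u \<longleftrightarrow> snd z \<le> L u (fst z)" if u: "u \<in> {s..t}"
  proof
    assume "inverse_clock z \<le> u"
    then show "snd z \<le> L u (fst z)"
      using m L_mono[OF \<omega>, of "inverse_clock z" u] u by auto
  next
    assume "snd z \<le> L u (fst z)"
    then show "inverse_clock z \<le> u"
      using u z bd by (auto simp: inverse_clock_def intro!: cInf_lower)
  qed
qed

lemma inverse_clock_gt:
  assumes z: "z \<in> clock_region"
  shows "s < inverse_clock z"
proof -
  have "fst z \<in> space M" "l0 < snd z" using z by (auto simp: clock_region_def space_pair_measure)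
  then show ?thesis
    using inverse_clock_mem(3)[OF z, of s] s_less_t L_start[of "fst z"] by simp
qed

text \<open>Attaining the infimum gives only an inequality. Equality holds because the path starts
  at \<open>l0\<close>, below the level, and being continuous cannot jump over it.\<close>

lemma L_inverse_clock:
  assumes z: "z \<in> clock_region"
  shows "L (inverse_clock z) (fst z) = snd z"
proof -
  have \<omega>: "fst z \<in> space M" using z by (auto simp: clock_region_def space_pair_measure)
  note m = inverse_clock_mem[OF z]
  have "\<exists>x. s \<le> x \<and> x \<le> inverse_clock z \<and> L x (fst z) = snd z"
    using m(1,2) z L_start[OF \<omega>] continuous_on_subset[OF L_continuous[OF \<omega>], of "{s..inverse_clock z}"]
    by (intro IVT') (auto simp: clock_region_def)
  then obtain x where x: "s \<le> x" "x \<le> inverse_clock z" "L x (fst z) = snd z" by auto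
  then have "inverse_clock z \<le> x" using m(1) m(3)[of x] by auto
  with x show ?thesis by simp
qed

lemma inverse_clock_measurable [measurable]: "inverse_clock \<in> borel_measurable (M \<Otimes>\<^sub>M lborel)"
proof (rule borel_measurableI_le)
  fix y
  consider "y < s" | "s \<le> y" "y < t" | "t \<le> y" by linarith
  then show "{z \<in> space (M \<Otimes>\<^sub>M lborel). inverse_clock z \<le> y} \<in> sets (M \<Otimes>\<^sub>M lborel)"
  proof cases
    case 1
    have "\<not> inverse_clock z \<le> y" for z
      using inverse_clock_mem(1)[of z] 1 s_less_t by (cases "z \<in> clock_region") (auto simp: inverse_clock_def)
    then show ?thesis by simp
  next
    case 2
    \<comment> \<open>The Galois connection describes the sublevel set through \<open>L y\<close> at
      the fixed time \<open>y\<close>, which is measurable.\<close>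
    have "{z \<in> space (M \<Otimes>\<^sub>M lborel). inverse_clock z \<le> y} =
        {z \<in> space (M \<Otimes>\<^sub>M lborel). z \<in> clock_region \<and> snd z \<le> L y (fst z)}"
      using inverse_clock_mem(3)[of _ y] 2 by (auto simp: inverse_clock_def[of z for z] split: if_splits)
    also have "\<dots> \<in> sets (M \<Otimes>\<^sub>M lborel)" by measurable
    finally show ?thesis .
  next
    case 3
    have "inverse_clock z \<le> y" for z
      using inverse_clock_mem(1)[of z] 3 by (cases "z \<in> clock_region") (auto simp: inverse_clock_def)
    then have "{z \<in> space (M \<Otimes>\<^sub>M lborel). inverse_clock z \<le> y} = space (M \<Otimes>\<^sub>M lborel)" by auto
    then show ?thesis by (simp only: sets.top)
  qed
qed

lemma sets_clock_measure [simp, measurable_cong]: "sets clock_measure = sets (M \<Otimes>\<^sub>M lborel)"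
  by (simp add: clock_measure_def)

lemma AE_clock_measure: "AE z in clock_measure. z \<in> clock_region"
  unfolding clock_measure_def by (subst AE_density) (auto split: split_indicator)

lemma L_bounds: "\<omega> \<in> space M \<Longrightarrow> u \<in> {s..t} \<Longrightarrow> l0 \<le> L u \<omega> \<and> L u \<omega> \<le> L t \<omega>"
  using L_mono[of \<omega> s u] L_mono[of \<omega> u t] L_start by force

lemma nn_integral_clock_measure:
  assumes [measurable]: "f \<in> borel_measurable (M \<Otimes>\<^sub>M lborel)"
  shows "(\<integral>\<^sup>+z. f z \<partial>clock_measure) = (\<integral>\<^sup>+\<omega>. (\<integral>\<^sup>+l\<in>{l0<..L t \<omega>}. f (\<omega>, l) \<partial>lborel) \<partial>M)"
proof -
  have "(\<integral>\<^sup>+z. f z \<partial>clock_measure) = (\<integral>\<^sup>+z. indicator clock_region z * f z \<partial>(M \<Otimes>\<^sub>M lborel))"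
    unfolding clock_measure_def by (subst nn_integral_density) auto
  also have "\<dots> = (\<integral>\<^sup>+\<omega>. (\<integral>\<^sup>+l. indicator clock_region (\<omega>, l) * f (\<omega>, l) \<partial>lborel) \<partial>M)"
    by (subst lborel.nn_integral_fst[symmetric]) auto
  also have "\<dots> = (\<integral>\<^sup>+\<omega>. (\<integral>\<^sup>+l\<in>{l0<..L t \<omega>}. f (\<omega>, l) \<partial>lborel) \<partial>M)"
    by (intro nn_integral_cong) (auto simp: clock_region_def space_pair_measure split: split_indicator)
  finally show ?thesis .
qed

end

locale local_time_clock = local_time_paths M s t l0 L
  for M :: "'w measure" and s t l0 :: real and L :: "real \<Rightarrow> 'w \<Rightarrow> real" +
  assumes L_integrable: "integrable M (L t)"
begin

text \<open>The total mass is the expected increment of the local time, which is where integrability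
  of \<open>L t\<close> enters.\<close>

sublocale clock: finite_measure clock_measure
proof (rule finite_measureI)
  have "emeasure clock_measure (space clock_measure) = (\<integral>\<^sup>+z. 1 \<partial>clock_measure)" by simp
  also have "\<dots> = (\<integral>\<^sup>+\<omega>. ennreal (L t \<omega> - l0) \<partial>M)"
    using L_bounds[of _ t] s_less_t
    by (subst nn_integral_clock_measure) (auto intro!: nn_integral_cong simp: L_start)
  also have "\<dots> < \<infinity>"
    using Bochner_Integration.integrable_diff[OF L_integrable, of "\<lambda>_. l0"] by (simp add: real_integrable_def top.not_eq_extremum emeasure_space_1)
  finally show "emeasure clock_measure (space clock_measure) \<noteq> \<infinity>" by simp
qed

lemma integral_clock_measure:
  fixes f :: "'w \<times> real \<Rightarrow> real"
  assumes [measurable]: "f \<in> borel_measurable (M \<Otimes>\<^sub>M lborel)"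
    and bd: "\<And>z. z \<in> clock_region \<Longrightarrow> \<bar>f z\<bar> \<le> C"
  shows "integrable clock_measure f"
    and "(\<integral>z. f z \<partial>clock_measure) = (\<integral>\<omega>. (LBINT l:{l0<..L t \<omega>}. f (\<omega>, l)) \<partial>M)"
proof -
  interpret P: pair_sigma_finite M lborel ..
  show i: "integrable clock_measure f"
    using AE_clock_measure bd by (intro clock.integrable_const_bound[of _ C]) (auto elim: eventually_mono)
  then have i': "integrable (M \<Otimes>\<^sub>M lborel) (\<lambda>z. indicator clock_region z *\<^sub>R f z)"
    unfolding clock_measure_def ennreal_indicator[symmetric] by (subst (asm) integrable_density) auto
  have "(\<integral>z. f z \<partial>clock_measure) = (\<integral>z. indicator clock_region z *\<^sub>R f z \<partial>(M \<Otimes>\<^sub>M lborel))"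
    unfolding clock_measure_def ennreal_indicator[symmetric] by (subst integral_density) auto
  also have "\<dots> = (\<integral>\<omega>. (LBINT l. indicator clock_region (\<omega>, l) *\<^sub>R f (\<omega>, l)) \<partial>M)"
    by (rule P.integral_fst'[OF i', symmetric])
  also have "\<dots> = (\<integral>\<omega>. (LBINT l:{l0<..L t \<omega>}. f (\<omega>, l)) \<partial>M)"
    unfolding set_lebesgue_integral_def
    by (intro Bochner_Integration.integral_cong) (auto simp: clock_region_def space_pair_measure split: split_indicator)
  finally show "(\<integral>z. f z \<partial>clock_measure) = (\<integral>\<omega>. (LBINT l:{l0<..L t \<omega>}. f (\<omega>, l)) \<partial>M)" .
qed

lemma inverse_clock_between:
  assumes "z \<in> clock_region" "q \<in> {s..t}" "r \<in> {s..t}"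
  shows "q < inverse_clock z \<and> inverse_clock z \<le> r \<longleftrightarrow> L q (fst z) < snd z \<and> snd z \<le> L r (fst z)"
  using inverse_clock_mem(3)[OF assms(1), of q] inverse_clock_mem(3)[OF assms(1), of r] assms by auto

text \<open>Pathwise this is the fundamental theorem of calculus in the level variable: the levels
  between \<open>L q\<close> and \<open>L r\<close> are those whose clock time lies in
  \<open>(q, r]\<close>. No differentiation along the random path is involved.\<close>

lemma integral_exp_increment:
  fixes n :: real
  assumes n: "0 \<le> n" and q: "s \<le> q" "q \<le> r" "r \<le> t"
    and W [measurable]: "W \<in> borel_measurable M" and C: "\<And>\<omega>. \<omega> \<in> space M \<Longrightarrow> \<bar>W \<omega>\<bar> \<le> C"
  shows "(\<integral>\<omega>. W \<omega> * (exp (- n * (L r \<omega> - l0)) - exp (- n * (L q \<omega> - l0))) \<partial>M) =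
    (\<integral>z. of_bool (q < inverse_clock z \<and> inverse_clock z \<le> r) * (- n * exp (- n * (snd z - l0)) * W (fst z)) \<partial>clock_measure)"
proof -
  let ?f = "\<lambda>z. of_bool (q < inverse_clock z \<and> inverse_clock z \<le> r) * (- n * exp (- n * (snd z - l0)) * W (fst z))"
  have bd: "\<bar>?f z\<bar> \<le> n * 1 * C" if z: "z \<in> clock_region" for z
  proof -
    have "exp (- n * (snd z - l0)) \<le> 1" using n z by (simp add: clock_region_def)
    moreover have "\<bar>W (fst z)\<bar> \<le> C" using z C by (auto simp: clock_region_def space_pair_measure)
    ultimately have "n * exp (- n * (snd z - l0)) * \<bar>W (fst z)\<bar> \<le> n * 1 * C"
      using n by (intro mult_mono) auto
    then show ?thesis using n \<open>\<bar>W (fst z)\<bar> \<le> C\<close> by (auto simp: abs_mult of_bool_def intro!: mult_nonneg_nonneg order_trans[OF abs_ge_zero])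
  qed
  have "?f \<in> borel_measurable (M \<Otimes>\<^sub>M lborel)" by measurable
  from integral_clock_measure(2)[OF this bd]
  have "(\<integral>z. ?f z \<partial>clock_measure) = (\<integral>\<omega>. (LBINT l:{l0<..L t \<omega>}. ?f (\<omega>, l)) \<partial>M)" .
  also have "\<dots> = (\<integral>\<omega>. W \<omega> * (exp (- n * (L r \<omega> - l0)) - exp (- n * (L q \<omega> - l0))) \<partial>M)"
  proof (rule Bochner_Integration.integral_cong[OF refl])
    fix \<omega> assume \<omega>: "\<omega> \<in> space M"
    have b: "l0 \<le> L q \<omega>" "L q \<omega> \<le> L r \<omega>" "L r \<omega> \<le> L t \<omega>"
      using L_bounds[OF \<omega>, of q] L_mono[OF \<omega>, of q r] L_bounds[OF \<omega>, of r] q by auto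
    have "(LBINT l:{l0<..L t \<omega>}. ?f (\<omega>, l)) = (LBINT l:{L q \<omega><..L r \<omega>}. (- n * exp (- n * (l - l0))) * W \<omega>)"
      unfolding set_lebesgue_integral_def
    proof (rule Bochner_Integration.integral_cong[OF refl])
      fix l :: real
      show "indicator {l0<..L t \<omega>} l *\<^sub>R ?f (\<omega>, l) = indicator {L q \<omega><..L r \<omega>} l *\<^sub>R ((- n * exp (- n * (l - l0))) * W \<omega>)"
      proof (cases "(\<omega>, l) \<in> clock_region")
        case True
        then show ?thesis using inverse_clock_between[OF True, of q r] q b
          by (auto simp: clock_region_def split: split_indicator)
      next
        case False
        then show ?thesis using \<omega> b by (auto simp: clock_region_def space_pair_measure split: split_indicator)
      qed
    qed
    also have "\<dots> = (LBINT l=L q \<omega>..L r \<omega>. (- n * exp (- n * (l - l0)))) * W \<omega>"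
      unfolding interval_integral_Ioc[OF b(2)] by (rule set_integral_mult_left)
    also have "(LBINT l=L q \<omega>..L r \<omega>. (- n * exp (- n * (l - l0)))) = exp (- n * (L r \<omega> - l0)) - exp (- n * (L q \<omega> - l0))"
    proof (rule interval_integral_FTC_finite)
      show "continuous_on {min (L q \<omega>) (L r \<omega>)..max (L q \<omega>) (L r \<omega>)} (\<lambda>l. - n * exp (- n * (l - l0)))"
        by (intro continuous_intros)
      show "((\<lambda>l. exp (- n * (l - l0))) has_vector_derivative - n * exp (- n * (l - l0)))
          (at l within {min (L q \<omega>) (L r \<omega>)..max (L q \<omega>) (L r \<omega>)})" for l
        unfolding has_real_derivative_iff_has_vector_derivative[symmetric]
        by (auto intro!: derivative_eq_intros)
    qed
    finally show "(LBINT l:{l0<..L t \<omega>}. ?f (\<omega>, l)) = W \<omega> * (exp (- n * (L r \<omega> - l0)) - exp (- n * (L q \<omega> - l0)))"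
      by (simp add: mult.commute)
  qed
  finally show ?thesis ..
qed


text \<open>
  Integration by parts for \<open>exp (- n (L - l0)) * W\<close> in expectation, where \<open>W\<close> minus the integral of
  \<open>\<beta>\<close> along the clock is a martingale: sum over a partition of \<open>[s,t]\<close> and refine.
\<close>
lemma product_identity:
  fixes n :: real and W :: "real \<Rightarrow> 'w \<Rightarrow> real" and \<beta> :: "'w \<times> real \<Rightarrow> real"
  assumes n: "0 \<le> n"
    and W [measurable]: "\<And>u. W u \<in> borel_measurable M"
    and Wc: "\<And>\<omega>. \<omega> \<in> space M \<Longrightarrow> continuous_on {s..t} (\<lambda>u. W u \<omega>)"
    and Wb: "\<And>u \<omega>. \<omega> \<in> space M \<Longrightarrow> \<bar>W u \<omega>\<bar> \<le> C"
    and \<beta> [measurable]: "\<beta> \<in> borel_measurable (M \<Otimes>\<^sub>M lborel)"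
    and \<beta>b: "\<And>z. z \<in> clock_region \<Longrightarrow> \<bar>\<beta> z\<bar> \<le> C"
    and w [measurable]: "w \<in> borel_measurable (M \<Otimes>\<^sub>M lborel)"
    and ww: "AE z in clock_measure. W (inverse_clock z) (fst z) = w z"
    and orth: "\<And>q r. s \<le> q \<Longrightarrow> q \<le> r \<Longrightarrow> r \<le> t \<Longrightarrow>
      (\<integral>\<omega>. exp (- n * (L q \<omega> - l0)) * (W r \<omega> - W q \<omega>) \<partial>M) =
      (\<integral>z. of_bool (q < inverse_clock z \<and> inverse_clock z \<le> r) * (exp (- n * (L q (fst z) - l0)) * \<beta> z) \<partial>clock_measure)"
  shows "(\<integral>\<omega>. exp (- n * (L t \<omega> - l0)) * W t \<omega> \<partial>M) - (\<integral>\<omega>. W s \<omega> \<partial>M) =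
      (\<integral>z. exp (- n * (snd z - l0)) * (\<beta> z - n * w z) \<partial>clock_measure)"
proof -
  define h where "h l = exp (- n * (l - l0))" for l
  have h_meas [measurable]: "h \<in> borel_measurable borel" unfolding h_def by measurable
  have h1: "0 \<le> h l \<and> h l \<le> 1" if "l0 \<le> l" for l using n that by (simp add: h_def)
  have hL: "\<bar>h (L u \<omega>)\<bar> \<le> 1" if "u \<in> {s..t}" "\<omega> \<in> space M" for u \<omega>
    using h1[of "L u \<omega>"] L_bounds[OF that(2,1)] by auto
  define P where "P N k = s + real k * (t - s) / real (Suc N)" for N k :: nat
  have P0: "P N 0 = s" and PN: "P N (Suc N) = t" for N by (simp_all add: P_def)
  have Pmono: "P N j \<le> P N k" if "j \<le> k" for N j k
    using that s_less_t by (simp add: P_def divide_right_mono mult_right_mono)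
  have Pmem: "P N k \<in> {s..t}" if "k \<le> Suc N" for N k
    using Pmono[of 0 k N] Pmono[of k "Suc N" N] that by (simp add: P0 PN)
  \<comment> \<open>This comes from
    \<open>h_r W_r - h_q W_q = h_q (W_r - W_q) + W_r (h_r - h_q)\<close> on a cell from
    \<open>q\<close> to \<open>r\<close>: the weight sits at the left end, as \<open>orth\<close>
    requires, and \<open>W\<close> at the right end.\<close>
  define trm where "trm N k z = h (L (P N k) (fst z)) * \<beta> z - n * h (snd z) * W (P N (Suc k)) (fst z)" for N k z
  define ind where "ind N k z = (P N k < inverse_clock z \<and> inverse_clock z \<le> P N (Suc k))" for N k z
  define \<Phi> where "\<Phi> N z = (\<Sum>k<Suc N. of_bool (ind N k z) * trm N k z)" for N z
  have tm [measurable]: "(\<lambda>z. trm N k z) \<in> borel_measurable (M \<Otimes>\<^sub>M lborel)" for N k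
    unfolding trm_def by measurable
  have im [measurable]: "Measurable.pred (M \<Otimes>\<^sub>M lborel) (\<lambda>z. ind N k z)" for N k
    unfolding ind_def by measurable
  have \<Phi>m: "(\<lambda>z. \<Phi> N z) \<in> borel_measurable (M \<Otimes>\<^sub>M lborel)" for N
    unfolding \<Phi>_def by measurable
  have C0: "0 \<le> C"
  proof -
    obtain \<omega> where "\<omega> \<in> space M" using not_empty by auto
    from order_trans[OF abs_ge_zero Wb[OF this]] show ?thesis .
  qed
  have regD: "fst z \<in> space M" "l0 < snd z" if "z \<in> clock_region" for z
    using that by (auto simp: clock_region_def space_pair_measure)
  have b1: "\<bar>h (L (P N k) (fst z)) * \<beta> z\<bar> \<le> C" if "z \<in> clock_region" "k \<le> Suc N" for N k z
    using mult_mono[OF hL[OF Pmem[OF that(2)] regD(1)[OF that(1)]] \<beta>b[OF that(1)]] by (simp add: abs_mult)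
  have b2: "\<bar>n * h (snd z) * W u (fst z)\<bar> \<le> n * C" if "z \<in> clock_region" for u z
    using mult_mono[OF _ Wb[OF regD(1)[OF that], of u], of "h (snd z)" 1] h1[of "snd z"] regD(2)[OF that] n
    by (simp add: abs_mult mult.assoc mult_left_mono)
  have tb: "\<bar>trm N k z\<bar> \<le> C + n * C" if "z \<in> clock_region" "k \<le> Suc N" for N k z
    using b1[OF that] b2[OF that(1), of "P N (Suc k)"] unfolding trm_def by linarith
  have pick: "\<exists>k\<le>N. ind N k z \<and> \<Phi> N z = trm N k z" if z: "z \<in> clock_region" for N z
  proof -
    \<comment> \<open>Position of the clock time in units of cells. It is strictly positive because
      levels above \<open>l0\<close> are reached only after \<open>s\<close>; the cells are open on
      the left, so exactly one of them, number \<open>\<lceil>x\<rceil> - 1\<close>, contains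
      it.\<close>
    define x where "x = (inverse_clock z - s) * real (Suc N) / (t - s)"
    have x: "0 < x" "x \<le> real (Suc N)"
      using inverse_clock_gt[OF z] inverse_clock_mem(1)[OF z] s_less_t
      by (auto simp: x_def divide_simps)
    have ind_x: "ind N k z \<longleftrightarrow> real k < x \<and> x \<le> real k + 1" for k
      using s_less_t unfolding ind_def P_def x_def by (auto simp: field_simps)
    define k where "k = nat (\<lceil>x\<rceil> - 1)"
    have c: "1 \<le> \<lceil>x\<rceil>" "\<lceil>x\<rceil> \<le> int (Suc N)" using x by (simp_all add: ceiling_le_iff one_le_ceiling)
    have k: "real k = real_of_int \<lceil>x\<rceil> - 1" "k \<le> N" using c by (auto simp: k_def)
    have ik: "ind N j z \<longleftrightarrow> j = k" for j
    proof
      assume "ind N j z"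
      then have "\<lceil>x\<rceil> = int j + 1" unfolding ind_x by (intro ceiling_unique) auto
      then show "j = k" using k by simp
    next
      assume "j = k"
      then show "ind N j z" unfolding ind_x using k(1) ceiling_correct[of x] by auto
    qed
    have "\<Phi> N z = (\<Sum>j<Suc N. if j = k then trm N j z else 0)"
      unfolding \<Phi>_def ik by (intro sum.cong) auto
    also have "\<dots> = trm N k z" using k(2) by (simp add: sum.delta)
    finally show ?thesis using k(2) ik by blast
  qed
  have step: "(\<integral>\<omega>. h (L r \<omega>) * W r \<omega> \<partial>M) - (\<integral>\<omega>. h (L q \<omega>) * W q \<omega> \<partial>M) =
     (\<integral>z. of_bool (q < inverse_clock z \<and> inverse_clock z \<le> r) * (h (L q (fst z)) * \<beta> z - n * h (snd z) * W r (fst z)) \<partial>clock_measure)"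
    if q: "s \<le> q" "q \<le> r" "r \<le> t" for q r
  proof -
    have iM: "integrable M (\<lambda>\<omega>. h (L u \<omega>) * W v \<omega>)" if "u \<in> {s..t}" for u v
    proof (rule integrable_const_bound[where B="1 * C"])
      show "AE \<omega> in M. norm (h (L u \<omega>) * W v \<omega>) \<le> 1 * C"
        using mult_mono[OF hL[OF that] Wb] by (intro AE_I2) (simp add: abs_mult)
    qed measurable
    have I: "integrable clock_measure (\<lambda>z. of_bool (q < inverse_clock z \<and> inverse_clock z \<le> r) * (h (L q (fst z)) * \<beta> z))"
    proof (rule integral_clock_measure(1)[where C=C])
      fix z assume z: "z \<in> clock_region"
      show "\<bar>of_bool (q < inverse_clock z \<and> inverse_clock z \<le> r) * (h (L q (fst z)) * \<beta> z)\<bar> \<le> C"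
        using mult_mono[OF hL[of q, OF _ regD(1)[OF z]] \<beta>b[OF z]] q C0 by (simp add: abs_mult of_bool_def)
    qed measurable
    have J: "integrable clock_measure (\<lambda>z. of_bool (q < inverse_clock z \<and> inverse_clock z \<le> r) * (- n * h (snd z) * W r (fst z)))"
    proof (rule integral_clock_measure(1)[where C="n * C"])
      fix z assume z: "z \<in> clock_region"
      show "\<bar>of_bool (q < inverse_clock z \<and> inverse_clock z \<le> r) * (- n * h (snd z) * W r (fst z))\<bar> \<le> n * C"
        using b2[OF z, of r] C0 n by (simp add: of_bool_def)
    qed measurable
    have "(\<integral>\<omega>. h (L r \<omega>) * W r \<omega> \<partial>M) - (\<integral>\<omega>. h (L q \<omega>) * W q \<omega> \<partial>M) =
       (\<integral>\<omega>. h (L q \<omega>) * (W r \<omega> - W q \<omega>) \<partial>M) + (\<integral>\<omega>. W r \<omega> * (h (L r \<omega>) - h (L q \<omega>)) \<partial>M)"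
    proof -
      have "(\<integral>\<omega>. h (L q \<omega>) * (W r \<omega> - W q \<omega>) \<partial>M) = (\<integral>\<omega>. h (L q \<omega>) * W r \<omega> \<partial>M) - (\<integral>\<omega>. h (L q \<omega>) * W q \<omega> \<partial>M)"
        unfolding right_diff_distrib using q by (intro Bochner_Integration.integral_diff iM) auto
      moreover have "(\<integral>\<omega>. W r \<omega> * (h (L r \<omega>) - h (L q \<omega>)) \<partial>M) = (\<integral>\<omega>. h (L r \<omega>) * W r \<omega> \<partial>M) - (\<integral>\<omega>. h (L q \<omega>) * W r \<omega> \<partial>M)"
        unfolding right_diff_distrib mult.commute[of "W r _"] using q by (intro Bochner_Integration.integral_diff iM) auto
      ultimately show ?thesis by simp
    qed
    also have "(\<integral>\<omega>. h (L q \<omega>) * (W r \<omega> - W q \<omega>) \<partial>M) =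
       (\<integral>z. of_bool (q < inverse_clock z \<and> inverse_clock z \<le> r) * (h (L q (fst z)) * \<beta> z) \<partial>clock_measure)"
      unfolding h_def by (rule orth[OF q])
    also have "(\<integral>\<omega>. W r \<omega> * (h (L r \<omega>) - h (L q \<omega>)) \<partial>M) =
       (\<integral>z. of_bool (q < inverse_clock z \<and> inverse_clock z \<le> r) * (- n * h (snd z) * W r (fst z)) \<partial>clock_measure)"
      unfolding h_def by (rule integral_exp_increment[OF n q W Wb])
    also have "(\<integral>z. of_bool (q < inverse_clock z \<and> inverse_clock z \<le> r) * (h (L q (fst z)) * \<beta> z) \<partial>clock_measure) +
       (\<integral>z. of_bool (q < inverse_clock z \<and> inverse_clock z \<le> r) * (- n * h (snd z) * W r (fst z)) \<partial>clock_measure) =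
       (\<integral>z. of_bool (q < inverse_clock z \<and> inverse_clock z \<le> r) * (h (L q (fst z)) * \<beta> z - n * h (snd z) * W r (fst z)) \<partial>clock_measure)"
      by (subst Bochner_Integration.integral_add[OF I J, symmetric])
        (auto intro!: Bochner_Integration.integral_cong simp: algebra_simps)
    finally show ?thesis .
  qed
  have ti: "integrable clock_measure (\<lambda>z. of_bool (ind N k z) * trm N k z)" if "k \<le> N" for N k
  proof (rule integral_clock_measure(1)[where C="C + n * C"])
    fix z assume "z \<in> clock_region"
    then show "\<bar>of_bool (ind N k z) * trm N k z\<bar> \<le> C + n * C"
      using tb[of z k N] that C0 n by (auto simp: of_bool_def)
  qed measurable
  have "(\<integral>z. \<Phi> N z \<partial>clock_measure) = (\<Sum>k<Suc N. (\<integral>z. of_bool (ind N k z) * trm N k z \<partial>clock_measure))" for N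
    unfolding \<Phi>_def using ti by (intro Bochner_Integration.integral_sum) auto
  also have "\<dots> N = (\<Sum>k<Suc N. (\<integral>\<omega>. h (L (P N (Suc k)) \<omega>) * W (P N (Suc k)) \<omega> \<partial>M) - (\<integral>\<omega>. h (L (P N k) \<omega>) * W (P N k) \<omega> \<partial>M))" for N
    unfolding ind_def trm_def
  proof (rule sum.cong[OF refl], rule step[symmetric])
    fix k assume "k \<in> {..<Suc N}"
    then show "s \<le> P N k" "P N k \<le> P N (Suc k)" "P N (Suc k) \<le> t"
      using Pmem[of k N] Pmem[of "Suc k" N] Pmono[of k "Suc k" N] by auto
  qed
  also have "\<dots> N = (\<integral>\<omega>. h (L t \<omega>) * W t \<omega> \<partial>M) - (\<integral>\<omega>. h (L s \<omega>) * W s \<omega> \<partial>M)" for N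
    by (subst sum_lessThan_telescope) (simp only: P0 PN)
  also have "(\<integral>\<omega>. h (L s \<omega>) * W s \<omega> \<partial>M) = (\<integral>\<omega>. W s \<omega> \<partial>M)"
    by (intro Bochner_Integration.integral_cong) (auto simp: L_start h_def)
  finally have tele: "(\<integral>z. \<Phi> N z \<partial>clock_measure) = (\<integral>\<omega>. h (L t \<omega>) * W t \<omega> \<partial>M) - (\<integral>\<omega>. W s \<omega> \<partial>M)" for N .
  \<comment> \<open>By telescoping, the integral of \<open>\<Phi> N\<close> is the same for every
    \<open>N\<close> and therefore equals the integral of the pointwise limit. Both ends of the
    selected cell tend to the clock time, where the local time is the level itself.\<close>
  define F where "F z = (if z \<in> clock_region then h (snd z) * (\<beta> z - n * W (inverse_clock z) (fst z)) else 0)" for z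
  have lim: "(\<lambda>N. indicator clock_region z * \<Phi> N z) \<longlonglongrightarrow> F z" for z
  proof (cases "z \<in> clock_region")
    case z: True
    obtain k where k: "\<And>N. k N \<le> N" "\<And>N. ind N (k N) z" "\<And>N. \<Phi> N z = trm N (k N) z"
      using pick[OF z] by metis
    note \<omega> = regD(1)[OF z]
    have gap: "P N (Suc j) = P N j + (t - s) / real (Suc N)" for N j
      by (simp add: P_def add_divide_distrib distrib_right)
    have l0': "(\<lambda>N. (t - s) / real (Suc N)) \<longlonglongrightarrow> 0"
      using LIMSEQ_Suc[OF lim_const_over_n[of "t - s"]] by simp
    have up: "(\<lambda>N. P N (Suc (k N))) \<longlonglongrightarrow> inverse_clock z"
    proof (rule tendsto_sandwich[of "\<lambda>_. inverse_clock z" _ _ "\<lambda>N. inverse_clock z + (t - s) / real (Suc N)"])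
      show "\<forall>\<^sub>F N in sequentially. inverse_clock z \<le> P N (Suc (k N))"
        using k(2) by (auto simp: ind_def)
      show "\<forall>\<^sub>F N in sequentially. P N (Suc (k N)) \<le> inverse_clock z + (t - s) / real (Suc N)"
        using k(2) unfolding gap by (auto simp: ind_def less_imp_le)
      show "(\<lambda>N. inverse_clock z + (t - s) / real (Suc N)) \<longlonglongrightarrow> inverse_clock z"
        using tendsto_add[OF tendsto_const l0', of "inverse_clock z"] by simp
    qed simp
    have lo: "(\<lambda>N. P N (k N)) \<longlonglongrightarrow> inverse_clock z"
      using tendsto_diff[OF up l0'] by (simp add: gap)
    have mem: "\<forall>\<^sub>F N in sequentially. P N (Suc (k N)) \<in> {s..t}" "\<forall>\<^sub>F N in sequentially. P N (k N) \<in> {s..t}"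
      using k(1) by (auto intro!: always_eventually Pmem simp del: atLeastAtMost_iff intro: le_SucI)
    have "(\<lambda>N. L (P N (k N)) (fst z)) \<longlonglongrightarrow> L (inverse_clock z) (fst z)"
      by (rule continuous_on_tendsto_compose[OF L_continuous[OF \<omega>] lo inverse_clock_mem(1)[OF z] mem(2)])
    then have "(\<lambda>N. h (L (P N (k N)) (fst z))) \<longlonglongrightarrow> h (snd z)"
      unfolding h_def L_inverse_clock[OF z] by (intro tendsto_intros)
    moreover have "(\<lambda>N. W (P N (Suc (k N))) (fst z)) \<longlonglongrightarrow> W (inverse_clock z) (fst z)"
      by (rule continuous_on_tendsto_compose[OF Wc[OF \<omega>] up inverse_clock_mem(1)[OF z] mem(1)])
    ultimately have "(\<lambda>N. trm N (k N) z) \<longlonglongrightarrow> h (snd z) * \<beta> z - n * h (snd z) * W (inverse_clock z) (fst z)"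
      unfolding trm_def by (intro tendsto_intros)
    then show ?thesis using z by (simp add: k(3) F_def algebra_simps)
  qed (simp add: F_def)
  \<comment> \<open>\<open>F\<close> evaluates \<open>W\<close> at a random time; its measurability
    is inherited from the discrete approximations.\<close>
  have Fm: "F \<in> borel_measurable (M \<Otimes>\<^sub>M lborel)"
    by (rule borel_measurable_LIMSEQ_real[OF lim])
      (intro borel_measurable_times borel_measurable_indicator clock_region_sets \<Phi>m)
  have "(\<lambda>N. \<integral>z. indicator clock_region z * \<Phi> N z \<partial>clock_measure) \<longlonglongrightarrow> (\<integral>z. F z \<partial>clock_measure)"
  proof (rule integral_dominated_convergence[where w="\<lambda>_. C + n * C"])
    show "AE z in clock_measure. norm (indicator clock_region z * \<Phi> N z) \<le> C + n * C" for N
      using AE_clock_measure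
    proof eventually_elim
      case (elim z)
      obtain k where "k \<le> N" "\<Phi> N z = trm N k z" using pick[OF elim] by blast
      then show ?case using tb[OF elim, of k N] elim by simp
    qed
    show "F \<in> borel_measurable clock_measure" using Fm by simp
    show "(\<lambda>z. indicator clock_region z * \<Phi> N z) \<in> borel_measurable clock_measure" for N
      unfolding measurable_cong_sets[OF sets_clock_measure refl]
      by (intro borel_measurable_times borel_measurable_indicator clock_region_sets \<Phi>m)
  qed (use lim in auto)
  moreover have "(\<integral>z. indicator clock_region z * \<Phi> N z \<partial>clock_measure) = (\<integral>z. \<Phi> N z \<partial>clock_measure)" for N
    using AE_clock_measure \<Phi>m[of N] by (intro integral_cong_AE) (auto elim!: eventually_mono)
  ultimately have "(\<integral>\<omega>. h (L t \<omega>) * W t \<omega> \<partial>M) - (\<integral>\<omega>. W s \<omega> \<partial>M) = (\<integral>z. F z \<partial>clock_measure)"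
    unfolding tele by (simp add: LIMSEQ_const_iff)
  also have "(\<integral>z. F z \<partial>clock_measure) = (\<integral>z. h (snd z) * (\<beta> z - n * w z) \<partial>clock_measure)"
  proof (rule integral_cong_AE)
    show "AE z in clock_measure. F z = h (snd z) * (\<beta> z - n * w z)"
      using AE_clock_measure ww by eventually_elim (simp add: F_def)
    show "F \<in> borel_measurable clock_measure"
      using Fm by (simp add: measurable_cong_sets[OF sets_clock_measure refl])
  qed measurable
  finally show ?thesis unfolding h_def .
qed

end

section \<open>The law of the local time\<close>

text \<open>Differentiating \<open>exp (- n * v)\<close> times the combination
  \<open>n sin + \<theta> cos\<close> makes the cosines cancel and leaves a multiple of the
  integrand, so the boundary term at \<open>v = 0\<close> is the whole integral.\<close>

lemma exponential_sine_integral: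
  fixes n \<theta> r :: real
  assumes n: "0 < n"
  shows "(\<integral>v. sin (\<theta> * (r + v)) \<partial>density lborel (exponential_density n)) =
    n / (n\<^sup>2 + \<theta>\<^sup>2) * (n * sin (\<theta> * r) + \<theta> * cos (\<theta> * r))"
proof -
  let ?f = "\<lambda>v. n * exp (- n * v) * sin (\<theta> * (r + v))"
  let ?F = "\<lambda>v. - (n / (n\<^sup>2 + \<theta>\<^sup>2)) * (exp (- n * v) * (n * sin (\<theta> * (r + v)) + \<theta> * cos (\<theta> * (r + v))))"
  have p: "0 < n\<^sup>2 + \<theta>\<^sup>2" using n by (simp add: add_pos_nonneg)
  interpret E: prob_space "density lborel (exponential_density n)"
    by (rule prob_space_exponential_density[OF n])
  have int: "integrable (density lborel (exponential_density n)) (\<lambda>v. sin (\<theta> * (r + v)))"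
    by (rule E.integrable_const_bound[where B=1]) auto
  have e: "exponential_density n v *\<^sub>R sin (\<theta> * (r + v)) = indicator {0..} v *\<^sub>R ?f v" for v
    by (auto simp: exponential_density_def split: split_indicator)
  have int': "integrable lborel (\<lambda>v. indicator {0..} v *\<^sub>R ?f v)"
    using int exponential_density_nonneg[OF n] unfolding e[symmetric]
    by (subst (asm) integrable_density) auto
  have "(\<integral>v. sin (\<theta> * (r + v)) \<partial>density lborel (exponential_density n)) = (LBINT v. indicator {0..} v *\<^sub>R ?f v)"
    unfolding e[symmetric] using exponential_density_nonneg[OF n] by (subst integral_density) auto
  also have "\<dots> = (LBINT v=0..\<infinity>. ?f v)"
    unfolding interval_lebesgue_integral_def set_lebesgue_integral_def
    using AE_lborel_singleton[of "0::real"] int'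
    by (auto intro!: integral_cong_AE elim!: eventually_mono simp: einterval_eq zero_ereal_def split: split_indicator)
  also have "\<dots> = 0 - ?F 0"
  proof (rule interval_integral_FTC_integrable)
    fix v :: real
    have "((\<lambda>v. exp (- n * v) * (n * sin (\<theta> * (r + v)) + \<theta> * cos (\<theta> * (r + v)))) has_real_derivative
        - ((n\<^sup>2 + \<theta>\<^sup>2) * (exp (- n * v) * sin (\<theta> * (r + v))))) (at v)"
      by (auto intro!: derivative_eq_intros simp: power2_eq_square algebra_simps)
    from DERIV_cmult[OF this, of "- (n / (n\<^sup>2 + \<theta>\<^sup>2))"]
    have "(?F has_real_derivative ?f v) (at v)"
      using p n by (simp add: mult.assoc)
    then show "(?F has_vector_derivative ?f v) (at v)"
      by (simp add: has_real_derivative_iff_has_vector_derivative)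
    show "isCont ?f v" by (intro continuous_intros)
  next
    have "isCont ?F 0" by (intro continuous_intros)
    then have "(?F \<longlongrightarrow> ?F 0) (at_right 0)"
      by (simp only: isCont_def filterlim_at_split)
    then show "((?F \<circ> real_of_ereal) \<longlongrightarrow> ?F 0) (at_right 0)"
      unfolding zero_ereal_def ereal_tendsto_simps by simp
    have "((\<lambda>v. exp (- n * v)) \<longlongrightarrow> 0) at_top" using n by real_asymp
    from tendsto_mult[OF this tendsto_const[of "\<bar>n\<bar> + \<bar>\<theta>\<bar>"]]
    have l: "((\<lambda>v. exp (- n * v) * (\<bar>n\<bar> + \<bar>\<theta>\<bar>)) \<longlongrightarrow> 0) at_top" by simp
    have "\<bar>n * sin y + \<theta> * cos y\<bar> \<le> \<bar>n\<bar> + \<bar>\<theta>\<bar>" for y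
    proof -
      have "\<bar>n * sin y\<bar> \<le> \<bar>n\<bar>" "\<bar>\<theta> * cos y\<bar> \<le> \<bar>\<theta>\<bar>"
        by (auto simp: abs_mult intro!: mult_left_le)
      then show ?thesis by linarith
    qed
    then have "((\<lambda>v. exp (- n * v) * (n * sin (\<theta> * (r + v)) + \<theta> * cos (\<theta> * (r + v)))) \<longlongrightarrow> 0) at_top"
      by (intro tendsto_0_le[OF l, of _ 1] always_eventually) (auto simp: abs_mult)
    from tendsto_mult[OF tendsto_const this, of "- (n / (n\<^sup>2 + \<theta>\<^sup>2))"]
    show "((?F \<circ> real_of_ereal) \<longlongrightarrow> 0) (at_left \<infinity>)"
      unfolding ereal_tendsto_simps by simp
  next
    show "set_integrable lborel (einterval 0 \<infinity>) ?f"
      by (rule set_integrable_subset[of _ "{0..}"])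
        (use int' in \<open>auto simp: set_integrable_def einterval_def zero_ereal_def\<close>)
  qed auto
  finally show ?thesis by simp
qed

text \<open>With \<open>V\<close> exponential of rate \<open>n\<close>, the function in the
  conclusion is the expected sign of \<open>r + V\<close>: for \<open>r < 0\<close> this sum is
  positive with probability \<open>exp (n * r)\<close>. The hypothesis says that the convolutions of
  \<open>P\<close> and \<open>Q\<close> with the law of \<open>V\<close> have the same sine
  transform, and \<open>sine_transform_unique\<close> on \<open>{0<..}\<close> compares just these
  expected signs.\<close>

lemma exponential_smoothing_unique:
  fixes P Q :: "real measure" and n :: real
  assumes n: "0 < n" and P: "finite_measure P" "sets P = sets borel" and Q: "finite_measure Q" "sets Q = sets borel"
    and eq: "\<And>\<theta>. (\<integral>r. n * sin (\<theta> * r) + \<theta> * cos (\<theta> * r) \<partial>P) = (\<integral>r. n * sin (\<theta> * r) + \<theta> * cos (\<theta> * r) \<partial>Q)"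
  shows "(\<integral>r. (if 0 \<le> r then 1 else 2 * exp (n * r) - 1) \<partial>P) = (\<integral>r. (if 0 \<le> r then 1 else 2 * exp (n * r) - 1) \<partial>Q)"
proof -
  let ?E = "density lborel (exponential_density n)"
  interpret E: prob_space ?E by (rule prob_space_exponential_density[OF n])
  have E: "finite_measure ?E" "sets ?E = sets borel" by (auto intro: E.finite_measure_axioms)
  have cdfE: "emeasure ?E {c<..} = ennreal (if 0 \<le> c then exp (- n * c) else 1)"
    "emeasure ?E {..<c} = ennreal (if 0 \<le> c then 1 - exp (- n * c) else 0)" for c
  proof -
    have D: "distributed ?E lborel (\<lambda>x. x) (exponential_density n)"
      unfolding distributed_def by (simp add: distr_id2)
    have ae0: "AE v in ?E. 0 \<le> v"
      by (subst AE_density) (auto simp: exponential_density_def)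
    have gt: "measure ?E {c<..} = (if 0 \<le> c then exp (- n * c) else 1)" for c
    proof (cases "0 \<le> c")
      case True
      then show ?thesis using E.exponential_distributedD_gt[OF D True n] by (simp add: greaterThan_def mult.commute)
    next
      case False
      have "AE v in ?E. v \<in> {c<..}" using ae0 by eventually_elim (use False in auto)
      then have "measure ?E {c<..} = 1" by (subst E.prob_eq_1) auto
      then show ?thesis using False by simp
    qed
    show "emeasure ?E {c<..} = ennreal (if 0 \<le> c then exp (- n * c) else 1)"
      unfolding E.emeasure_eq_measure gt ..
    have "AE v in ?E. v \<noteq> c"
      using AE_lborel_singleton[of c] by (subst AE_density) (auto elim: eventually_mono)
    then have "measure ?E {c..} = measure ?E {c<..}"
      by (intro E.finite_measure_eq_AE) (auto elim: eventually_mono)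
    moreover have "{..<c} = space ?E - {c..}" by auto
    then have "measure ?E {..<c} = 1 - measure ?E {c..}" by (simp only:) (subst E.prob_compl, auto)
    ultimately show "emeasure ?E {..<c} = ennreal (if 0 \<le> c then 1 - exp (- n * c) else 0)"
      unfolding E.emeasure_eq_measure using gt[of c] by simp
  qed
  have tail: "emeasure (K \<star> ?E) {0<..} = (\<integral>\<^sup>+r. ennreal (if 0 \<le> r then 1 else exp (n * r)) \<partial>K)"
    "emeasure (K \<star> ?E) {..<0} = (\<integral>\<^sup>+r. ennreal (if 0 \<le> r then 0 else 1 - exp (n * r)) \<partial>K)"
    and tr: "(\<integral>z. sin (\<theta> * z) \<partial>(K \<star> ?E)) = n / (n\<^sup>2 + \<theta>\<^sup>2) * (\<integral>r. n * sin (\<theta> * r) + \<theta> * cos (\<theta> * r) \<partial>K)"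
    and i: "integrable K (\<lambda>r. if 0 \<le> r then 1 else exp (n * r))" "integrable K (\<lambda>r. if 0 \<le> r then 0 else 1 - exp (n * r))"
    if K: "finite_measure K" "sets K = sets borel" for K :: "real measure" and \<theta>
  proof -
    note Km = measurable_cong_sets[OF K(2) refl]
    interpret K: finite_measure K by fact
    interpret KE: pair_sigma_finite K ?E ..
    interpret KP: finite_measure "K \<Otimes>\<^sub>M ?E" by (rule finite_measure_pair_measure) fact+
    have ind: "indicator {0<..} (x + y) = (indicator {- x<..} y :: ennreal)"
      "indicator {..<0} (x + y) = (indicator {..<- x} y :: ennreal)" for x y :: real
      by (auto split: split_indicator)
    show "emeasure (K \<star> ?E) {0<..} = (\<integral>\<^sup>+r. ennreal (if 0 \<le> r then 1 else exp (n * r)) \<partial>K)"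
      by (subst convolution_emeasure'[OF _ K(1) E K(2)]) (auto simp: ind cdfE intro!: nn_integral_cong)
    show "emeasure (K \<star> ?E) {..<0} = (\<integral>\<^sup>+r. ennreal (if 0 \<le> r then 0 else 1 - exp (n * r)) \<partial>K)"
      by (subst convolution_emeasure'[OF _ K(1) E K(2)]) (auto simp: ind cdfE intro!: nn_integral_cong)
    show "integrable K (\<lambda>r. if 0 \<le> r then 1 else exp (n * r))"
      using n by (intro K.integrable_const_bound[where B=1]) (auto simp: Km mult_le_0_iff)
    show "integrable K (\<lambda>r. if 0 \<le> r then 0 else 1 - exp (n * r))"
      using n by (intro K.integrable_const_bound[where B=1]) (auto simp: Km mult_le_0_iff)
    have pm: "(\<lambda>z. sin (\<theta> * (fst z + snd z))) \<in> borel_measurable (K \<Otimes>\<^sub>M ?E)"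
      unfolding measurable_cong_sets[OF sets_pair_measure_cong[OF K(2) E(2)] refl] by measurable
    have "(\<integral>z. sin (\<theta> * z) \<partial>(K \<star> ?E)) = (\<integral>z. sin (\<theta> * (fst z + snd z)) \<partial>(K \<Otimes>\<^sub>M ?E))"
      unfolding convolution_def case_prod_beta
      by (subst integral_distr) (auto simp: measurable_cong_sets[OF sets_pair_measure_cong[OF K(2) E(2)] refl])
    also have "\<dots> = (\<integral>r. (\<integral>v. sin (\<theta> * (r + v)) \<partial>?E) \<partial>K)"
      by (subst KE.integral_fst'[symmetric]) (auto intro!: KP.integrable_const_bound[where B=1] pm)
    also have "\<dots> = n / (n\<^sup>2 + \<theta>\<^sup>2) * (\<integral>r. n * sin (\<theta> * r) + \<theta> * cos (\<theta> * r) \<partial>K)"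
      unfolding exponential_sine_integral[OF n] by (rule integral_mult_right_zero)
    finally show "(\<integral>z. sin (\<theta> * z) \<partial>(K \<star> ?E)) = n / (n\<^sup>2 + \<theta>\<^sup>2) * (\<integral>r. n * sin (\<theta> * r) + \<theta> * cos (\<theta> * r) \<partial>K)" .
  qed
  have fin: "finite_measure (K \<star> ?E)" if K: "finite_measure K" "sets K = sets borel" for K :: "real measure"
    using convolution_finite[OF K(1) E(1) E(2) K(2)] .
  have neg: "uminus -` {0<..} = {..<(0::real)}" by auto
  have "emeasure (P \<star> ?E) {0<..} + emeasure (Q \<star> ?E) {..<0} = emeasure (Q \<star> ?E) {0<..} + emeasure (P \<star> ?E) {..<0}"
    unfolding neg[symmetric]
    by (rule sine_transform_unique[OF fin[OF P] _ fin[OF Q]]) (auto simp: tr[OF P] tr[OF Q] eq)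
  then have "(\<integral>r. (if 0 \<le> r then 1 else exp (n * r)) \<partial>P) + (\<integral>r. (if 0 \<le> r then 0 else 1 - exp (n * r)) \<partial>Q) =
     (\<integral>r. (if 0 \<le> r then 1 else exp (n * r)) \<partial>Q) + (\<integral>r. (if 0 \<le> r then 0 else 1 - exp (n * r)) \<partial>P)"
  proof -
    have nn: "(\<integral>\<^sup>+r. ennreal (if 0 \<le> r then 1 else exp (n * r)) \<partial>K) = ennreal (\<integral>r. (if 0 \<le> r then 1 else exp (n * r)) \<partial>K)"
      "(\<integral>\<^sup>+r. ennreal (if 0 \<le> r then 0 else 1 - exp (n * r)) \<partial>K) = ennreal (\<integral>r. (if 0 \<le> r then 0 else 1 - exp (n * r)) \<partial>K)"
      "0 \<le> (\<integral>r. (if 0 \<le> r then 1 else exp (n * r)) \<partial>K)" "0 \<le> (\<integral>r. (if 0 \<le> r then 0 else 1 - exp (n * r)) \<partial>K)"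
      if K: "finite_measure K" "sets K = sets borel" for K :: "real measure"
      using n by (intro nn_integral_eq_integral i[OF K] integral_nonneg_AE AE_I2; simp add: mult_le_0_iff)+
    show ?thesis if "emeasure (P \<star> ?E) {0<..} + emeasure (Q \<star> ?E) {..<0} = emeasure (Q \<star> ?E) {0<..} + emeasure (P \<star> ?E) {..<0}"
      using that unfolding tail[OF P] tail[OF Q] nn(1,2)[OF P] nn(1,2)[OF Q]
      using nn(3,4)[OF P] nn(3,4)[OF Q] by (simp flip: ennreal_plus)
  qed
  moreover have "(\<integral>r. (if 0 \<le> r then 1 else 2 * exp (n * r) - 1) \<partial>K) =
     (\<integral>r. (if 0 \<le> r then 1 else exp (n * r)) \<partial>K) - (\<integral>r. (if 0 \<le> r then 0 else 1 - exp (n * r)) \<partial>K)"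
    if K: "finite_measure K" "sets K = sets borel" for K :: "real measure"
    by (subst Bochner_Integration.integral_diff[OF i[OF K], symmetric]) (auto intro!: Bochner_Integration.integral_cong)
  ultimately show ?thesis using P Q by simp
qed

text \<open>This is all that the transform computation takes from the spider, with filtrations and
  Stieltjes integrals already removed. \<open>\<rho> j\<close> is the distance on branch
  \<open>j\<close> and 0 off that branch. The orthogonality relations are the martingale property
  tested against an exponential of the past local time; the cosine relation has right side 0 because
  the cosine has slope 0 at the junction.\<close>

locale spider_clock = local_time_clock M s t l0 L
  for M :: "'w measure" and s t l0 :: real and L :: "real \<Rightarrow> 'w \<Rightarrow> real" +
  fixes \<rho> :: "'i::finite \<Rightarrow> real \<Rightarrow> 'w \<Rightarrow> real" and \<alpha> :: "'i \<Rightarrow> real \<Rightarrow> real \<Rightarrow> real" and x :: real and i :: 'i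
  assumes rho_measurable [measurable]: "\<rho> j u \<in> borel_measurable M"
    and rho_continuous: "\<omega> \<in> space M \<Longrightarrow> continuous_on {s..t} (\<lambda>u. \<rho> j u \<omega>)"
    and rho_nonneg: "\<omega> \<in> space M \<Longrightarrow> 0 \<le> \<rho> j u \<omega>"
    and rho_single: "\<omega> \<in> space M \<Longrightarrow> \<exists>k. \<forall>j. j \<noteq> k \<longrightarrow> \<rho> j u \<omega> = 0"
    and x_nonneg: "0 \<le> x"
    and rho_start: "\<omega> \<in> space M \<Longrightarrow> \<rho> j s \<omega> = (if j = i then x else 0)"
    and rho_clock: "AE z in clock_measure. \<forall>j. \<rho> j (inverse_clock z) (fst z) = 0"
    and alpha_measurable [measurable]: "(\<lambda>z. \<alpha> j (fst z) (snd z)) \<in> borel_measurable (borel \<Otimes>\<^sub>M borel)"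
    and alpha_nonneg: "0 \<le> \<alpha> j u l" and alpha_sum: "(\<Sum>j\<in>UNIV. \<alpha> j u l) = 1"
    and sin_orthogonal: "0 \<le> n \<Longrightarrow> s \<le> q \<Longrightarrow> q \<le> r \<Longrightarrow> r \<le> t \<Longrightarrow>
      (\<integral>\<omega>. exp (- n * (L q \<omega> - l0)) * (exp (\<theta>\<^sup>2 * r / 2) * sin (\<theta> * \<rho> j r \<omega>) - exp (\<theta>\<^sup>2 * q / 2) * sin (\<theta> * \<rho> j q \<omega>)) \<partial>M) =
      (\<integral>z. of_bool (q < inverse_clock z \<and> inverse_clock z \<le> r) * (exp (- n * (L q (fst z) - l0)) *
        (\<alpha> j (inverse_clock z) (snd z) * (\<theta> * exp (\<theta>\<^sup>2 * inverse_clock z / 2)))) \<partial>clock_measure)"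
    and cos_orthogonal: "0 \<le> n \<Longrightarrow> s \<le> q \<Longrightarrow> q \<le> r \<Longrightarrow> r \<le> t \<Longrightarrow>
      (\<integral>\<omega>. exp (- n * (L q \<omega> - l0)) * (exp (\<theta>\<^sup>2 * r / 2) * cos (\<theta> * (\<Sum>j\<in>UNIV. \<rho> j r \<omega>)) -
        exp (\<theta>\<^sup>2 * q / 2) * cos (\<theta> * (\<Sum>j\<in>UNIV. \<rho> j q \<omega>))) \<partial>M) = 0"
begin

definition R :: "real \<Rightarrow> 'w \<Rightarrow> real" where "R u \<omega> = (\<Sum>j\<in>UNIV. \<rho> j u \<omega>)"

lemma R_measurable [measurable]: "R u \<in> borel_measurable M"
  unfolding R_def by measurable

lemma R_nonneg: "\<omega> \<in> space M \<Longrightarrow> 0 \<le> R u \<omega>"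
  by (simp add: R_def sum_nonneg rho_nonneg)

lemma alpha_le_1: "\<alpha> j u l \<le> 1"
  using alpha_sum[of u l] member_le_sum[of j UNIV "\<lambda>j. \<alpha> j u l"] alpha_nonneg by auto

lemma alpha_measurable' [measurable (raw)]:
  assumes [measurable]: "f \<in> borel_measurable N" "h \<in> borel_measurable N"
  shows "(\<lambda>z. \<alpha> j (f z) (h z)) \<in> borel_measurable N"
  using measurable_compose[OF measurable_Pair[OF assms] alpha_measurable[of j]] by simp

lemma sin_R: "\<omega> \<in> space M \<Longrightarrow> sin (\<theta> * R u \<omega>) = (\<Sum>j\<in>UNIV. sin (\<theta> * \<rho> j u \<omega>))"
proof -
  assume "\<omega> \<in> space M"
  then obtain k where k: "\<And>j. j \<noteq> k \<Longrightarrow> \<rho> j u \<omega> = 0" using rho_single by blast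
  have "R u \<omega> = \<rho> k u \<omega>" unfolding R_def
    by (subst sum.remove[of _ k]) (auto simp: k intro!: sum.neutral)
  moreover have "(\<Sum>j\<in>UNIV. sin (\<theta> * \<rho> j u \<omega>)) = sin (\<theta> * \<rho> k u \<omega>)"
    by (subst sum.remove[of _ k]) (auto simp: k intro!: sum.neutral)
  ultimately show ?thesis by simp
qed

text \<open>The factor \<open>exp (- (\<theta>\<^sup>2 * (t - inverse_clock z) / 2))\<close> is the
  damping between the clock time and \<open>t\<close> that is left when the growth factor
  \<open>exp (\<theta>\<^sup>2 * t / 2)\<close> of the test functions is divided out.\<close>

definition kernel_integral :: "real \<Rightarrow> real \<Rightarrow> ('w \<times> real \<Rightarrow> real) \<Rightarrow> real" where
  "kernel_integral n \<theta> f = (\<integral>z. exp (- n * (snd z - l0)) * (f z * exp (- (\<theta>\<^sup>2 * (t - inverse_clock z) / 2))) \<partial>clock_measure)"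

lemma exp_time_shift: "exp (\<theta>\<^sup>2 * t / 2) * exp (- (\<theta>\<^sup>2 * (t - u) / 2)) = exp (\<theta>\<^sup>2 * u / 2)"
  by (simp add: exp_add[symmetric] right_diff_distrib diff_divide_distrib)

text \<open>The sine vanishes at almost every clock time, so the term with \<open>n\<close> in
  \<open>product_identity\<close> drops out and only the compensator \<open>\<beta>\<close>
  remains.\<close>

lemma sine_identity:
  assumes n: "0 \<le> n"
  shows "(\<integral>\<omega>. exp (- n * (L t \<omega> - l0)) * sin (\<theta> * \<rho> j t \<omega>) \<partial>M) =
    exp (- (\<theta>\<^sup>2 * (t - s) / 2)) * sin (\<theta> * (if j = i then x else 0)) +
    \<theta> * kernel_integral n \<theta> (\<lambda>z. \<alpha> j (inverse_clock z) (snd z))"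
proof -
  \<comment> \<open>\<open>min t u\<close> agrees with \<open>u\<close> on \<open>{s..t}\<close> and
    provides the bound for all \<open>u\<close> that \<open>product_identity\<close> asks
    for.\<close>
  define W where "W u \<omega> = exp (\<theta>\<^sup>2 * min t u / 2) * sin (\<theta> * \<rho> j u \<omega>)" for u \<omega>
  define \<beta> where "\<beta> z = \<alpha> j (inverse_clock z) (snd z) * (\<theta> * exp (\<theta>\<^sup>2 * inverse_clock z / 2))" for z
  have et: "exp (\<theta>\<^sup>2 * min t u / 2) \<le> exp (\<theta>\<^sup>2 * t / 2)" for u
    by (auto intro!: mult_left_mono divide_right_mono)
  have st: "s \<le> t" using s_less_t by simp
  have "(\<integral>\<omega>. exp (- n * (L t \<omega> - l0)) * W t \<omega> \<partial>M) - (\<integral>\<omega>. W s \<omega> \<partial>M) =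
      (\<integral>z. exp (- n * (snd z - l0)) * (\<beta> z - n * 0) \<partial>clock_measure)"
  proof (rule product_identity[OF n, where C="(1 + \<bar>\<theta>\<bar>) * exp (\<theta>\<^sup>2 * t / 2)"])
    show "W u \<in> borel_measurable M" for u unfolding W_def by measurable
    show "continuous_on {s..t} (\<lambda>u. W u \<omega>)" if "\<omega> \<in> space M" for \<omega>
      unfolding W_def by (intro continuous_intros rho_continuous that) auto
    show "\<bar>W u \<omega>\<bar> \<le> (1 + \<bar>\<theta>\<bar>) * exp (\<theta>\<^sup>2 * t / 2)" for u \<omega>
    proof -
      have "\<bar>W u \<omega>\<bar> \<le> exp (\<theta>\<^sup>2 * t / 2) * 1"
        unfolding W_def abs_mult using et[of u] by (intro mult_mono) auto
      also have "\<dots> \<le> (1 + \<bar>\<theta>\<bar>) * exp (\<theta>\<^sup>2 * t / 2)" by (simp add: distrib_right)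
      finally show ?thesis .
    qed
    show "\<beta> \<in> borel_measurable (M \<Otimes>\<^sub>M lborel)" unfolding \<beta>_def[abs_def] by measurable
    show "\<bar>\<beta> z\<bar> \<le> (1 + \<bar>\<theta>\<bar>) * exp (\<theta>\<^sup>2 * t / 2)" if z: "z \<in> clock_region" for z
    proof -
      have "inverse_clock z \<le> t" using inverse_clock_mem(1)[OF z] by simp
      then have "exp (\<theta>\<^sup>2 * inverse_clock z / 2) \<le> exp (\<theta>\<^sup>2 * t / 2)"
        by (auto intro!: mult_left_mono divide_right_mono)
      then have "\<bar>\<beta> z\<bar> \<le> 1 * (\<bar>\<theta>\<bar> * exp (\<theta>\<^sup>2 * t / 2))"
        unfolding \<beta>_def abs_mult using alpha_nonneg alpha_le_1 by (intro mult_mono) auto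
      also have "\<dots> \<le> (1 + \<bar>\<theta>\<bar>) * exp (\<theta>\<^sup>2 * t / 2)" by (simp add: distrib_right)
      finally show ?thesis .
    qed
    show "(\<lambda>_. 0) \<in> borel_measurable (M \<Otimes>\<^sub>M lborel)" by simp
    show "AE z in clock_measure. W (inverse_clock z) (fst z) = 0"
      using rho_clock by eventually_elim (simp add: W_def)
    show "(\<integral>\<omega>. exp (- n * (L q \<omega> - l0)) * (W r \<omega> - W q \<omega>) \<partial>M) =
      (\<integral>z. of_bool (q < inverse_clock z \<and> inverse_clock z \<le> r) * (exp (- n * (L q (fst z) - l0)) * \<beta> z) \<partial>clock_measure)"
      if q: "s \<le> q" "q \<le> r" "r \<le> t" for q r
    proof -
      have mins: "min t r = r" "min t q = q" using q by auto
      show ?thesis unfolding W_def \<beta>_def mins by (rule sin_orthogonal[OF n q])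
    qed
  qed
  moreover have "(\<integral>\<omega>. exp (- n * (L t \<omega> - l0)) * W t \<omega> \<partial>M) =
      exp (\<theta>\<^sup>2 * t / 2) * (\<integral>\<omega>. exp (- n * (L t \<omega> - l0)) * sin (\<theta> * \<rho> j t \<omega>) \<partial>M)"
    unfolding integral_mult_right_zero[symmetric] by (intro Bochner_Integration.integral_cong) (auto simp: W_def)
  moreover have "(\<integral>\<omega>. W s \<omega> \<partial>M) = (\<integral>\<omega>. exp (\<theta>\<^sup>2 * s / 2) * sin (\<theta> * (if j = i then x else 0)) \<partial>M)"
    using st by (intro Bochner_Integration.integral_cong) (auto simp: W_def rho_start)
  then have "(\<integral>\<omega>. W s \<omega> \<partial>M) = exp (\<theta>\<^sup>2 * s / 2) * sin (\<theta> * (if j = i then x else 0))"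
    by (simp add: prob_space)
  moreover have "(\<integral>z. exp (- n * (snd z - l0)) * (\<beta> z - n * 0) \<partial>clock_measure) =
      exp (\<theta>\<^sup>2 * t / 2) * (\<theta> * kernel_integral n \<theta> (\<lambda>z. \<alpha> j (inverse_clock z) (snd z)))"
    unfolding kernel_integral_def integral_mult_right_zero[symmetric] \<beta>_def
    by (intro Bochner_Integration.integral_cong refl) (simp add: exp_time_shift[symmetric] mult_ac)
  ultimately have "exp (\<theta>\<^sup>2 * t / 2) * (\<integral>\<omega>. exp (- n * (L t \<omega> - l0)) * sin (\<theta> * \<rho> j t \<omega>) \<partial>M) =
     exp (\<theta>\<^sup>2 * s / 2) * sin (\<theta> * (if j = i then x else 0)) +
      exp (\<theta>\<^sup>2 * t / 2) * (\<theta> * kernel_integral n \<theta> (\<lambda>z. \<alpha> j (inverse_clock z) (snd z)))"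
    by simp
  also note exp_time_shift[of \<theta> s, symmetric]
  finally have "exp (\<theta>\<^sup>2 * t / 2) * (\<integral>\<omega>. exp (- n * (L t \<omega> - l0)) * sin (\<theta> * \<rho> j t \<omega>) \<partial>M) =
     exp (\<theta>\<^sup>2 * t / 2) * (exp (- (\<theta>\<^sup>2 * (t - s) / 2)) * sin (\<theta> * (if j = i then x else 0)) +
      \<theta> * kernel_integral n \<theta> (\<lambda>z. \<alpha> j (inverse_clock z) (snd z)))"
    by (simp only: distrib_left mult.assoc)
  then show ?thesis by simp
qed

text \<open>The situation is opposite to that of the sine: the compensator is 0, while at clock
  times the cosine is 1, so that only the term with \<open>n\<close> remains.\<close>

lemma cosine_identity:
  assumes n: "0 \<le> n"
  shows "(\<integral>\<omega>. exp (- n * (L t \<omega> - l0)) * cos (\<theta> * R t \<omega>) \<partial>M) =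
    exp (- (\<theta>\<^sup>2 * (t - s) / 2)) * cos (\<theta> * x) - n * kernel_integral n \<theta> (\<lambda>_. 1)"
proof -
  define W where "W u \<omega> = exp (\<theta>\<^sup>2 * min t u / 2) * cos (\<theta> * R u \<omega>)" for u \<omega>
  have et: "exp (\<theta>\<^sup>2 * min t u / 2) \<le> exp (\<theta>\<^sup>2 * t / 2)" for u
    by (auto intro!: mult_left_mono divide_right_mono)
  have st: "s \<le> t" using s_less_t by simp
  have "(\<integral>\<omega>. exp (- n * (L t \<omega> - l0)) * W t \<omega> \<partial>M) - (\<integral>\<omega>. W s \<omega> \<partial>M) =
      (\<integral>z. exp (- n * (snd z - l0)) * (0 - n * exp (\<theta>\<^sup>2 * inverse_clock z / 2)) \<partial>clock_measure)"
  proof (rule product_identity[OF n, where C="exp (\<theta>\<^sup>2 * t / 2)"])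
    show "W u \<in> borel_measurable M" for u unfolding W_def by measurable
    show "continuous_on {s..t} (\<lambda>u. W u \<omega>)" if "\<omega> \<in> space M" for \<omega>
      unfolding W_def R_def by (intro continuous_intros rho_continuous that) auto
    show "\<bar>W u \<omega>\<bar> \<le> exp (\<theta>\<^sup>2 * t / 2)" for u \<omega>
    proof -
      have "\<bar>W u \<omega>\<bar> \<le> exp (\<theta>\<^sup>2 * t / 2) * 1"
        unfolding W_def abs_mult using et[of u] by (intro mult_mono) auto
      then show ?thesis by simp
    qed
    show "(\<lambda>z. exp (\<theta>\<^sup>2 * inverse_clock z / 2)) \<in> borel_measurable (M \<Otimes>\<^sub>M lborel)" by measurable
    show "AE z in clock_measure. W (inverse_clock z) (fst z) = exp (\<theta>\<^sup>2 * inverse_clock z / 2)"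
      using rho_clock AE_clock_measure
    proof eventually_elim
      case (elim z)
      then show ?case using inverse_clock_mem(1)[of z] by (simp add: W_def R_def min_def)
    qed
    show "(\<integral>\<omega>. exp (- n * (L q \<omega> - l0)) * (W r \<omega> - W q \<omega>) \<partial>M) =
      (\<integral>z. of_bool (q < inverse_clock z \<and> inverse_clock z \<le> r) * (exp (- n * (L q (fst z) - l0)) * 0) \<partial>clock_measure)"
      if q: "s \<le> q" "q \<le> r" "r \<le> t" for q r
    proof -
      have mins: "min t r = r" "min t q = q" using q by auto
      show ?thesis unfolding W_def R_def mins cos_orthogonal[OF n q] by simp
    qed
  qed auto
  moreover have "(\<integral>\<omega>. exp (- n * (L t \<omega> - l0)) * W t \<omega> \<partial>M) =
      exp (\<theta>\<^sup>2 * t / 2) * (\<integral>\<omega>. exp (- n * (L t \<omega> - l0)) * cos (\<theta> * R t \<omega>) \<partial>M)"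
    unfolding integral_mult_right_zero[symmetric] by (intro Bochner_Integration.integral_cong) (auto simp: W_def)
  moreover have "(\<integral>\<omega>. W s \<omega> \<partial>M) = (\<integral>\<omega>. exp (\<theta>\<^sup>2 * s / 2) * cos (\<theta> * x) \<partial>M)"
    using st by (intro Bochner_Integration.integral_cong) (auto simp: W_def R_def rho_start)
  then have "(\<integral>\<omega>. W s \<omega> \<partial>M) = exp (\<theta>\<^sup>2 * s / 2) * cos (\<theta> * x)"
    by (simp add: prob_space)
  moreover have "(\<integral>z. exp (- n * (snd z - l0)) * (0 - n * exp (\<theta>\<^sup>2 * inverse_clock z / 2)) \<partial>clock_measure) =
      exp (\<theta>\<^sup>2 * t / 2) * (- n * kernel_integral n \<theta> (\<lambda>_. 1))"
    unfolding kernel_integral_def integral_mult_right_zero[symmetric]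
    by (intro Bochner_Integration.integral_cong refl) (simp add: exp_time_shift[symmetric] mult_ac)
  ultimately have "exp (\<theta>\<^sup>2 * t / 2) * (\<integral>\<omega>. exp (- n * (L t \<omega> - l0)) * cos (\<theta> * R t \<omega>) \<partial>M) =
     exp (\<theta>\<^sup>2 * s / 2) * cos (\<theta> * x) + exp (\<theta>\<^sup>2 * t / 2) * (- n * kernel_integral n \<theta> (\<lambda>_. 1))"
    by simp
  also note exp_time_shift[of \<theta> s, symmetric]
  finally have "exp (\<theta>\<^sup>2 * t / 2) * (\<integral>\<omega>. exp (- n * (L t \<omega> - l0)) * cos (\<theta> * R t \<omega>) \<partial>M) =
     exp (\<theta>\<^sup>2 * t / 2) * (exp (- (\<theta>\<^sup>2 * (t - s) / 2)) * cos (\<theta> * x) - n * kernel_integral n \<theta> (\<lambda>_. 1))"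
    by (simp add: distrib_left right_diff_distrib mult.assoc)
  then show ?thesis by simp
qed

end

section \<open>Comparison with the endpoint of a Brownian motion\<close>

lemma emeasure_normal_density_lower_tail:
  assumes \<sigma>: "0 < \<sigma>"
  shows "emeasure (density lborel (normal_density \<mu> \<sigma>)) {..- m} = ennreal (1 - std_normal_cdf ((\<mu> + m) / \<sigma>))"
proof -
  interpret N: real_distribution std_normal_distribution by (rule real_dist_normal_dist)
  let ?a = "(\<mu> + m) / \<sigma>"
  have n: "\<sigma> * normal_density \<mu> \<sigma> (\<mu> - \<sigma> * z) = std_normal_density z" for z
    using \<sigma> by (simp add: normal_density_def real_sqrt_mult power_mult_distrib field_simps)
  have "emeasure (density lborel (normal_density \<mu> \<sigma>)) {..- m} = (\<integral>\<^sup>+y. ennreal (normal_density \<mu> \<sigma> y) * indicator {..- m} y \<partial>lborel)"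
    by (simp add: emeasure_density)
  \<comment> \<open>The negative slope \<open>- \<sigma>\<close> turns the lower tail into an upper
    tail of the standard normal law.\<close>
  also have "\<dots> = ennreal \<bar>- \<sigma>\<bar> * (\<integral>\<^sup>+z. ennreal (normal_density \<mu> \<sigma> (\<mu> + - \<sigma> * z)) * indicator {..- m} (\<mu> + - \<sigma> * z) \<partial>lborel)"
    using \<sigma> by (intro nn_integral_real_affine) auto
  also have "\<dots> = (\<integral>\<^sup>+z. ennreal \<bar>- \<sigma>\<bar> * (ennreal (normal_density \<mu> \<sigma> (\<mu> + - \<sigma> * z)) * indicator {..- m} (\<mu> + - \<sigma> * z)) \<partial>lborel)"
    by (rule nn_integral_cmult[symmetric]) measurable
  also have "\<dots> = (\<integral>\<^sup>+z. ennreal (std_normal_density z) * indicator {?a..} z \<partial>lborel)"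
    using \<sigma> by (intro nn_integral_cong) (auto simp: n[symmetric] ennreal_mult'' field_simps split: split_indicator)
  also have "\<dots> = emeasure std_normal_distribution {?a..}" by (simp add: emeasure_density)
  also have "\<dots> = emeasure std_normal_distribution {?a<..}"
  proof (rule emeasure_eq_AE)
    have "AE z in std_normal_distribution. z \<noteq> ?a"
      using AE_lborel_singleton[of ?a] by (subst AE_density) (auto elim: eventually_mono)
    then show "AE z in std_normal_distribution. (z \<in> {?a..}) = (z \<in> {?a<..})"
      by eventually_elim auto
  qed auto
  also have "{?a<..} = space std_normal_distribution - {..?a}" by auto
  also have "emeasure std_normal_distribution \<dots> = ennreal (1 - std_normal_cdf ?a)"
    unfolding N.emeasure_eq_measure cdf_def by (subst N.prob_compl) auto
  finally show ?thesis .
qed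

context spider_clock
begin

abbreviation endpoint_law :: "real measure" where
  "endpoint_law \<equiv> density lborel (normal_density x (sqrt (t - s)))"

lemma sd_pos: "0 < sqrt (t - s)" using s_less_t by simp

lemma prob_space_endpoint_law: "prob_space endpoint_law"
  by (rule prob_space_normal_density[OF sd_pos])

lemma endpoint_transform:
  "(\<integral>y. sin (\<theta> * y) \<partial>endpoint_law) = exp (- (\<theta>\<^sup>2 * (t - s) / 2)) * sin (\<theta> * x)"
  "(\<integral>y. cos (\<theta> * y) \<partial>endpoint_law) = exp (- (\<theta>\<^sup>2 * (t - s) / 2)) * cos (\<theta> * x)"
  using normal_density_transform[OF sd_pos, of x \<theta>] s_less_t by (simp_all add: integral_density)

lemma sum_rho_start: "(\<Sum>j\<in>UNIV. sin (\<theta> * (if j = i then x else 0))) = sin (\<theta> * x)"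
  by (simp add: if_distrib[of "\<lambda>y. sin (\<theta> * y)"] sum.delta cong: if_cong)

text \<open>For \<open>n = 0\<close> the weight is trivial, and \<open>cosine_identity\<close> gives
  the radius the cosine transform of the Gaussian endpoint. The two laws therefore have the same
  symmetrisation, and the Gaussian has no atom at 0.\<close>

lemma AE_radius_pos: "AE \<omega> in M. 0 < R t \<omega>"
proof -
  interpret N: prob_space endpoint_law by (rule prob_space_endpoint_law)
  have cos: "(\<integral>y. cos (\<theta> * y) \<partial>distr M borel (R t)) = (\<integral>y. cos (\<theta> * y) \<partial>endpoint_law)" for \<theta>
    using cosine_identity[of 0 \<theta>] by (simp add: integral_distr endpoint_transform)
  have neg: "uminus -` {0} = {0::real}" by auto
  have "emeasure (distr M borel (R t)) {0} + emeasure (distr M borel (R t)) {0} = emeasure endpoint_law {0} + emeasure endpoint_law {0}"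
    using cosine_transform_unique[OF finite_measure_distr _ N.finite_measure_axioms _ cos, of "{0}"]
    unfolding neg by simp
  also have "emeasure endpoint_law {0} = 0"
    by (simp add: emeasure_density nn_integral_0_iff_AE)
  finally have "emeasure M (R t -` {0} \<inter> space M) = 0" by (simp add: emeasure_distr)
  then have "AE \<omega> in M. R t \<omega> \<noteq> 0"
    by (subst AE_iff_null) (auto simp: null_sets_def vimage_def Int_def conj_commute)
  then show ?thesis using AE_space
  proof eventually_elim
    case (elim \<omega>)
    then show ?case using R_nonneg[of \<omega> t] by simp
  qed
qed

lemma exp_L_le: "\<omega> \<in> space M \<Longrightarrow> 0 \<le> n \<Longrightarrow> exp (- n * (L t \<omega> - l0)) \<le> 1"
  using L_bounds[of \<omega> t] s_less_t by simp

text \<open>\<open>exponential_smoothing_unique\<close> is applied to the law of the radius weighted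
  by \<open>exp (- n * (L t - l0))\<close> and to the Gaussian endpoint law. On nonnegative
  arguments the compared function is 1, so the radius side collapses to the Laplace transform,
  whereas the Gaussian side also sees the negative half line. There is no exponential law of rate 0,
  so \<open>n = 0\<close> is checked directly.\<close>

lemma laplace_local_time:
  assumes n: "0 \<le> n"
  shows "(\<integral>\<omega>. exp (- n * (L t \<omega> - l0)) \<partial>M) = (\<integral>y. 2 * exp (- n * max 0 (- y)) - 1 \<partial>endpoint_law)"
proof (cases "n = 0")
  case True
  interpret N: prob_space endpoint_law by (rule prob_space_endpoint_law)
  show ?thesis using True N.prob_space by (simp add: prob_space)
next
  case False
  then have n: "0 < n" using assms by simp
  interpret N: prob_space endpoint_law by (rule prob_space_endpoint_law)
  let ?D = "density M (\<lambda>\<omega>. ennreal (exp (- n * (L t \<omega> - l0))))"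
  let ?Q = "distr ?D borel (R t)"
  have "emeasure ?D (space M) = (\<integral>\<^sup>+\<omega>. ennreal (exp (- n * (L t \<omega> - l0))) \<partial>M)"
    by (simp add: emeasure_density cong: nn_integral_cong)
  also have "\<dots> \<le> (\<integral>\<^sup>+\<omega>. 1 \<partial>M)"
    by (intro nn_integral_mono) (simp only: ennreal_le_1 exp_L_le less_imp_le[OF n])
  finally have "emeasure ?D (space M) \<le> (\<integral>\<^sup>+\<omega>. 1 \<partial>M)" .
  then have "finite_measure ?D"
    by (intro finite_measureI) (auto simp: emeasure_space_1 top_unique)
  then have fQ: "finite_measure ?Q" by (intro finite_measure.finite_measure_distr) auto
  have iQ: "(\<integral>r. f r \<partial>?Q) = (\<integral>\<omega>. exp (- n * (L t \<omega> - l0)) * f (R t \<omega>) \<partial>M)"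
    if [measurable]: "f \<in> borel_measurable borel" for f :: "real \<Rightarrow> real"
    by (subst integral_distr, simp, simp, subst integral_density) auto
  have int: "integrable M (\<lambda>\<omega>. exp (- n * (L t \<omega> - l0)) * f \<omega>)"
    if [measurable]: "f \<in> borel_measurable M" and "\<And>\<omega>. \<bar>f \<omega>\<bar> \<le> 1" for f
  proof (rule integrable_const_bound[where B=1])
    show "AE \<omega> in M. norm (exp (- n * (L t \<omega> - l0)) * f \<omega>) \<le> 1"
    proof (rule AE_I2)
      fix \<omega> assume "\<omega> \<in> space M"
      from mult_mono[OF exp_L_le[OF this] that(2)[of \<omega>]] n show "norm (exp (- n * (L t \<omega> - l0)) * f \<omega>) \<le> 1"
        by (simp add: abs_mult)
    qed
  qed measurable
  have "(\<integral>r. n * sin (\<theta> * r) + \<theta> * cos (\<theta> * r) \<partial>?Q) = (\<integral>r. n * sin (\<theta> * r) + \<theta> * cos (\<theta> * r) \<partial>endpoint_law)" for \<theta>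
  proof -
    have K: "integrable clock_measure (\<lambda>z. exp (- n * (snd z - l0)) * (\<alpha> j (inverse_clock z) (snd z) * exp (- (\<theta>\<^sup>2 * (t - inverse_clock z) / 2))))" for j
    proof (rule integral_clock_measure(1)[where C=1])
      fix z assume z: "z \<in> clock_region"
      have "exp (- n * (snd z - l0)) \<le> 1" "exp (- (\<theta>\<^sup>2 * (t - inverse_clock z) / 2)) \<le> 1"
        using z n inverse_clock_mem(1)[OF z] by (auto simp: clock_region_def)
      then show "\<bar>exp (- n * (snd z - l0)) * (\<alpha> j (inverse_clock z) (snd z) * exp (- (\<theta>\<^sup>2 * (t - inverse_clock z) / 2)))\<bar> \<le> 1"
        using alpha_nonneg[of j] alpha_le_1[of j] by (auto simp: abs_mult intro!: mult_le_one mult_nonneg_nonneg)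
    qed measurable
    \<comment> \<open>Summing over the branches removes the spinning measure, because its components
      add up to 1 at every time and level. Here the dependence on \<open>\<alpha>\<close>
      disappears.\<close>
    have ks: "(\<Sum>j\<in>UNIV. kernel_integral n \<theta> (\<lambda>z. \<alpha> j (inverse_clock z) (snd z))) = kernel_integral n \<theta> (\<lambda>_. 1)"
      unfolding kernel_integral_def
      by (subst Bochner_Integration.integral_sum[OF K, symmetric])
        (auto intro!: Bochner_Integration.integral_cong simp: sum_distrib_left[symmetric] sum_distrib_right[symmetric] alpha_sum)
    have iS: "integrable M (\<lambda>\<omega>. exp (- n * (L t \<omega> - l0)) * sin (\<theta> * \<rho> j t \<omega>))" for j
      by (rule int) auto
    have "(\<integral>\<omega>. exp (- n * (L t \<omega> - l0)) * sin (\<theta> * R t \<omega>) \<partial>M) = (\<Sum>j\<in>UNIV. \<integral>\<omega>. exp (- n * (L t \<omega> - l0)) * sin (\<theta> * \<rho> j t \<omega>) \<partial>M)"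
      by (subst Bochner_Integration.integral_sum[OF iS, symmetric])
        (auto intro!: Bochner_Integration.integral_cong simp: sin_R sum_distrib_left[symmetric])
    also have "\<dots> = exp (- (\<theta>\<^sup>2 * (t - s) / 2)) * sin (\<theta> * x) + \<theta> * kernel_integral n \<theta> (\<lambda>_. 1)"
      unfolding sine_identity[OF assms] sum.distrib sum_distrib_left[symmetric] ks sum_rho_start ..
    finally have S: "(\<integral>\<omega>. exp (- n * (L t \<omega> - l0)) * sin (\<theta> * R t \<omega>) \<partial>M) =
       exp (- (\<theta>\<^sup>2 * (t - s) / 2)) * sin (\<theta> * x) + \<theta> * kernel_integral n \<theta> (\<lambda>_. 1)" .
    have "(\<integral>r. n * sin (\<theta> * r) + \<theta> * cos (\<theta> * r) \<partial>?Q) =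
       (\<integral>\<omega>. n * (exp (- n * (L t \<omega> - l0)) * sin (\<theta> * R t \<omega>)) + \<theta> * (exp (- n * (L t \<omega> - l0)) * cos (\<theta> * R t \<omega>)) \<partial>M)"
      by (subst iQ) (auto intro!: Bochner_Integration.integral_cong simp: algebra_simps)
    also have "\<dots> = n * (\<integral>\<omega>. exp (- n * (L t \<omega> - l0)) * sin (\<theta> * R t \<omega>) \<partial>M) + \<theta> * (\<integral>\<omega>. exp (- n * (L t \<omega> - l0)) * cos (\<theta> * R t \<omega>) \<partial>M)"
      using int[of "\<lambda>\<omega>. sin (\<theta> * R t \<omega>)"] int[of "\<lambda>\<omega>. cos (\<theta> * R t \<omega>)"] by simp
    also have "\<dots> = n * (\<integral>y. sin (\<theta> * y) \<partial>endpoint_law) + \<theta> * (\<integral>y. cos (\<theta> * y) \<partial>endpoint_law)"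
      unfolding S cosine_identity[OF assms] endpoint_transform by (simp add: algebra_simps)
    also have "\<dots> = (\<integral>r. n * sin (\<theta> * r) + \<theta> * cos (\<theta> * r) \<partial>endpoint_law)"
      by (subst Bochner_Integration.integral_add)
        (auto intro!: integrable_mult_right N.integrable_const_bound[where B=1])
    finally show ?thesis .
  qed
  from exponential_smoothing_unique[OF n fQ _ N.finite_measure_axioms _ this]
  have "(\<integral>r. (if 0 \<le> r then 1 else 2 * exp (n * r) - 1) \<partial>?Q) = (\<integral>r. (if 0 \<le> r then 1 else 2 * exp (n * r) - 1) \<partial>endpoint_law)"
    by simp
  also have "(\<integral>r. (if 0 \<le> r then 1 else 2 * exp (n * r) - 1) \<partial>?Q) = (\<integral>\<omega>. exp (- n * (L t \<omega> - l0)) \<partial>M)"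
    by (subst iQ) (auto intro!: Bochner_Integration.integral_cong simp: R_nonneg)
  also have "(\<integral>r. (if 0 \<le> r then 1 else 2 * exp (n * r) - 1) \<partial>endpoint_law) = (\<integral>y. 2 * exp (- n * max 0 (- y)) - 1 \<partial>endpoint_law)"
    by (intro Bochner_Integration.integral_cong) (auto simp: max_def)
  finally show ?thesis .
qed

text \<open>
  By \<open>laplace_local_time\<close> the law of \<open>L t - l0\<close> plus a unit mass at \<open>0\<close> is twice the law of the
  negative part of the endpoint of a Brownian motion started at \<open>x\<close>.
\<close>
lemma law_local_time:
  assumes m: "0 < m"
  shows "emeasure M {\<omega> \<in> space M. m \<le> L t \<omega> - l0} = (\<integral>\<^sup>+v\<in>{0<..<t - s}. ennreal (hitting_density (x + m) v) \<partial>lborel)"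
proof -
  interpret N: prob_space endpoint_law by (rule prob_space_endpoint_law)
  let ?P = "distr M borel (\<lambda>\<omega>. L t \<omega> - l0)" and ?A = "distr endpoint_law borel (\<lambda>y. max 0 (- y))"
  interpret P: prob_space ?P by (rule prob_space_distr) auto
  interpret A: prob_space ?A by (rule N.prob_space_distr) auto
  interpret Z: prob_space "return borel (0::real)" by (rule prob_space_return) auto
  have "plus_measure ?P (return borel 0) = plus_measure ?A ?A"
  proof (rule laplace_transform_unique)
    fix n :: nat
    have i: "integrable K (\<lambda>y. exp (- real n * y))" if "finite_measure K" "sets K = sets borel" "AE y in K. 0 \<le> y" for K
      using that(3) by (intro finite_measure.integrable_const_bound[OF that(1), where B=1])
        (auto simp: measurable_cong_sets[OF that(2) refl] elim!: eventually_mono)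
    have iP: "integrable ?P (\<lambda>y. exp (- real n * y))"
      using L_bounds[of _ t] s_less_t
      by (intro i P.finite_measure_axioms) (auto simp: AE_distr_iff intro!: AE_I2)
    have iA: "integrable ?A (\<lambda>y. exp (- real n * y))"
      by (intro i A.finite_measure_axioms) (auto simp: AE_distr_iff intro!: AE_I2)
    have iZ: "integrable (return borel 0) (\<lambda>y. exp (- real n * y))"
      by (intro i Z.finite_measure_axioms) (auto simp: AE_return)
    have "(\<integral>y. exp (- real n * y) \<partial>plus_measure ?P (return borel 0)) = (\<integral>\<omega>. exp (- real n * (L t \<omega> - l0)) \<partial>M) + 1"
      using iP iZ by (subst integral_plus_measure) (auto simp: integral_distr integral_return)
    also have "\<dots> = (\<integral>y. 2 * exp (- real n * max 0 (- y)) \<partial>endpoint_law)"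
    proof -
      have "integrable endpoint_law (\<lambda>y. 2 * exp (- real n * max 0 (- y)))"
        by (intro integrable_mult_right N.integrable_const_bound[where B=1]) auto
      then show ?thesis
        unfolding laplace_local_time[OF of_nat_0_le_iff] using N.prob_space
        by (subst Bochner_Integration.integral_diff) auto
    qed
    also have "\<dots> = (\<integral>y. exp (- real n * y) \<partial>plus_measure ?A ?A)"
      using iA by (subst integral_plus_measure) (auto simp: integral_distr)
    finally show "(\<integral>y. exp (- real n * y) \<partial>plus_measure ?P (return borel 0)) = (\<integral>y. exp (- real n * y) \<partial>plus_measure ?A ?A)" .
  next
    have null: "AE y in plus_measure K K'. 0 \<le> y" if "sets K = sets borel" "sets K' = sets borel" "AE y in K. 0 \<le> y" "AE y in K'. 0 \<le> y" for K K' :: "real measure"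
    proof -
      have "emeasure K {..<0} = 0" "emeasure K' {..<0} = 0"
        using that by (auto simp: AE_iff_null_sets[of "{..<0}"] AE_iff_measurable[OF _ refl] sets_eq_imp_space_eq[OF that(1)] sets_eq_imp_space_eq[OF that(2)] not_le lessThan_def)
      then have "{..<0} \<in> null_sets (plus_measure K K')"
        using that by (auto simp: null_sets_def sets_plus_measure emeasure_plus_measure)
      from AE_not_in[OF this] show ?thesis by eventually_elim auto
    qed
    show "AE y in plus_measure ?P (return borel 0). 0 \<le> y"
      using L_bounds[of _ t] s_less_t by (intro null) (auto simp: AE_distr_iff AE_return intro!: AE_I2)
    show "AE y in plus_measure ?A ?A. 0 \<le> y"
      by (intro null) (auto simp: AE_distr_iff intro!: AE_I2)
  qed (auto simp: sets_plus_measure intro!: finite_measure_plus_measure P.finite_measure_axioms A.finite_measure_axioms Z.finite_measure_axioms)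
  \<comment> \<open>Since \<open>0 < m\<close>, the unit mass at 0 does not charge
    \<open>{m..}\<close>. What remains is twice a Gaussian tail, that is, the probability of a first
    passage at \<open>x + m\<close> within time \<open>t - s\<close>.\<close>
  from arg_cong[OF this, of "\<lambda>K. emeasure K {m..}"]
  have "emeasure ?P {m..} + 0 = emeasure ?A {m..} + emeasure ?A {m..}"
    using m by (simp add: emeasure_plus_measure)
  also have "emeasure ?A {m..} = emeasure endpoint_law {..- m}"
  proof -
    have "(\<lambda>y. max 0 (- y)) -` {m..} \<inter> space endpoint_law = {..- m}" using m by (auto simp: max_def split: if_splits)
    then show ?thesis by (subst emeasure_distr) auto
  qed
  also have "\<dots> + \<dots> = ennreal (2 * (1 - std_normal_cdf ((x + m) / sqrt (t - s))))"
  proof -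
    interpret Nn: real_distribution std_normal_distribution by (rule real_dist_normal_dist)
    have "std_normal_cdf y \<le> 1" for y by (rule Nn.cdf_bounded_prob)
    then show ?thesis unfolding emeasure_normal_density_lower_tail[OF sd_pos]
      by (subst ennreal_plus[symmetric]) auto
  qed
  also have "\<dots> = (\<integral>\<^sup>+v\<in>{0<..<t - s}. ennreal (hitting_density (x + m) v) \<partial>lborel)"
    using nn_integral_hitting_density_time[of "x + m" "t - s"] m x_nonneg s_less_t by simp
  also have "emeasure ?P {m..} + 0 = emeasure M {\<omega> \<in> space M. m \<le> L t \<omega> - l0}"
    by (subst emeasure_distr) (auto intro!: arg_cong[where f="emeasure M"])
  finally show ?thesis .
qed

end

section \<open>The law of the inverse local time\<close>

context spider_clock
begin

lemma inverse_clock_section_measurable [measurable]: "(\<lambda>\<omega>. inverse_clock (\<omega>, l)) \<in> borel_measurable M"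
  by (rule measurable_compose[OF measurable_Pair2' inverse_clock_measurable]) simp

context
  assumes law: "\<And>u m. s < u \<Longrightarrow> u \<le> t \<Longrightarrow> 0 < m \<Longrightarrow>
    emeasure M {\<omega> \<in> space M. m \<le> L u \<omega> - l0} = (\<integral>\<^sup>+v\<in>{0<..<u - s}. ennreal (hitting_density (x + m) v) \<partial>lborel)"
begin

text \<open>Reaching \<open>l\<close> by a time \<open>a\<close> in \<open>(s, t]\<close> means
  \<open>l \<le> L a\<close>, so \<open>law\<close> provides the distribution function of the clock
  time on the paths that reach \<open>l\<close>. The law of the local time is required at all times
  up to \<open>t\<close>, whereas the locale fixes \<open>t\<close>. It is therefore a hypothesis
  here, supplied later by clocks with other horizons.\<close>

lemma nn_integral_inverse_clock_section:
  assumes l: "l0 < l" and \<kappa> [measurable]: "\<kappa> \<in> borel_measurable borel"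
  shows "(\<integral>\<^sup>+\<omega>. indicator {\<omega> \<in> space M. l \<le> L t \<omega>} \<omega> * \<kappa> (inverse_clock (\<omega>, l)) \<partial>M) =
    (\<integral>\<^sup>+u\<in>{s<..<t}. ennreal (hitting_density (x + (l - l0)) (u - s)) * \<kappa> u \<partial>lborel)"
proof -
  define m where "m = l - l0"
  have m: "0 < m" using l by (simp add: m_def)
  let ?B = "{\<omega> \<in> space M. l \<le> L t \<omega>}"
  let ?d = "\<lambda>u. indicator {s<..<t} u * ennreal (hitting_density (x + m) (u - s))"
  let ?D = "distr (density M (indicator ?B)) borel (\<lambda>\<omega>. inverse_clock (\<omega>, l))"
  let ?E = "density lborel ?d"
  have B: "?B \<in> sets M" by measurable
  have reg: "(\<omega>, l) \<in> clock_region \<longleftrightarrow> \<omega> \<in> ?B" for \<omega>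
    using l by (auto simp: clock_region_def space_pair_measure)
  have E: "emeasure ?E {..a} = (\<integral>\<^sup>+v\<in>{0<..<min a t - s}. ennreal (hitting_density (x + m) v) \<partial>lborel)" for a
  proof -
    have "emeasure ?E {..a} = (\<integral>\<^sup>+u. ?d u * indicator {..a} u \<partial>lborel)" by (simp add: emeasure_density)
    also have "\<dots> = (\<integral>\<^sup>+u. ennreal (hitting_density (x + m) (u - s)) * indicator {s<..<min a t} u \<partial>lborel)"
      using AE_lborel_singleton[of a]
      by (intro nn_integral_cong_AE) (auto elim!: eventually_mono split: split_indicator)
    also have "\<dots> = ennreal \<bar>1\<bar> * (\<integral>\<^sup>+v. ennreal (hitting_density (x + m) (s + 1 * v - s)) * indicator {s<..<min a t} (s + 1 * v) \<partial>lborel)"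
      by (rule nn_integral_real_affine) auto
    also have "\<dots> = (\<integral>\<^sup>+v\<in>{0<..<min a t - s}. ennreal (hitting_density (x + m) v) \<partial>lborel)"
      by (auto intro!: nn_integral_cong split: split_indicator)
    finally show ?thesis .
  qed
  have D: "emeasure ?D {..a} = emeasure M {\<omega> \<in> space M. l \<le> L t \<omega> \<and> inverse_clock (\<omega>, l) \<le> a}" for a
  proof -
    have "emeasure ?D {..a} = emeasure (density M (indicator ?B)) {\<omega> \<in> space M. inverse_clock (\<omega>, l) \<le> a}"
      by (subst emeasure_distr) (auto intro!: arg_cong2[where f=emeasure])
    also have "\<dots> = emeasure M (?B \<inter> {\<omega> \<in> space M. inverse_clock (\<omega>, l) \<le> a})"
      by (rule emeasure_restricted[OF B]) measurable
    also have "?B \<inter> {\<omega> \<in> space M. inverse_clock (\<omega>, l) \<le> a} = {\<omega> \<in> space M. l \<le> L t \<omega> \<and> inverse_clock (\<omega>, l) \<le> a}"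
      by auto
    finally show ?thesis .
  qed
  \<comment> \<open>Levels above \<open>l0\<close> are reached strictly after \<open>s\<close>, so
    both sides vanish for \<open>a \<le> s\<close>; a time beyond \<open>t\<close> may be replaced
    by \<open>t\<close>.\<close>
  have DE: "emeasure ?D {..a} = emeasure ?E {..a}" for a
  proof (cases "a \<le> s")
    case True
    have e: "{\<omega> \<in> space M. l \<le> L t \<omega> \<and> inverse_clock (\<omega>, l) \<le> a} = {}"
    proof -
      have "s < inverse_clock (\<omega>, l)" if "\<omega> \<in> space M" "l \<le> L t \<omega>" for \<omega>
        using inverse_clock_gt[of "(\<omega>, l)"] reg that by auto
      then show ?thesis using True by force
    qed
    have "{0<..<min a t - s} = {}" using True by auto
    then show ?thesis unfolding D E e by simp
  next
    case False
    let ?c = "min a t"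
    have c: "s < ?c" "?c \<le> t" "?c \<in> {s..t}" using False s_less_t by auto
    have "l \<le> L t \<omega> \<and> inverse_clock (\<omega>, l) \<le> a \<longleftrightarrow> m \<le> L ?c \<omega> - l0" if \<omega>: "\<omega> \<in> space M" for \<omega>
    proof
      assume *: "l \<le> L t \<omega> \<and> inverse_clock (\<omega>, l) \<le> a"
      then have r: "(\<omega>, l) \<in> clock_region" using reg \<omega> by auto
      then have "inverse_clock (\<omega>, l) \<le> ?c" using inverse_clock_mem(1)[OF r] * by auto
      then show "m \<le> L ?c \<omega> - l0" using inverse_clock_mem(3)[OF r c(3)] by (simp add: m_def)
    next
      assume "m \<le> L ?c \<omega> - l0"
      then have lc: "l \<le> L ?c \<omega>" by (simp add: m_def)
      then have lt: "l \<le> L t \<omega>" using L_bounds[OF \<omega> c(3)] by simp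
      then have r: "(\<omega>, l) \<in> clock_region" using reg \<omega> by auto
      show "l \<le> L t \<omega> \<and> inverse_clock (\<omega>, l) \<le> a" using lt inverse_clock_mem(3)[OF r c(3)] lc by auto
    qed
    then have "{\<omega> \<in> space M. l \<le> L t \<omega> \<and> inverse_clock (\<omega>, l) \<le> a} = {\<omega> \<in> space M. m \<le> L ?c \<omega> - l0}" by blast
    then show ?thesis unfolding D E by (simp only: law[OF c(1,2) m])
  qed
  have dm: "?d \<in> borel_measurable lborel" by measurable
  have fE: "finite_measure ?E"
  proof (rule finite_measureI)
    have "emeasure ?E (space ?E) = emeasure ?E {..t}"
      by (auto simp: emeasure_density intro!: nn_integral_cong split: split_indicator)
    also have "\<dots> = emeasure ?D {..t}" by (rule DE[symmetric])
    also have "\<dots> < \<infinity>" unfolding D using emeasure_finite by (simp add: less_top[symmetric])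
    finally show "emeasure ?E (space ?E) \<noteq> \<infinity>" by simp
  qed
  have fD: "finite_measure ?D"
  proof (rule finite_measure.finite_measure_distr)
    show "finite_measure (density M (indicator ?B))"
      using finite_measure_restricted[OF B] .
  qed measurable
  have "?D = ?E"
  proof (rule cdf_unique')
    show "finite_borel_measure ?D" "finite_borel_measure ?E"
      using fD fE by (auto simp: finite_borel_measure_def finite_borel_measure_axioms_def)
    show "cdf ?D = cdf ?E" by (simp add: cdf_def fun_eq_iff measure_def DE)
  qed
  then have "(\<integral>\<^sup>+u. \<kappa> u \<partial>?D) = (\<integral>\<^sup>+u. \<kappa> u \<partial>?E)" by simp
  also have "(\<integral>\<^sup>+u. \<kappa> u \<partial>?D) = (\<integral>\<^sup>+\<omega>. indicator ?B \<omega> * \<kappa> (inverse_clock (\<omega>, l)) \<partial>M)"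
    by (subst nn_integral_distr, simp, simp, subst nn_integral_density) auto
  also have "(\<integral>\<^sup>+u. \<kappa> u \<partial>?E) = (\<integral>\<^sup>+u\<in>{s<..<t}. ennreal (hitting_density (x + m) (u - s)) * \<kappa> u \<partial>lborel)"
    by (subst nn_integral_density[OF dm]) (auto intro!: nn_integral_cong split: split_indicator)
  finally show ?thesis unfolding m_def .
qed

lemma nn_integral_inverse_clock:
  assumes \<kappa> [measurable]: "\<kappa> \<in> borel_measurable (borel \<Otimes>\<^sub>M borel)"
  shows "(\<integral>\<^sup>+z. \<kappa> (inverse_clock z, snd z) \<partial>clock_measure) =
    (\<integral>\<^sup>+l\<in>{l0<..}. (\<integral>\<^sup>+u\<in>{s<..<t}. ennreal (hitting_density (x + (l - l0)) (u - s)) * \<kappa> (u, l) \<partial>lborel) \<partial>lborel)"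
proof -
  interpret P: pair_sigma_finite M lborel ..
  have "(\<integral>\<^sup>+z. \<kappa> (inverse_clock z, snd z) \<partial>clock_measure) = (\<integral>\<^sup>+z. indicator clock_region z * \<kappa> (inverse_clock z, snd z) \<partial>(M \<Otimes>\<^sub>M lborel))"
    unfolding clock_measure_def by (subst nn_integral_density) auto
  also have "\<dots> = (\<integral>\<^sup>+l. (\<integral>\<^sup>+\<omega>. indicator clock_region (\<omega>, l) * \<kappa> (inverse_clock (\<omega>, l), l) \<partial>M) \<partial>lborel)"
    by (subst P.nn_integral_snd[symmetric]) auto
  also have "\<dots> = (\<integral>\<^sup>+l\<in>{l0<..}. (\<integral>\<^sup>+u\<in>{s<..<t}. ennreal (hitting_density (x + (l - l0)) (u - s)) * \<kappa> (u, l) \<partial>lborel) \<partial>lborel)"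
  proof (rule nn_integral_cong)
    fix l :: real
    show "(\<integral>\<^sup>+\<omega>. indicator clock_region (\<omega>, l) * \<kappa> (inverse_clock (\<omega>, l), l) \<partial>M) =
      (\<integral>\<^sup>+u\<in>{s<..<t}. ennreal (hitting_density (x + (l - l0)) (u - s)) * \<kappa> (u, l) \<partial>lborel) * indicator {l0<..} l"
    proof (cases "l0 < l")
      case True
      have "(\<integral>\<^sup>+\<omega>. indicator clock_region (\<omega>, l) * \<kappa> (inverse_clock (\<omega>, l), l) \<partial>M) =
        (\<integral>\<^sup>+\<omega>. indicator {\<omega> \<in> space M. l \<le> L t \<omega>} \<omega> * \<kappa> (inverse_clock (\<omega>, l), l) \<partial>M)"
        using True by (intro nn_integral_cong) (auto simp: clock_region_def space_pair_measure split: split_indicator)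
      also have "\<dots> = (\<integral>\<^sup>+u\<in>{s<..<t}. ennreal (hitting_density (x + (l - l0)) (u - s)) * \<kappa> (u, l) \<partial>lborel)"
        by (rule nn_integral_inverse_clock_section[OF True, of "\<lambda>u. \<kappa> (u, l)"]) measurable
      finally show ?thesis using True by simp
    next
      case False
      then have "(\<omega>, l) \<notin> clock_region" for \<omega> by (auto simp: clock_region_def)
      then show ?thesis using False by simp
    qed
  qed
  finally show ?thesis .
qed

text \<open>The law of the clock time has a density on \<open>(s, t)\<close>, so \<open>t\<close>
  itself is not charged. Strictness matters because the sine transform of
  \<open>hitting_density y r\<close> is available for \<open>0 < r\<close>.\<close>

lemma AE_inverse_clock_less: "AE z in clock_measure. inverse_clock z < t"
proof -
  have "(\<integral>\<^sup>+z. indicator ({t..} \<times> UNIV) (inverse_clock z, snd z) \<partial>clock_measure) =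
     (\<integral>\<^sup>+l\<in>{l0<..}. (\<integral>\<^sup>+u\<in>{s<..<t}. ennreal (hitting_density (x + (l - l0)) (u - s)) * indicator ({t..} \<times> UNIV) (u, l) \<partial>lborel) \<partial>lborel)"
    by (rule nn_integral_inverse_clock) simp
  also have "\<dots> = 0"
  proof -
    have "ennreal (hitting_density (x + (l - l0)) (u - s)) * indicator ({t..} \<times> UNIV) (u, l) * indicator {s<..<t} u = 0" for u l
      by (auto split: split_indicator)
    then show ?thesis by (simp only: mult_zero_left nn_integral_const)
  qed
  finally have "(\<integral>\<^sup>+z. indicator ({t..} \<times> UNIV) (inverse_clock z, snd z) \<partial>clock_measure) = 0" .
  moreover have "(\<lambda>z. indicator ({t..} \<times> UNIV) (inverse_clock z, snd z) :: ennreal) \<in> borel_measurable clock_measure"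
    by measurable
  ultimately have "AE z in clock_measure. indicator ({t..} \<times> UNIV) (inverse_clock z, snd z) = (0::ennreal)"
    by (subst (asm) nn_integral_0_iff_AE)
  then show ?thesis by eventually_elim (auto split: split_indicator_asm)
qed

end

end

section \<open>The law at a fixed time\<close>

text \<open>In its first argument the hitting density has a Gaussian primitive, so integrating over
  levels leaves a Gaussian value. The bound serves to show that \<open>kernel_density\<close> has
  finite mass.\<close>

lemma nn_integral_hitting_density_space:
  assumes r: "0 < r" and c: "0 \<le> c"
  shows "(\<integral>\<^sup>+m\<in>{0<..}. ennreal (hitting_density (c + m) r) \<partial>lborel) \<le> ennreal (normal_density 0 (sqrt r) c)"
proof -
  let ?F = "\<lambda>m. - normal_density 0 (sqrt r) (c + m)"
  have "(\<integral>\<^sup>+m. ennreal (hitting_density (c + m) r) * indicator {0..} m \<partial>lborel) = ennreal (0 - ?F 0)"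
  proof (rule nn_integral_FTC_atLeast[where F="?F" and T=0 and f="\<lambda>m. hitting_density (c + m) r"])
    define k where "k = 1 / sqrt (2 * pi * r)"
    have k: "normal_density 0 (sqrt r) = (\<lambda>y. k * exp (- (y\<^sup>2 / (2 * r))))"
      using r by (auto simp: normal_density_def fun_eq_iff k_def)
    show "(?F has_real_derivative hitting_density (c + m) r) (at m)" if "0 \<le> m" for m
      unfolding hitting_density_eq_normal[OF r] k using r
      by (auto intro!: derivative_eq_intros simp: field_simps)
    show "0 \<le> hitting_density (c + m) r" if "0 \<le> m" for m
      using that c r by (intro hitting_density_nonneg) auto
    show "(?F \<longlongrightarrow> 0) at_top" unfolding k using r by real_asymp
  qed measurable
  then have "(\<integral>\<^sup>+m. ennreal (hitting_density (c + m) r) * indicator {0..} m \<partial>lborel) = ennreal (normal_density 0 (sqrt r) c)"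
    by simp
  moreover have "(\<integral>\<^sup>+m\<in>{0<..}. ennreal (hitting_density (c + m) r) \<partial>lborel) \<le> (\<integral>\<^sup>+m\<in>{0..}. ennreal (hitting_density (c + m) r) \<partial>lborel)"
    by (intro nn_integral_mono) (auto split: split_indicator)
  ultimately show ?thesis by simp
qed

text \<open>One formula serves both starting points: \<open>x = 0\<close> gives the junction
  density, \<open>x > 0\<close> the branch density. The level \<open>l0 + m\<close> is reached after
  a time \<open>u\<close>, \<open>a\<close> weights the branch, and the remaining time belongs to an
  unfinished excursion found at \<open>y\<close>. Values in \<open>ennreal\<close> allow Tonelli
  before integrability is known.\<close>

definition kernel_density :: "(real \<Rightarrow> real \<Rightarrow> real) \<Rightarrow> real \<Rightarrow> real \<Rightarrow> real \<Rightarrow> real \<Rightarrow> real \<Rightarrow> real \<Rightarrow> ennreal" where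
  "kernel_density a s t l0 x y m =
    (\<integral>\<^sup>+u\<in>{0<..<t - s}. ennreal (a (s + u) (l0 + m) * (2 * hitting_density y (t - s - u)) * hitting_density (x + m) u) \<partial>lborel)"

text \<open>With \<open>a\<close> replaced by its bound 1, the integrand is twice the convolution of
  two hitting densities.\<close>

lemma kernel_density_le:
  assumes a: "\<And>u l. 0 \<le> a u l" "\<And>u l. a u l \<le> 1"
    and pos: "0 < y" "0 < x + m" and st: "s < t"
  shows "kernel_density a s t l0 x y m \<le> ennreal (2 * hitting_density (x + m + y) (t - s))"
proof -
  have "kernel_density a s t l0 x y m \<le> (\<integral>\<^sup>+u. 2 * (ennreal (hitting_density (x + m) u * hitting_density y (t - s - u)) * indicator {0<..<t - s} u) \<partial>lborel)"
    unfolding kernel_density_def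
  proof (intro nn_integral_mono)
    fix u :: real
    show "ennreal (a (s + u) (l0 + m) * (2 * hitting_density y (t - s - u)) * hitting_density (x + m) u) * indicator {0<..<t - s} u
       \<le> 2 * (ennreal (hitting_density (x + m) u * hitting_density y (t - s - u)) * indicator {0<..<t - s} u)"
    proof (cases "u \<in> {0<..<t - s}")
      case True
      have nn: "0 \<le> hitting_density y (t - s - u)" "0 \<le> hitting_density (x + m) u"
        using True pos by (auto intro!: hitting_density_nonneg)
      have "a (s + u) (l0 + m) * (2 * hitting_density y (t - s - u)) * hitting_density (x + m) u \<le>
          1 * (2 * hitting_density y (t - s - u)) * hitting_density (x + m) u"
        using nn a by (intro mult_right_mono) auto
      then have "ennreal (a (s + u) (l0 + m) * (2 * hitting_density y (t - s - u)) * hitting_density (x + m) u) \<le>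
         ennreal (2 * (hitting_density (x + m) u * hitting_density y (t - s - u)))"
        by (intro ennreal_leI) (simp add: mult_ac)
      then show ?thesis using True nn by (simp add: ennreal_mult)
    qed simp
  qed
  also have "\<dots> = 2 * (\<integral>\<^sup>+u\<in>{0<..<t - s}. ennreal (hitting_density (x + m) u * hitting_density y (t - s - u)) \<partial>lborel)"
    by (rule nn_integral_cmult) measurable
  also have "\<dots> = ennreal (2 * hitting_density (x + m + y) (t - s))"
    using hitting_density_convolution[OF pos(2,1), of "t - s"] st hitting_density_nonneg[of "x + m + y" "t - s"] pos
    by (simp add: ennreal_mult)
  finally show ?thesis .
qed

text \<open>Integrating the bound of \<open>kernel_density_le\<close> over the levels gives at most
  twice a Gaussian density at \<open>x + y\<close>, hence at most twice that at \<open>y\<close>,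
  which is integrable.\<close>

lemma kernel_density_finite:
  assumes a: "\<And>u l. 0 \<le> a u l" "\<And>u l. a u l \<le> 1"
    and x: "0 \<le> x" and st: "s < t"
  shows "(\<integral>\<^sup>+y\<in>{0<..}. (\<integral>\<^sup>+m\<in>{0<..}. kernel_density a s t l0 x y m \<partial>lborel) \<partial>lborel) < \<infinity>"
proof -
  have "(\<integral>\<^sup>+m\<in>{0<..}. kernel_density a s t l0 x y m \<partial>lborel) \<le> 2 * ennreal (normal_density 0 (sqrt (t - s)) y)" if y: "0 < y" for y
  proof -
    have "(\<integral>\<^sup>+m\<in>{0<..}. kernel_density a s t l0 x y m \<partial>lborel) \<le> (\<integral>\<^sup>+m. 2 * (ennreal (hitting_density ((x + y) + m) (t - s)) * indicator {0<..} m) \<partial>lborel)"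
    proof (intro nn_integral_mono)
      fix m :: real
      show "kernel_density a s t l0 x y m * indicator {0<..} m \<le> 2 * (ennreal (hitting_density ((x + y) + m) (t - s)) * indicator {0<..} m)"
        using kernel_density_le[OF a y, where x=x and m=m and s=s and t=t and ?l0.0=l0] x st y hitting_density_nonneg[of "x + y + m" "t - s"]
        by (auto simp: ac_simps ennreal_mult split: split_indicator)
    qed
    also have "\<dots> = 2 * (\<integral>\<^sup>+m\<in>{0<..}. ennreal (hitting_density ((x + y) + m) (t - s)) \<partial>lborel)"
      by (rule nn_integral_cmult) measurable
    also have "\<dots> \<le> 2 * ennreal (normal_density 0 (sqrt (t - s)) (x + y))"
      using nn_integral_hitting_density_space[of "t - s" "x + y"] x y st by (intro mult_left_mono) auto
    also have "\<dots> \<le> 2 * ennreal (normal_density 0 (sqrt (t - s)) y)"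
      using x y st by (intro mult_left_mono ennreal_leI) (auto simp: normal_density_def divide_right_mono power_mono)
    finally show ?thesis .
  qed
  then have "(\<integral>\<^sup>+y\<in>{0<..}. (\<integral>\<^sup>+m\<in>{0<..}. kernel_density a s t l0 x y m \<partial>lborel) \<partial>lborel) \<le>
     (\<integral>\<^sup>+y. 2 * ennreal (normal_density 0 (sqrt (t - s)) y) \<partial>lborel)"
    by (intro nn_integral_mono) (auto split: split_indicator)
  also have "\<dots> = 2 * (\<integral>\<^sup>+y. ennreal (normal_density 0 (sqrt (t - s)) y) \<partial>lborel)"
    by (rule nn_integral_cmult) measurable
  also have "\<dots> = 2 * ennreal (LBINT y. normal_density 0 (sqrt (t - s)) y)"
    using st by (subst nn_integral_eq_integral) auto
  also have "\<dots> < \<infinity>" by (simp add: ennreal_mult_less_top)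
  finally show ?thesis .
qed

section \<open>Spatial densities attached to the clock times\<close>

context spider_clock
begin

abbreviation exit_density :: "'i \<Rightarrow> ('w \<times> real) \<times> real \<Rightarrow> real" where
  "exit_density j w \<equiv> \<alpha> j (inverse_clock (fst w)) (snd (fst w)) * (2 * hitting_density (snd w) (t - inverse_clock (fst w))) * indicator {0<..} (snd w)"

lemma exit_density_measurable [measurable]: "exit_density j \<in> borel_measurable (clock_measure \<Otimes>\<^sub>M lborel)"
  by measurable

lemma inverse_clock_le: "inverse_clock z \<le> t"
  using inverse_clock_mem(1)[of z] by (cases "z \<in> clock_region") (auto simp: inverse_clock_def)

text \<open>Clock times equal to \<open>t\<close> are covered because the hitting density at time 0
  is 0.\<close>

lemma exit_density_nonneg: "0 \<le> exit_density j w"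
  using alpha_nonneg[of j] inverse_clock_le[of "fst w"]
  by (auto simp: hitting_density_def split: split_indicator intro!: mult_nonneg_nonneg)

context
  assumes law: "\<And>u m. s < u \<Longrightarrow> u \<le> t \<Longrightarrow> 0 < m \<Longrightarrow>
    emeasure M {\<omega> \<in> space M. m \<le> L u \<omega> - l0} = (\<integral>\<^sup>+v\<in>{0<..<u - s}. ennreal (hitting_density (x + m) v) \<partial>lborel)"
begin

text \<open>The law of the clock time at each level is inserted, times and levels are counted from
  \<open>s\<close> and \<open>l0\<close>, and the order of integration is exchanged until the time
  integral, which is \<open>kernel_density\<close>, is innermost.\<close>

lemma nn_integral_exit_density:
  assumes f [measurable]: "f \<in> borel_measurable (borel \<Otimes>\<^sub>M borel)"
  shows "(\<integral>\<^sup>+w. ennreal (exit_density j w) * f (snd w, snd (fst w) - l0) \<partial>(clock_measure \<Otimes>\<^sub>M lborel)) =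
    (\<integral>\<^sup>+y\<in>{0<..}. (\<integral>\<^sup>+m\<in>{0<..}. kernel_density (\<alpha> j) s t l0 x y m * f (y, m) \<partial>lborel) \<partial>lborel)"
proof -
  interpret CL: pair_sigma_finite clock_measure lborel ..
  define \<kappa> where "\<kappa> p = (\<integral>\<^sup>+y. ennreal (\<alpha> j (fst p) (snd p) * (2 * hitting_density y (t - fst p)) * indicator {0<..} y) * f (y, snd p - l0) \<partial>lborel)" for p
  have \<kappa> [measurable]: "\<kappa> \<in> borel_measurable (borel \<Otimes>\<^sub>M borel)" unfolding \<kappa>_def[abs_def] by measurable
  define \<Phi> where "\<Phi> m v y = ennreal (hitting_density (x + m) v) * (ennreal (\<alpha> j (s + v) (l0 + m) * (2 * hitting_density y (t - s - v)) * indicator {0<..} y) * f (y, m))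
      * indicator {0<..<t - s} v * indicator {0<..} m" for m v y
  have \<Phi>m [measurable (raw)]: "(\<lambda>w. \<Phi> (p w) (q w) (r w)) \<in> borel_measurable N"
    if [measurable]: "p \<in> borel_measurable N" "q \<in> borel_measurable N" "r \<in> borel_measurable N" for p q r and N :: "'z measure"
    unfolding \<Phi>_def by measurable
  have "(\<integral>\<^sup>+w. ennreal (exit_density j w) * f (snd w, snd (fst w) - l0) \<partial>(clock_measure \<Otimes>\<^sub>M lborel)) =
     (\<integral>\<^sup>+z. \<kappa> (inverse_clock z, snd z) \<partial>clock_measure)"
    unfolding \<kappa>_def by (subst lborel.nn_integral_fst[symmetric]) auto
  also have "\<dots> = (\<integral>\<^sup>+l. (\<integral>\<^sup>+u. ennreal (hitting_density (x + (l - l0)) (u - s)) * \<kappa> (u, l) * indicator {s<..<t} u \<partial>lborel) * indicator {l0<..} l \<partial>lborel)"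
    by (rule nn_integral_inverse_clock[OF law \<kappa>])
  also have "\<dots> = ennreal \<bar>1\<bar> * (\<integral>\<^sup>+m. (\<integral>\<^sup>+u. ennreal (hitting_density (x + (l0 + 1 * m - l0)) (u - s)) * \<kappa> (u, l0 + 1 * m) * indicator {s<..<t} u \<partial>lborel) * indicator {l0<..} (l0 + 1 * m) \<partial>lborel)"
    using \<kappa> by (intro nn_integral_real_affine) auto
  also have "\<dots> = (\<integral>\<^sup>+m. (\<integral>\<^sup>+v. (\<integral>\<^sup>+y. \<Phi> m v y \<partial>lborel) \<partial>lborel) \<partial>lborel)"
  proof -
    have "(\<integral>\<^sup>+u. ennreal (hitting_density (x + (l0 + 1 * m - l0)) (u - s)) * \<kappa> (u, l0 + 1 * m) * indicator {s<..<t} u \<partial>lborel) * indicator {l0<..} (l0 + 1 * m) =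
       (\<integral>\<^sup>+v. (\<integral>\<^sup>+y. \<Phi> m v y \<partial>lborel) \<partial>lborel)" for m
    proof -
      have km: "(\<lambda>u. \<kappa> (u, l0 + m)) \<in> borel_measurable borel" using \<kappa> by measurable
      have "(\<integral>\<^sup>+u. ennreal (hitting_density (x + m) (u - s)) * \<kappa> (u, l0 + m) * indicator {s<..<t} u \<partial>lborel) =
         ennreal \<bar>1\<bar> * (\<integral>\<^sup>+v. ennreal (hitting_density (x + m) (s + 1 * v - s)) * \<kappa> (s + 1 * v, l0 + m) * indicator {s<..<t} (s + 1 * v) \<partial>lborel)"
        using km by (intro nn_integral_real_affine) auto
      also have "\<dots> = (\<integral>\<^sup>+v. ennreal (hitting_density (x + m) v) * \<kappa> (s + v, l0 + m) * indicator {0<..<t - s} v \<partial>lborel)"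
        by (auto intro!: nn_integral_cong split: split_indicator)
      finally have e: "(\<integral>\<^sup>+u. ennreal (hitting_density (x + m) (u - s)) * \<kappa> (u, l0 + m) * indicator {s<..<t} u \<partial>lborel) = \<dots>" .
      have p: "(\<integral>\<^sup>+y. \<Phi> m v y \<partial>lborel) = ennreal (hitting_density (x + m) v) * \<kappa> (s + v, l0 + m) * indicator {0<..<t - s} v * indicator {0<..} m" for v
        unfolding \<Phi>_def \<kappa>_def by (simp add: nn_integral_multc nn_integral_cmult diff_diff_eq)
      have q: "(\<integral>\<^sup>+v. (\<integral>\<^sup>+y. \<Phi> m v y \<partial>lborel) \<partial>lborel) = (\<integral>\<^sup>+v. ennreal (hitting_density (x + m) v) * \<kappa> (s + v, l0 + m) * indicator {0<..<t - s} v \<partial>lborel) * indicator {0<..} m"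
        unfolding p using \<kappa> by (intro nn_integral_multc) measurable
      show ?thesis unfolding q e[symmetric] by (simp add: indicator_def)
    qed
    then show ?thesis by simp
  qed
  also have "\<dots> = (\<integral>\<^sup>+m. (\<integral>\<^sup>+y. (\<integral>\<^sup>+v. \<Phi> m v y \<partial>lborel) \<partial>lborel) \<partial>lborel)"
    by (intro nn_integral_cong lborel_pair.Fubini') measurable
  also have "\<dots> = (\<integral>\<^sup>+y. (\<integral>\<^sup>+m. (\<integral>\<^sup>+v. \<Phi> m v y \<partial>lborel) \<partial>lborel) \<partial>lborel)"
    by (intro lborel_pair.Fubini') measurable
  also have "\<dots> = (\<integral>\<^sup>+y\<in>{0<..}. (\<integral>\<^sup>+m\<in>{0<..}. kernel_density (\<alpha> j) s t l0 x y m * f (y, m) \<partial>lborel) \<partial>lborel)"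
  proof -
    have "(\<integral>\<^sup>+v. \<Phi> m v y \<partial>lborel) = kernel_density (\<alpha> j) s t l0 x y m * f (y, m) * indicator {0<..} m * indicator {0<..} y" for m y
    proof -
      have eq: "\<Phi> m v y = ennreal (\<alpha> j (s + v) (l0 + m) * (2 * hitting_density y (t - s - v)) * hitting_density (x + m) v) * indicator {0<..<t - s} v
          * (f (y, m) * indicator {0<..} m * indicator {0<..} y)" for v
      proof (cases "0 < m \<and> 0 < y \<and> v \<in> {0<..<t - s}")
        case True
        then have "0 \<le> hitting_density (x + m) v" "0 \<le> hitting_density y (t - s - v)"
          using x_nonneg by (auto intro!: hitting_density_nonneg)
        then show ?thesis using True alpha_nonneg[of j] by (simp add: \<Phi>_def ennreal_mult mult_ac)
      qed (auto simp: \<Phi>_def split: split_indicator)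
      have "(\<integral>\<^sup>+v. \<Phi> m v y \<partial>lborel) = kernel_density (\<alpha> j) s t l0 x y m * (f (y, m) * indicator {0<..} m * indicator {0<..} y)"
        unfolding kernel_density_def eq by (rule nn_integral_multc) measurable
      then show ?thesis by (simp only: mult.assoc)
    qed
    then have "(\<integral>\<^sup>+m. (\<integral>\<^sup>+v. \<Phi> m v y \<partial>lborel) \<partial>lborel) = (\<integral>\<^sup>+m\<in>{0<..}. kernel_density (\<alpha> j) s t l0 x y m * f (y, m) \<partial>lborel) * indicator {0<..} y" for y
      by (auto split: split_indicator)
    then show ?thesis by simp
  qed
  finally show ?thesis .
qed

end

end

section \<open>Joint law of position and local time on a branch\<close>

context spider_clock
begin

context
  assumes law: "\<And>u m. s < u \<Longrightarrow> u \<le> t \<Longrightarrow> 0 < m \<Longrightarrow>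
    emeasure M {\<omega> \<in> space M. m \<le> L u \<omega> - l0} = (\<integral>\<^sup>+v\<in>{0<..<u - s}. ennreal (hitting_density (x + m) v) \<partial>lborel)"
begin

lemma integrable_exit_density: "integrable (clock_measure \<Otimes>\<^sub>M lborel) (exit_density j)"
proof -
  have "(\<integral>\<^sup>+w. ennreal (exit_density j w) \<partial>(clock_measure \<Otimes>\<^sub>M lborel)) < \<infinity>"
    using nn_integral_exit_density[OF law, of "\<lambda>_. 1" j] kernel_density_finite[of "\<alpha> j" x s t l0] alpha_nonneg[of j] alpha_le_1[of j] x_nonneg s_less_t
    by simp
  then show ?thesis
    using exit_density_nonneg[of j] by (intro integrableI_nonneg) auto
qed

text \<open>At a fixed clock point before time \<open>t\<close> the integral over \<open>y\<close>
  is \<open>hitting_density_sine_transform\<close>. The exit density is made for this: it reproduces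
  the last term of \<open>sine_identity\<close>.\<close>

lemma exit_sine_transform:
  assumes n: "0 \<le> n"
  shows "(\<integral>w. exit_density j w * (exp (- n * (snd (fst w) - l0)) * sin (\<theta> * snd w)) \<partial>(clock_measure \<Otimes>\<^sub>M lborel)) =
    \<theta> * kernel_integral n \<theta> (\<lambda>z. \<alpha> j (inverse_clock z) (snd z))"
proof -
  interpret CL: pair_sigma_finite clock_measure lborel ..
  let ?h = "\<lambda>w. exit_density j w * (exp (- n * (snd (fst w) - l0)) * sin (\<theta> * snd w))"
  have AE_reg: "AE w in clock_measure \<Otimes>\<^sub>M lborel. fst w \<in> clock_region"
  proof -
    have "AE z in clock_measure. AE y in lborel. fst (z, y) \<in> clock_region"
      using AE_clock_measure by eventually_elim simp
    then show ?thesis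
    proof (rule CL.AE_pair_measure[rotated])
      have "clock_region \<in> sets clock_measure" unfolding sets_clock_measure by (rule clock_region_sets)
      from measurable_sets[OF measurable_fst this, of lborel]
      show "{w \<in> space (clock_measure \<Otimes>\<^sub>M lborel). fst w \<in> clock_region} \<in> sets (clock_measure \<Otimes>\<^sub>M lborel)"
        by (simp add: vimage_def Int_def conj_commute)
    qed
  qed
  have int: "integrable (clock_measure \<Otimes>\<^sub>M lborel) ?h"
  proof (rule Bochner_Integration.integrable_bound[OF integrable_exit_density[of j]])
    show "AE w in clock_measure \<Otimes>\<^sub>M lborel. norm (?h w) \<le> norm (exit_density j w)"
      using AE_reg
    proof eventually_elim
      case (elim w)
      then have "exp (- n * (snd (fst w) - l0)) \<le> 1" using n by (simp add: clock_region_def)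
      then have "\<bar>exp (- n * (snd (fst w) - l0)) * sin (\<theta> * snd w)\<bar> \<le> 1"
        by (auto simp: abs_mult intro!: mult_le_one)
      from mult_left_mono[OF this, of "\<bar>exit_density j w\<bar>"] show ?case
        by (simp add: abs_mult)
    qed
  qed measurable
  have "(\<integral>w. ?h w \<partial>(clock_measure \<Otimes>\<^sub>M lborel)) = (\<integral>z. (LBINT y. ?h (z, y)) \<partial>clock_measure)"
    by (rule CL.integral_fst'[OF int, symmetric])
  also have "\<dots> = (\<integral>z. \<theta> * (exp (- n * (snd z - l0)) * (\<alpha> j (inverse_clock z) (snd z) * exp (- (\<theta>\<^sup>2 * (t - inverse_clock z) / 2)))) \<partial>clock_measure)"
  proof (rule integral_cong_AE)
    show "AE z in clock_measure. (LBINT y. ?h (z, y)) = \<theta> * (exp (- n * (snd z - l0)) * (\<alpha> j (inverse_clock z) (snd z) * exp (- (\<theta>\<^sup>2 * (t - inverse_clock z) / 2))))"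
    proof -
      have "AE z in clock_measure. inverse_clock z < t"
        by (rule AE_inverse_clock_less) (rule law)
      then show ?thesis
    proof eventually_elim
      case (elim z)
      have "(LBINT y. ?h (z, y)) = (LBINT y. (\<alpha> j (inverse_clock z) (snd z) * exp (- n * (snd z - l0))) * (indicator {0<..} y *\<^sub>R (2 * hitting_density y (t - inverse_clock z) * sin (\<theta> * y))))"
        by (intro Bochner_Integration.integral_cong) (auto simp: mult_ac)
      also have "\<dots> = (\<alpha> j (inverse_clock z) (snd z) * exp (- n * (snd z - l0))) * (LBINT y:{0<..}. 2 * hitting_density y (t - inverse_clock z) * sin (\<theta> * y))"
        unfolding set_lebesgue_integral_def by (rule integral_mult_right_zero)
      also have "(LBINT y:{0<..}. 2 * hitting_density y (t - inverse_clock z) * sin (\<theta> * y)) = \<theta> * exp (- (\<theta>\<^sup>2 * (t - inverse_clock z) / 2))"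
        using elim by (intro hitting_density_sine_transform) simp
      finally show ?case by (simp add: mult_ac)
    qed
    qed
    show "(\<lambda>z. LBINT y. ?h (z, y)) \<in> borel_measurable clock_measure"
      by measurable
  qed measurable
  finally show ?thesis unfolding kernel_integral_def by simp
qed

text \<open>The right side of \<open>sine_identity\<close> is the transform of a sum of two explicit
  measures: \<open>?\<nu>1\<close>, the image of the exit density, and \<open>?\<nu>2\<close>, the
  absorbed density carried by the line of zero local time increment. Uniqueness of the transform
  identifies the law on sets away from the junction.\<close>

lemma endpoint_law_on_branch:
  assumes B: "B \<in> sets (borel \<Otimes>\<^sub>M borel)" "\<And>z. z \<in> B \<Longrightarrow> 0 < fst z"
  shows "emeasure M {\<omega> \<in> space M. (\<rho> j t \<omega>, L t \<omega> - l0) \<in> B} =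
    (\<integral>\<^sup>+y\<in>{0<..}. (\<integral>\<^sup>+m\<in>{0<..}. kernel_density (\<alpha> j) s t l0 x y m * indicator B (y, m) \<partial>lborel) \<partial>lborel) +
    (\<integral>\<^sup>+y\<in>{0<..}. of_bool (i = j) * ennreal (absorbed_density (t - s) x y) * indicator B (y, 0) \<partial>lborel)"
proof -
  let ?BB = "borel \<Otimes>\<^sub>M borel :: (real \<times> real) measure"
  let ?C = "clock_measure \<Otimes>\<^sub>M lborel"
  let ?\<mu> = "distr M ?BB (\<lambda>\<omega>. (\<rho> j t \<omega>, L t \<omega> - l0))"
  let ?e = "\<lambda>w. (snd w, snd (fst w) - l0)"
  let ?k1 = "density ?C (\<lambda>w. ennreal (exit_density j w))"
  let ?\<nu>1 = "distr ?k1 ?BB ?e"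
  define a where "a y = of_bool (i = j) * absorbed_density (t - s) x y * indicator {0<..} y" for y
  let ?k2 = "density lborel (\<lambda>y. ennreal (a y))"
  let ?\<nu>2 = "distr ?k2 ?BB (\<lambda>y. (y, 0))"
  have a_meas [measurable]: "a \<in> borel_measurable borel"
    unfolding a_def absorbed_density_def by measurable
  have a_nonneg: "0 \<le> a y" for y
    using absorbed_density_nonneg[of "t - s" x y] s_less_t x_nonneg by (auto simp: a_def split: split_indicator)
  have a_int: "integrable lborel a"
  proof -
    have "integrable lborel (\<lambda>y. normal_density x (sqrt (t - s)) y - normal_density (- x) (sqrt (t - s)) y)"
      using sd_pos by (intro Bochner_Integration.integrable_diff integrable_normal_density)
    then have "integrable lborel (\<lambda>y. absorbed_density (t - s) x y)"
      using s_less_t by (simp add: absorbed_density_eq_normal)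
    then show ?thesis
      by (rule Bochner_Integration.integrable_bound) (auto simp: a_def split: split_indicator)
  qed
  have e_meas [measurable]: "?e \<in> measurable ?C ?BB" by measurable
  have \<mu>_meas [measurable]: "(\<lambda>\<omega>. (\<rho> j t \<omega>, L t \<omega> - l0)) \<in> measurable M ?BB" by measurable
  have fin1: "finite_measure ?\<nu>1"
  proof (rule finite_measure.finite_measure_distr)
    show "finite_measure ?k1"
    proof (rule finite_measureI)
      have "emeasure ?k1 (space ?k1) = (\<integral>\<^sup>+w. ennreal (exit_density j w) * indicator (space ?C) w \<partial>?C)"
        unfolding space_density
      proof (rule emeasure_density)
        show "(\<lambda>w. ennreal (exit_density j w)) \<in> borel_measurable ?C" by measurable
      qed (rule sets.top)
      also have "\<dots> = (\<integral>\<^sup>+w. ennreal (exit_density j w) \<partial>?C)"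
        by (rule nn_integral_cong) (simp del: space_pair_measure)
      also have "\<dots> < \<infinity>"
        using integrable_exit_density[of j] exit_density_nonneg[of j] by (simp add: integrable_iff_bounded)
      finally show "emeasure ?k1 (space ?k1) \<noteq> \<infinity>" by simp
    qed
  qed simp
  have fin2: "finite_measure ?\<nu>2"
  proof (rule finite_measure.finite_measure_distr)
    show "finite_measure ?k2"
    proof (rule finite_measureI)
      have "emeasure ?k2 (space ?k2) = (\<integral>\<^sup>+y. ennreal (a y) \<partial>lborel)"
        by (simp add: emeasure_density cong: nn_integral_cong)
      also have "\<dots> < \<infinity>"
        using a_int a_nonneg by (simp add: integrable_iff_bounded)
      finally show "emeasure ?k2 (space ?k2) \<noteq> \<infinity>" by simp
    qed
  qed simp
  have em1: "emeasure ?\<nu>1 C = (\<integral>\<^sup>+y\<in>{0<..}. (\<integral>\<^sup>+m\<in>{0<..}. kernel_density (\<alpha> j) s t l0 x y m * indicator C (y, m) \<partial>lborel) \<partial>lborel)"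
    if C [measurable]: "C \<in> sets ?BB" for C
  proof -
    have "emeasure ?\<nu>1 C = (\<integral>\<^sup>+p. indicator C p \<partial>?\<nu>1)" using C by simp
    also have "\<dots> = (\<integral>\<^sup>+w. indicator C (?e w) \<partial>?k1)"
      by (rule nn_integral_distr) auto
    also have "\<dots> = (\<integral>\<^sup>+w. ennreal (exit_density j w) * indicator C (?e w) \<partial>?C)"
      by (rule nn_integral_density) measurable
    also have "\<dots> = (\<integral>\<^sup>+y\<in>{0<..}. (\<integral>\<^sup>+m\<in>{0<..}. kernel_density (\<alpha> j) s t l0 x y m * indicator C (y, m) \<partial>lborel) \<partial>lborel)"
      by (rule nn_integral_exit_density[OF law]) measurable
    finally show ?thesis .
  qed
  have em2: "emeasure ?\<nu>2 C = (\<integral>\<^sup>+y\<in>{0<..}. of_bool (i = j) * ennreal (absorbed_density (t - s) x y) * indicator C (y, 0) \<partial>lborel)"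
    if C [measurable]: "C \<in> sets ?BB" for C
  proof -
    have "emeasure ?\<nu>2 C = (\<integral>\<^sup>+p. indicator C p \<partial>?\<nu>2)" using C by simp
    also have "\<dots> = (\<integral>\<^sup>+y. indicator C (y, 0) \<partial>?k2)"
      by (rule nn_integral_distr) auto
    also have "\<dots> = (\<integral>\<^sup>+y. ennreal (a y) * indicator C (y, 0) \<partial>lborel)"
      by (rule nn_integral_density) measurable
    also have "\<dots> = (\<integral>\<^sup>+y\<in>{0<..}. of_bool (i = j) * ennreal (absorbed_density (t - s) x y) * indicator C (y, 0) \<partial>lborel)"
      by (intro nn_integral_cong) (auto simp: a_def split: split_indicator)
    finally show ?thesis .
  qed
  \<comment> \<open>Both candidate measures live on positive distances and nonnegative increments,
    which yields the sign conditions of \<open>sine_laplace_transform_unique\<close>.\<close>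
  have null: "C \<in> null_sets ?\<nu>1" "C \<in> null_sets ?\<nu>2"
    if C: "C \<in> sets ?BB" and out: "\<And>y m. 0 < y \<Longrightarrow> 0 \<le> m \<Longrightarrow> (y, m) \<notin> C" for C
  proof -
    have "(\<integral>\<^sup>+m\<in>{0<..}. kernel_density (\<alpha> j) s t l0 x y m * indicator C (y, m) \<partial>lborel) * indicator {0<..} y = 0" for y
    proof (cases "0 < y")
      case True
      have "kernel_density (\<alpha> j) s t l0 x y m * indicator C (y, m) * indicator {0<..} m = 0" for m
        using out[OF True, of m] by (auto split: split_indicator)
      then show ?thesis by (simp only: nn_integral_const mult_zero_left)
    qed simp
    then have "emeasure ?\<nu>1 C = 0" unfolding em1[OF C] by (simp only: nn_integral_const mult_zero_left)
    then show "C \<in> null_sets ?\<nu>1" using C by (simp add: null_sets_def)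
    have "of_bool (i = j) * ennreal (absorbed_density (t - s) x y) * indicator C (y, 0) * indicator {0<..} y = 0" for y
      using out[of y 0] by (auto split: split_indicator)
    then have "emeasure ?\<nu>2 C = 0" unfolding em2[OF C] by (simp only: nn_integral_const mult_zero_left)
    then show "C \<in> null_sets ?\<nu>2" using C by (simp add: null_sets_def)
  qed
  have null_sets_plus: "C \<in> null_sets (plus_measure ?\<nu>1 ?\<nu>2)"
    if "C \<in> sets ?BB" "C \<in> null_sets ?\<nu>1" "C \<in> null_sets ?\<nu>2" for C
    using that by (auto simp: null_sets_def sets_plus_measure emeasure_plus_measure)
  have "{z. fst z < (0::real)} = fst -` {..<0} \<inter> space ?BB" "{z. snd z < (0::real)} = snd -` {..<0} \<inter> space ?BB"
    by (auto simp: space_pair_measure)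
  then have neg: "{z. fst z < (0::real)} \<in> sets ?BB" "{z. snd z < (0::real)} \<in> sets ?BB"
    by (simp_all only:) (rule measurable_sets[of _ ?BB borel]; simp)+
  have "emeasure ?\<mu> B = emeasure (plus_measure ?\<nu>1 ?\<nu>2) B"
  proof (rule sine_laplace_transform_unique[OF _ _ _ _ _ _ _ _ _ B])
    show "finite_measure ?\<mu>" by (rule finite_measure_distr) simp
    show "finite_measure (plus_measure ?\<nu>1 ?\<nu>2)" by (rule finite_measure_plus_measure[OF _ fin1 fin2]) simp
    show "AE z in ?\<mu>. 0 \<le> fst z"
      by (subst AE_distr_iff) (auto intro!: AE_I2 rho_nonneg)
    show "AE z in ?\<mu>. 0 \<le> snd z"
      using L_bounds[of _ t] s_less_t by (subst AE_distr_iff) (auto intro!: AE_I2)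
    show "AE z in plus_measure ?\<nu>1 ?\<nu>2. 0 \<le> fst z" "AE z in plus_measure ?\<nu>1 ?\<nu>2. 0 \<le> snd z"
      using AE_not_in[OF null_sets_plus[OF neg(1) null[OF neg(1)]]] AE_not_in[OF null_sets_plus[OF neg(2) null[OF neg(2)]]]
      by (auto simp: not_less)
    fix n :: nat and \<theta> :: real
    let ?f = "\<lambda>z. exp (- real n * snd z) * sin (\<theta> * fst z)"
    have f [measurable]: "?f \<in> borel_measurable ?BB" by measurable
    have "(\<integral>z. ?f z \<partial>?\<nu>1) = (\<integral>w. ?f (?e w) \<partial>?k1)" by (rule integral_distr) auto
    also have "\<dots> = (\<integral>w. exit_density j w *\<^sub>R ?f (?e w) \<partial>?C)"
      using exit_density_nonneg[of j] by (intro integral_density) auto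
    also have "\<dots> = \<theta> * kernel_integral n \<theta> (\<lambda>z. \<alpha> j (inverse_clock z) (snd z))"
      using exit_sine_transform[of n j \<theta>] by simp
    finally have i1: "(\<integral>z. ?f z \<partial>?\<nu>1) = \<theta> * kernel_integral n \<theta> (\<lambda>z. \<alpha> j (inverse_clock z) (snd z))" .
    have "(\<integral>z. ?f z \<partial>?\<nu>2) = (\<integral>y. ?f (y, 0) \<partial>?k2)" by (rule integral_distr) auto
    also have "\<dots> = (LBINT y. a y *\<^sub>R ?f (y, 0))"
      using a_nonneg by (intro integral_density) auto
    also have "\<dots> = (LBINT y. of_bool (i = j) * (indicator {0<..} y *\<^sub>R (absorbed_density (t - s) x y * sin (\<theta> * y))))"
      by (intro Bochner_Integration.integral_cong) (auto simp: a_def)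
    also have "\<dots> = of_bool (i = j) * (LBINT y:{0<..}. absorbed_density (t - s) x y * sin (\<theta> * y))"
      unfolding set_lebesgue_integral_def by (rule integral_mult_right_zero)
    also have "\<dots> = exp (- (\<theta>\<^sup>2 * (t - s) / 2)) * sin (\<theta> * (if j = i then x else 0))"
      using absorbed_density_sine_transform[of "t - s" x \<theta>] s_less_t by auto
    finally have i2: "(\<integral>z. ?f z \<partial>?\<nu>2) = exp (- (\<theta>\<^sup>2 * (t - s) / 2)) * sin (\<theta> * (if j = i then x else 0))" .
    have bd: "integrable K ?f" if "finite_measure K" "sets K = sets ?BB" "AE z in K. 0 \<le> snd z" for K
      using that(3)
      by (intro finite_measure.integrable_const_bound[OF that(1), where B=1])
        (auto simp: measurable_cong_sets[OF that(2) refl] abs_mult elim!: eventually_mono intro!: mult_le_one)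
    have "AE z in ?\<nu>1. 0 \<le> snd z" "AE z in ?\<nu>2. 0 \<le> snd z"
      using AE_not_in[OF null(1)[OF neg(2)]] AE_not_in[OF null(2)[OF neg(2)]] by (auto simp: not_less)
    then have p1: "integrable ?\<nu>1 ?f" "integrable ?\<nu>2 ?f"
      using bd[OF fin1] bd[OF fin2] by auto
    have "(\<integral>z. ?f z \<partial>?\<mu>) = (\<integral>\<omega>. exp (- real n * (L t \<omega> - l0)) * sin (\<theta> * \<rho> j t \<omega>) \<partial>M)"
      by (subst integral_distr) auto
    also have "\<dots> = (\<integral>z. ?f z \<partial>?\<nu>2) + (\<integral>z. ?f z \<partial>?\<nu>1)"
      unfolding i1 i2 by (rule sine_identity) simp
    also have "\<dots> = (\<integral>z. ?f z \<partial>plus_measure ?\<nu>1 ?\<nu>2)"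
      using p1 by (subst integral_plus_measure) auto
    finally show "(\<integral>z. ?f z \<partial>?\<mu>) = (\<integral>z. ?f z \<partial>plus_measure ?\<nu>1 ?\<nu>2)" .
  qed (auto simp: sets_plus_measure)
  also have "\<dots> = emeasure ?\<nu>1 B + emeasure ?\<nu>2 B"
    using B(1) by (intro emeasure_plus_measure) auto
  also have "emeasure ?\<mu> B = emeasure M {\<omega> \<in> space M. (\<rho> j t \<omega>, L t \<omega> - l0) \<in> B}"
    using B(1) by (subst emeasure_distr) (auto intro!: arg_cong[where f="emeasure M"])
  finally show ?thesis unfolding em1[OF B(1)] em2[OF B(1)] .
qed

end

end

section \<open>From the martingale problem to the inverse local time\<close>

text \<open>This is the substitution \<open>l = a u\<close>: the Stieltjes measure is the image of
  Lebesgue measure on the levels under the inverse of \<open>a\<close>. It suffices to compare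
  half-open intervals, whose preimages under \<open>\<tau>\<close> are intervals of levels by the
  Galois connection.\<close>

lemma stieltjes_eq_distr:
  fixes a \<tau> :: "real \<Rightarrow> real"
  assumes sr: "s \<le> r" and cont: "continuous_on {s..r} a" and mono: "mono_on {s..r} a"
    and \<tau>_meas [measurable]: "\<tau> \<in> borel_measurable borel"
    and \<tau>: "\<And>l u. a s < l \<Longrightarrow> l \<le> a r \<Longrightarrow> s \<le> u \<Longrightarrow> u \<le> r \<Longrightarrow> \<tau> l \<le> u \<longleftrightarrow> l \<le> a u"
  shows "stieltjes s r a = distr (density lborel (indicator {a s<..a r})) borel \<tau>"
proof -
  define F where "F u = a (max s (min r u))" for u
  let ?D = "distr (density lborel (indicator {a s<..a r})) borel \<tau>"
  have mem: "max s (min r u) \<in> {s..r}" for u using sr by auto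
  have Fmono: "F u \<le> F v" if "u \<le> v" for u v
    unfolding F_def using that mem by (intro mono_onD[OF mono]) auto
  have Fb: "a s \<le> F u" "F u \<le> a r" for u
    unfolding F_def using mem sr by (auto intro!: mono_onD[OF mono])
  have "continuous_on UNIV F"
    unfolding F_def using mem by (intro continuous_on_compose2[OF cont] continuous_intros) auto
  then have Fc: "continuous (at_right u) F" for u
    by (auto simp: continuous_on_eq_continuous_within intro: continuous_within_subset)
  have I: "emeasure (stieltjes s r a) {c<..d} = ennreal (F d - F c)" if "c \<le> d" for c d
    unfolding stieltjes_def F_def[symmetric] using that Fmono Fc by (intro emeasure_interval_measure_Ioc) auto
  \<comment> \<open>The hypothesis only speaks about times in \<open>{s..r}\<close>; since
    \<open>\<tau> l\<close> lies there, clamping \<open>u\<close> extends the equivalence to all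
    real times.\<close>
  have iff: "\<tau> l \<le> u \<longleftrightarrow> l \<le> F u" if l: "a s < l" "l \<le> a r" for l u
  proof -
    have "s < \<tau> l" "\<tau> l \<le> r" using \<tau>[OF l, of s] \<tau>[OF l, of r] l sr by auto
    then have "\<tau> l \<le> u \<longleftrightarrow> \<tau> l \<le> max s (min r u)" by auto
    also have "\<dots> \<longleftrightarrow> l \<le> F u" unfolding F_def using \<tau>[OF l] mem[of u] by auto
    finally show ?thesis .
  qed
  have D: "emeasure ?D {c<..d} = ennreal (F d - F c)" if cd: "c \<le> d" for c d
  proof -
    have "emeasure ?D {c<..d} = emeasure (density lborel (indicator {a s<..a r})) (\<tau> -` {c<..d})"
      by (subst emeasure_distr) auto
    also have "\<dots> = emeasure lborel ({a s<..a r} \<inter> \<tau> -` {c<..d})"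
      using measurable_sets[OF \<tau>_meas, of "{c<..d}"] by (intro emeasure_restricted) auto
    also have "{a s<..a r} \<inter> \<tau> -` {c<..d} = {F c<..F d}"
      using iff[of _ c] iff[of _ d] Fb[of c] Fb[of d] by (auto simp: not_le[symmetric])
    finally show ?thesis using Fmono[OF cd] by simp
  qed
  show ?thesis
  proof (rule measure_eqI_generator_eq[where E="range (\<lambda>(c, d). {c<..d})" and \<Omega>=UNIV and A="\<lambda>i. {- real i<..real i}"])
    show "Int_stable (range (\<lambda>(c, d). {c<..d::real}))"
      by (auto simp: Int_stable_def)
    show "emeasure (stieltjes s r a) Y = emeasure ?D Y" if "Y \<in> range (\<lambda>(c, d). {c<..d})" for Y
    proof -
      obtain c d where Y: "Y = {c<..d}" using \<open>Y \<in> _\<close> by auto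
      show ?thesis unfolding Y by (cases "c \<le> d") (simp_all add: I D)
    qed
    show "sets (stieltjes s r a) = sigma_sets UNIV (range (\<lambda>(c, d). {c<..d}))"
      "sets ?D = sigma_sets UNIV (range (\<lambda>(c, d). {c<..d}))"
      by (simp_all add: stieltjes_def borel_sigma_sets_Ioc)
    show "(\<Union>i. {- real i<..real i}) = UNIV"
    proof -
      have "\<exists>i::nat. - real i < z \<and> z \<le> real i" for z
      proof -
        obtain i where "\<bar>z\<bar> < real i" using reals_Archimedean2 by blast
        then show ?thesis by (intro exI[of _ i]) auto
      qed
      then show ?thesis by auto
    qed
    show "emeasure (stieltjes s r a) {- real i<..real i} \<noteq> \<infinity>" for i
      by (subst I) auto
  qed auto
qed

lemma integral_stieltjes:
  fixes a \<tau> f :: "real \<Rightarrow> real"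
  assumes sr: "s \<le> r" and cont: "continuous_on {s..r} a" and mono: "mono_on {s..r} a"
    and \<tau>_meas [measurable]: "\<tau> \<in> borel_measurable borel"
    and \<tau>: "\<And>l u. a s < l \<Longrightarrow> l \<le> a r \<Longrightarrow> s \<le> u \<Longrightarrow> u \<le> r \<Longrightarrow> \<tau> l \<le> u \<longleftrightarrow> l \<le> a u"
    and f: "continuous_on {s..r} f"
  shows "(LINT u:{s..r}|stieltjes s r a. f u) = (LBINT l:{a s<..a r}. f (\<tau> l))"
proof -
  \<comment> \<open>Continuity of \<open>f\<close> is known on \<open>{s..r}\<close> only, so the
    indicator stays attached to it for measurability.\<close>
  have fm [measurable]: "(\<lambda>u. indicator {s..r} u *\<^sub>R f u) \<in> borel_measurable borel"
    using f by (intro borel_measurable_continuous_on_indicator) auto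
  have "(LINT u:{s..r}|stieltjes s r a. f u) = (\<integral>l. indicator {s..r} (\<tau> l) *\<^sub>R f (\<tau> l) \<partial>density lborel (indicator {a s<..a r}))"
  proof -
    have E: "stieltjes s r a = distr (density lborel (indicator {a s<..a r})) borel \<tau>"
      by (rule stieltjes_eq_distr[OF sr cont mono \<tau>_meas]) (rule \<tau>)
    show ?thesis unfolding set_lebesgue_integral_def E by (rule integral_distr[OF _ fm]) simp
  qed
  also have "\<dots> = (LBINT l. indicator {a s<..a r} l *\<^sub>R (indicator {s..r} (\<tau> l) *\<^sub>R f (\<tau> l)))"
    unfolding ennreal_indicator[symmetric]
    by (rule integral_density) (use measurable_compose[OF \<tau>_meas fm] in auto)
  also have "\<dots> = (LBINT l:{a s<..a r}. f (\<tau> l))"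
    unfolding set_lebesgue_integral_def
  proof (rule Bochner_Integration.integral_cong[OF refl])
    fix l
    show "indicator {a s<..a r} l *\<^sub>R (indicator {s..r} (\<tau> l) *\<^sub>R f (\<tau> l)) = indicator {a s<..a r} l *\<^sub>R f (\<tau> l)"
      using \<tau>[of l s] \<tau>[of l r] sr by (auto split: split_indicator)
  qed
  finally show ?thesis .
qed

text \<open>The random time is approximated by
  \<open>\<lfloor>(n + 1) * \<sigma>\<rfloor> / (n + 1)\<close>, which takes countably many values;
  continuity of the paths allows the passage to the limit.\<close>

lemma continuous_process_at_measurable:
  fixes W :: "real \<Rightarrow> 'w \<Rightarrow> real"
  assumes W: "\<And>u. W u \<in> borel_measurable M" and c: "\<And>\<omega>. \<omega> \<in> space M \<Longrightarrow> continuous_on UNIV (\<lambda>u. W u \<omega>)"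
    and \<pi> [measurable]: "\<pi> \<in> measurable N M" and \<sigma> [measurable]: "\<sigma> \<in> borel_measurable N"
  shows "(\<lambda>z. W (\<sigma> z) (\<pi> z)) \<in> borel_measurable N"
proof (rule borel_measurable_LIMSEQ_real)
  let ?d = "\<lambda>n z. of_int \<lfloor>real (Suc n) * \<sigma> z\<rfloor> / real (Suc n)"
  show "(\<lambda>n. W (?d n z) (\<pi> z)) \<longlonglongrightarrow> W (\<sigma> z) (\<pi> z)" if "z \<in> space N" for z
  proof (rule continuous_on_tendsto_compose[OF c[OF measurable_space[OF \<pi> that]]])
    have b: "\<bar>?d n z - \<sigma> z\<bar> \<le> 1 / real (Suc n)" for n
    proof -
      have "\<bar>of_int \<lfloor>real (Suc n) * \<sigma> z\<rfloor> - real (Suc n) * \<sigma> z\<bar> \<le> 1" by linarith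
      then have "\<bar>of_int \<lfloor>real (Suc n) * \<sigma> z\<rfloor> - real (Suc n) * \<sigma> z\<bar> / real (Suc n) \<le> 1 / real (Suc n)"
        by (intro divide_right_mono) auto
      also have "\<bar>of_int \<lfloor>real (Suc n) * \<sigma> z\<rfloor> - real (Suc n) * \<sigma> z\<bar> / real (Suc n) = \<bar>?d n z - \<sigma> z\<bar>"
      proof -
        have "?d n z - \<sigma> z = (of_int \<lfloor>real (Suc n) * \<sigma> z\<rfloor> - real (Suc n) * \<sigma> z) / real (Suc n)"
          by (simp add: diff_divide_distrib del: of_nat_Suc)
        then show ?thesis by (simp add: abs_divide del: of_nat_Suc)
      qed
      finally show ?thesis .
    qed
    have "(\<lambda>n. ?d n z - \<sigma> z) \<longlonglongrightarrow> 0"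
      by (rule Lim_null_comparison[OF _ LIMSEQ_Suc[OF lim_1_over_n]]) (use b in \<open>auto simp del: of_nat_Suc\<close>)
    then show "(\<lambda>n. ?d n z) \<longlonglongrightarrow> \<sigma> z" by (simp only: LIM_zero_iff)
  qed auto
  show "(\<lambda>z. W (?d n z) (\<pi> z)) \<in> borel_measurable N" for n
  proof (rule measurable_compose_countable[where f="\<lambda>k z. W (of_int k / real (Suc n)) (\<pi> z)" and g="\<lambda>z. \<lfloor>real (Suc n) * \<sigma> z\<rfloor>"])
    show "(\<lambda>z. W (of_int k / real (Suc n)) (\<pi> z)) \<in> borel_measurable N" for k :: int
      using measurable_compose[OF \<pi> W] .
  qed measurable
qed

text \<open>Boundedness of \<open>Y\<close> and its measurability at time \<open>q\<close> allow it
  to be moved through the conditional expectation. Integrability belongs to the conclusion because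
  that of the compensator is later deduced from it.\<close>

lemma martingale_orthogonal:
  assumes M: "prob_space M" and mart: "martingale M F J Z" and sub: "subalgebra M (F q)"
    and q: "q \<in> J" "r \<in> J" "q \<le> r" and Y: "Y \<in> borel_measurable (F q)" "\<And>\<omega>. \<omega> \<in> space M \<Longrightarrow> \<bar>Y \<omega>\<bar> \<le> C"
  shows "integrable M (\<lambda>\<omega>. Y \<omega> * Z q \<omega>)" "integrable M (\<lambda>\<omega>. Y \<omega> * Z r \<omega>)"
    "(\<integral>\<omega>. Y \<omega> * Z r \<omega> \<partial>M) = (\<integral>\<omega>. Y \<omega> * Z q \<omega> \<partial>M)"
proof -
  interpret prob_space M by fact
  interpret finite_measure_subalgebra M "F q" by unfold_locales (rule sub)
  have Z: "integrable M (Z u)" if "u \<in> J" for u using mart that by (auto simp: martingale_def)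
  have YM [measurable]: "Y \<in> borel_measurable M" using measurable_from_subalg[OF sub Y(1)] .
  have iY: "integrable M (\<lambda>\<omega>. Y \<omega> * Z u \<omega>)" if "u \<in> J" for u
  proof (rule Bochner_Integration.integrable_bound[OF integrable_mult_right[OF Z[OF that], of C]])
    show "(\<lambda>\<omega>. Y \<omega> * Z u \<omega>) \<in> borel_measurable M" using Z[OF that] by measurable
    show "AE \<omega> in M. norm (Y \<omega> * Z u \<omega>) \<le> norm (C * Z u \<omega>)"
      using Y(2) by (intro AE_I2) (force simp: abs_mult intro!: mult_right_mono)
  qed
  then show "integrable M (\<lambda>\<omega>. Y \<omega> * Z q \<omega>)" "integrable M (\<lambda>\<omega>. Y \<omega> * Z r \<omega>)" using q by auto
  have Zr: "Z r \<in> borel_measurable M" using Z[OF q(2)] by auto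
  have "(\<integral>\<omega>. Y \<omega> * Z r \<omega> \<partial>M) = (\<integral>\<omega>. Y \<omega> * real_cond_exp M (F q) (Z r) \<omega> \<partial>M)"
    by (rule real_cond_exp_intg(2)[OF iY[OF q(2)] Y(1) Zr, symmetric])
  also have "\<dots> = (\<integral>\<omega>. Y \<omega> * Z q \<omega> \<partial>M)"
  proof (rule integral_cong_AE)
    have "AE \<omega> in M. real_cond_exp M (F q) (Z r) \<omega> = Z q \<omega>" using mart q by (auto simp: martingale_def)
    then show "AE \<omega> in M. Y \<omega> * real_cond_exp M (F q) (Z r) \<omega> = Y \<omega> * Z q \<omega>" by eventually_elim simp
    show "(\<lambda>\<omega>. Y \<omega> * real_cond_exp M (F q) (Z r) \<omega>) \<in> borel_measurable M" by measurable
    show "(\<lambda>\<omega>. Y \<omega> * Z q \<omega>) \<in> borel_measurable M" using iY[OF q(1)] by auto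
  qed
  finally show "(\<integral>\<omega>. Y \<omega> * Z r \<omega> \<partial>M) = (\<integral>\<omega>. Y \<omega> * Z q \<omega> \<partial>M)" .
qed

section \<open>Trigonometric test functions on the network\<close>

lemma C12b_trig:
  fixes \<theta> :: real
  shows "C12b T (\<lambda>t x. exp (\<theta>\<^sup>2 * t / 2) * sin (\<theta> * x)) (\<lambda>t x. \<theta>\<^sup>2 / 2 * (exp (\<theta>\<^sup>2 * t / 2) * sin (\<theta> * x)))
      (\<lambda>t x. \<theta> * (exp (\<theta>\<^sup>2 * t / 2) * cos (\<theta> * x))) (\<lambda>t x. - \<theta>\<^sup>2 * (exp (\<theta>\<^sup>2 * t / 2) * sin (\<theta> * x)))" (is ?S)
    and "C12b T (\<lambda>t x. exp (\<theta>\<^sup>2 * t / 2) * cos (\<theta> * x)) (\<lambda>t x. \<theta>\<^sup>2 / 2 * (exp (\<theta>\<^sup>2 * t / 2) * cos (\<theta> * x)))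
      (\<lambda>t x. - \<theta> * (exp (\<theta>\<^sup>2 * t / 2) * sin (\<theta> * x))) (\<lambda>t x. - \<theta>\<^sup>2 * (exp (\<theta>\<^sup>2 * t / 2) * cos (\<theta> * x)))" (is ?C)
    and "C12b T (\<lambda>t x. 0) (\<lambda>t x. 0) (\<lambda>t x. 0) (\<lambda>t x. 0)"
proof -
  have bd: "bounded ((\<lambda>(t, x). c * (exp (\<theta>\<^sup>2 * t / 2) * w (\<theta> * x))) ` ({0..T} \<times> {0..}))"
    if w: "\<And>y. \<bar>w y\<bar> \<le> 1" for c :: real and w :: "real \<Rightarrow> real"
  proof (rule boundedI)
    fix y assume "y \<in> (\<lambda>(t, x). c * (exp (\<theta>\<^sup>2 * t / 2) * w (\<theta> * x))) ` ({0..T} \<times> {0..})"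
    then obtain z where "z \<in> {0..T} \<times> {0..}" "y = (\<lambda>(t, x). c * (exp (\<theta>\<^sup>2 * t / 2) * w (\<theta> * x))) z"
      by (rule imageE)
    then have y: "y = c * (exp (\<theta>\<^sup>2 * fst z / 2) * w (\<theta> * snd z))" "fst z \<le> T" by auto
    have "exp (\<theta>\<^sup>2 * fst z / 2) * \<bar>w (\<theta> * snd z)\<bar> \<le> exp (\<theta>\<^sup>2 * T / 2) * 1"
      using y(2) w by (intro mult_mono) (auto intro!: mult_left_mono divide_right_mono)
    then show "norm y \<le> \<bar>c\<bar> * (exp (\<theta>\<^sup>2 * T / 2) * 1)"
      unfolding y by (simp add: abs_mult mult_left_mono)
  qed
  have ct: "continuous_on ({0..T} \<times> {0..}) (\<lambda>(t, x). c * (exp (\<theta>\<^sup>2 * t / 2) * w (\<theta> * x)))"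
    if "continuous_on UNIV w" for c :: real and w :: "real \<Rightarrow> real"
    unfolding case_prod_beta
    by (intro continuous_intros continuous_on_compose2[OF that]) auto
  \<comment> \<open>The functions and all their derivatives are constant multiples of members of two
    families, so continuity and boundedness are checked once for each family.\<close>
  define P where "P h \<longleftrightarrow> continuous_on ({0..T} \<times> {0..}) (\<lambda>(t, x). h t x) \<and> bounded ((\<lambda>(t, x). h t x) ` ({0..T} \<times> {0..}))"
    for h :: "real \<Rightarrow> real \<Rightarrow> real"
  have P_sin: "P (\<lambda>t x. c * (exp (\<theta>\<^sup>2 * t / 2) * sin (\<theta> * x)))"
    and P_cos: "P (\<lambda>t x. c * (exp (\<theta>\<^sup>2 * t / 2) * cos (\<theta> * x)))" for c
    unfolding P_def using bd[of sin] bd[of cos] ct[OF continuous_on_sin[OF continuous_on_id]] ct[OF continuous_on_cos[OF continuous_on_id]]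
    by auto
  have C: "C12b T f ft fx fxx"
    if "\<And>t x. (f t has_real_derivative fx t x) (at x)" "\<And>t x. (fx t has_real_derivative fxx t x) (at x)"
      "\<And>t x. ((\<lambda>t. f t x) has_real_derivative ft t x) (at t)" "P f" "P ft" "P fx" "P fxx" for f ft fx fxx
    using that by (auto simp: C12b_def P_def intro: has_field_derivative_at_within)
  show ?S
  proof (rule C)
    show "P (\<lambda>t x. exp (\<theta>\<^sup>2 * t / 2) * sin (\<theta> * x))" using P_sin[of 1] by simp
  qed (rule P_sin P_cos | (auto intro!: derivative_eq_intros simp: power2_eq_square; fail))+
  show ?C
  proof (rule C)
    show "P (\<lambda>t x. exp (\<theta>\<^sup>2 * t / 2) * cos (\<theta> * x))" using P_cos[of 1] by simp
  qed (rule P_sin P_cos | (auto intro!: derivative_eq_intros simp: power2_eq_square; fail))+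
  show "C12b T (\<lambda>t x. 0) (\<lambda>t x. 0) (\<lambda>t x. 0) (\<lambda>t x. 0)"
    unfolding C12b_def by (auto simp: bounded_iff)
qed

text \<open>Defined through \<open>label\<close> and not through \<open>branch\<close>, so that no
  unspecified branch enters at the junction.\<close>

definition branch_radius :: "'i \<Rightarrow> 'i network \<Rightarrow> real" where
  "branch_radius j q = (if label q = Some j then radius q else 0)"

lemma branch_radius_point: "0 \<le> x \<Longrightarrow> branch_radius j (point x i) = (if j = i then x else 0)"
  unfolding branch_radius_def by transfer auto

lemma branch_radius_nonneg: "0 \<le> branch_radius j q"
  by (simp add: branch_radius_def radius_nonneg)

lemma branch_radius_eq_0: "j \<noteq> branch q \<Longrightarrow> branch_radius j q = 0"
  by (auto simp: branch_radius_def branch_def split: option.splits)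

lemma branch_radius_branch: "branch_radius (branch q) q = radius q"
  using label_eq_None_iff[of q] by (auto simp: branch_radius_def branch_def split: option.splits)

lemma sum_branch_radius: "(\<Sum>j\<in>UNIV. branch_radius j q) = radius (q :: 'i::finite network)"
  by (subst sum.remove[of _ "branch q"]) (auto simp: branch_radius_branch branch_radius_eq_0 intro!: sum.neutral)

text \<open>The distance between points with different labels is the sum of their radii, which
  dominates the single radius that \<open>branch_radius\<close> can see.\<close>

lemma branch_radius_lipschitz: "\<bar>branch_radius j p - branch_radius j q\<bar> \<le> dist p q"
  using radius_nonneg[of p] radius_nonneg[of q] by (auto simp: branch_radius_def dist_network_def)

lemma continuous_branch_radius: "continuous_on A (branch_radius j)"
proof (rule continuous_on_subset)
  have "1-lipschitz_on UNIV (branch_radius j)"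
    by (rule lipschitz_onI) (auto simp: dist_real_def branch_radius_lipschitz)
  then show "continuous_on UNIV (branch_radius j)" by (rule lipschitz_on_continuous_on)
qed simp

lemma branch_radius_measurable [measurable]: "branch_radius j \<in> borel_measurable borel"
  by (rule borel_measurable_continuous_onI[OF continuous_branch_radius])

lemma on_network_single:
  assumes "w 0 = 0"
  shows "on_network (\<lambda>k r y. if k = j then c r * w (\<theta> * y) else 0) r q = c r * w (\<theta> * branch_radius j q)"
proof (cases "j = branch q")
  case True
  then show ?thesis by (simp add: on_network_def branch_radius_branch)
next
  case False
  then show ?thesis using assms by (auto simp: on_network_def branch_radius_eq_0)
qed

section \<open>The spider with regularised paths\<close>

locale spider_process =
  fixes M :: "'w measure" and T :: real and \<alpha> :: "'i::finite \<Rightarrow> real \<Rightarrow> real \<Rightarrow> real" and s x l0 :: real and i :: 'i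
    and X :: "real \<Rightarrow> 'w \<Rightarrow> 'i network" and L :: "real \<Rightarrow> 'w \<Rightarrow> real"
  assumes spider: "brownian_spider M T \<alpha> s (point x i) l0 X L"
    and spin: "spinning_measure T \<alpha>"
    and bounds: "0 \<le> x" "0 \<le> l0" "0 \<le> s" "s < T"
begin

sublocale prob_space M using spider by (simp add: brownian_spider_def)

definition good :: "'w \<Rightarrow> bool" where
  "good \<omega> \<longleftrightarrow> X s \<omega> = point x i \<and> L s \<omega> = l0 \<and> mono_on {s..T} (\<lambda>u. L u \<omega>) \<and>
    (\<integral>\<^sup>+u. indicator {u \<in> {s..T}. 0 < radius (X u \<omega>)} u \<partial>stieltjes s T (\<lambda>u. L u \<omega>)) = 0"

text \<open>The paths that are not good need not form a measurable set, so a null set containing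
  them is chosen; redefining the process on it preserves measurability.\<close>

definition bad :: "'w set" where
  "bad = (SOME N. N \<in> null_sets M \<and> {\<omega> \<in> space M. \<not> good \<omega>} \<subseteq> N)"

lemma bad: "bad \<in> null_sets M" "\<omega> \<in> space M \<Longrightarrow> \<omega> \<notin> bad \<Longrightarrow> good \<omega>"
proof -
  have "AE \<omega> in M. good \<omega>"
    using spider by (auto simp: brownian_spider_def good_def)
  then have "\<exists>N. N \<in> null_sets M \<and> {\<omega> \<in> space M. \<not> good \<omega>} \<subseteq> N"
    by (auto simp: eventually_ae_filter)
  from someI_ex[OF this] have "bad \<in> null_sets M \<and> {\<omega> \<in> space M. \<not> good \<omega>} \<subseteq> bad"
    unfolding bad_def .
  then show "bad \<in> null_sets M" "\<omega> \<in> space M \<Longrightarrow> \<omega> \<notin> bad \<Longrightarrow> good \<omega>" by auto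
qed

lemma bad_sets [measurable]: "bad \<in> sets M" using bad(1) by auto

lemma AE_not_bad: "AE \<omega> in M. \<omega> \<notin> bad" by (rule AE_not_in[OF bad(1)])

definition clamp_time :: "real \<Rightarrow> real" where "clamp_time u = max s (min T u)"

lemma clamp_time_mem: "clamp_time u \<in> {s..T}" using bounds by (auto simp: clamp_time_def)
lemma clamp_time_id: "u \<in> {s..T} \<Longrightarrow> clamp_time u = u" by (auto simp: clamp_time_def)

text \<open>
  The process is frozen outside \<open>[s,T]\<close> and made constant on a null set, so that all its paths are
  good; \<open>ra\<close> extends the spinning measure continuously to the plane.
\<close>

definition rX :: "real \<Rightarrow> 'w \<Rightarrow> 'i network" where
  "rX u \<omega> = (if \<omega> \<in> bad then point x i else X (clamp_time u) \<omega>)"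

definition rL :: "real \<Rightarrow> 'w \<Rightarrow> real" where
  "rL u \<omega> = (if \<omega> \<in> bad then l0 else L (clamp_time u) \<omega>)"

definition ra :: "'i \<Rightarrow> real \<Rightarrow> real \<Rightarrow> real" where
  "ra j u v = \<alpha> j (max 0 (min T u)) (max 0 v)"

lemma X_measurable: "u \<in> {s..T} \<Longrightarrow> X u \<in> borel_measurable M"
  and L_measurable: "u \<in> {s..T} \<Longrightarrow> L u \<in> borel_measurable M"
  and L_nonneg: "\<omega> \<in> space M \<Longrightarrow> u \<in> {s..T} \<Longrightarrow> 0 \<le> L u \<omega>"
  and X_continuous: "\<omega> \<in> space M \<Longrightarrow> continuous_on {s..T} (\<lambda>u. X u \<omega>)"
  and L_continuous: "\<omega> \<in> space M \<Longrightarrow> continuous_on {s..T} (\<lambda>u. L u \<omega>)"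
  using spider by (auto simp: brownian_spider_def)

lemma rX_measurable [measurable]: "rX u \<in> borel_measurable M"
  unfolding rX_def[abs_def] using X_measurable[OF clamp_time_mem] by measurable

lemma rL_measurable [measurable]: "rL u \<in> borel_measurable M"
  unfolding rL_def[abs_def] using L_measurable[OF clamp_time_mem] by measurable

lemma r_eq: "\<omega> \<notin> bad \<Longrightarrow> u \<in> {s..T} \<Longrightarrow> rX u \<omega> = X u \<omega>" "\<omega> \<notin> bad \<Longrightarrow> u \<in> {s..T} \<Longrightarrow> rL u \<omega> = L u \<omega>"
  by (auto simp: rX_def rL_def clamp_time_id)

lemma clamp_time_continuous: "continuous_on A clamp_time"
  unfolding clamp_time_def by (intro continuous_intros)

lemma rX_continuous:
  assumes "\<omega> \<in> space M"
  shows "continuous_on A (\<lambda>u. rX u \<omega>)"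
proof (cases "\<omega> \<in> bad")
  case False
  have "continuous_on A (\<lambda>u. X (clamp_time u) \<omega>)"
    by (rule continuous_on_compose2[OF X_continuous[OF assms] clamp_time_continuous]) (use clamp_time_mem in blast)
  then show ?thesis using False by (simp add: rX_def)
qed (simp add: rX_def)

lemma rL_continuous:
  assumes "\<omega> \<in> space M"
  shows "continuous_on A (\<lambda>u. rL u \<omega>)"
proof (cases "\<omega> \<in> bad")
  case False
  have "continuous_on A (\<lambda>u. L (clamp_time u) \<omega>)"
    by (rule continuous_on_compose2[OF L_continuous[OF assms] clamp_time_continuous]) (use clamp_time_mem in blast)
  then show ?thesis using False by (simp add: rL_def)
qed (simp add: rL_def)

lemma rL_mono: "\<omega> \<in> space M \<Longrightarrow> u \<le> v \<Longrightarrow> rL u \<omega> \<le> rL v \<omega>"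
  using bad(2)[of \<omega>] clamp_time_mem[of u] clamp_time_mem[of v]
  by (auto simp: rL_def good_def clamp_time_def intro!: mono_onD[where A="{s..T}" and f="\<lambda>u. L u \<omega>"])

lemma r_start: "\<omega> \<in> space M \<Longrightarrow> rL s \<omega> = l0" "\<omega> \<in> space M \<Longrightarrow> rX s \<omega> = point x i"
  using bad(2)[of \<omega>] bounds by (auto simp: rL_def rX_def good_def clamp_time_def)

lemma paths: "s < t \<Longrightarrow> local_time_paths M s t l0 rL"
  by unfold_locales (auto simp: rL_continuous rL_mono r_start)

lemma ra_continuous: "continuous_on UNIV (\<lambda>z. ra j (fst z) (snd z))"
proof -
  have "continuous_on ({0..T} \<times> {0..}) (\<lambda>(t, l). \<alpha> j t l)" using spin by (auto simp: spinning_measure_def)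
  then have "continuous_on UNIV (\<lambda>z. (\<lambda>(t, l). \<alpha> j t l) (max 0 (min T (fst z)), max 0 (snd z)))"
    by (rule continuous_on_compose2) (use bounds in \<open>auto intro!: continuous_intros\<close>)
  then show ?thesis by (simp add: ra_def)
qed

lemma ra_measurable: "(\<lambda>z. ra j (fst z) (snd z)) \<in> borel_measurable (borel \<Otimes>\<^sub>M borel)"
  using borel_measurable_continuous_onI[OF ra_continuous] by (simp add: borel_prod)

lemma ra_eq: "u \<in> {s..T} \<Longrightarrow> 0 \<le> v \<Longrightarrow> ra j u v = \<alpha> j u v"
  using bounds by (auto simp: ra_def)

lemma ra_sum: "(\<Sum>j\<in>UNIV. ra j u v) = 1"
  using spin bounds by (auto simp: ra_def spinning_measure_def)

lemma ra_lower_bound: obtains a where "0 < a" "\<And>j u v. a \<le> ra j u v"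
proof -
  from spin obtain a where "a > 0" "\<forall>i. \<forall>t\<in>{0..T}. \<forall>l\<ge>0. a \<le> \<alpha> i t l" by (auto simp: spinning_measure_def)
  then show ?thesis using bounds by (intro that[of a]) (auto simp: ra_def)
qed

lemma ra_nonneg: "0 \<le> ra j u v"
  by (rule ra_lower_bound) (meson less_imp_le order_trans)

lemma ra_le_1: "ra j u v \<le> 1"
  using ra_sum[of u v] member_le_sum[of j UNIV "\<lambda>j. ra j u v"] ra_nonneg by auto

lemma subalgebra_filtration:
  assumes q: "q \<le> T"
  shows "subalgebra M (generated_filtration M s X L q)"
proof -
  let ?G = "{(\<lambda>\<omega>. (X u \<omega>, L u \<omega>)) -` A \<inter> space M | u A. u \<in> {s..q} \<and> A \<in> sets (borel \<Otimes>\<^sub>M borel)}"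
  have "?G \<subseteq> sets M"
  proof safe
    fix u and A :: "('i network \<times> real) set" assume u: "u \<in> {s..q}" and A: "A \<in> sets (borel \<Otimes>\<^sub>M borel)"
    then have "u \<in> {s..T}" using q by auto
    from measurable_sets[OF measurable_Pair[OF X_measurable[OF this] L_measurable[OF this]] A]
    show "(\<lambda>\<omega>. (X u \<omega>, L u \<omega>)) -` A \<inter> space M \<in> sets M" .
  qed
  moreover have G: "?G \<subseteq> Pow (space M)" by auto
  ultimately show ?thesis
    unfolding subalgebra_def generated_filtration_def space_measure_of[OF G] sets_measure_of[OF G]
    by (simp only: sets.sigma_sets_subset)
qed

lemma L_filtration_measurable:
  assumes q: "q \<in> {s..T}"
  shows "L q \<in> borel_measurable (generated_filtration M s X L q)"
proof (rule measurableI)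
  let ?G = "{(\<lambda>\<omega>. (X u \<omega>, L u \<omega>)) -` A \<inter> space M | u A. u \<in> {s..q} \<and> A \<in> sets (borel \<Otimes>\<^sub>M borel)}"
  have G: "?G \<subseteq> Pow (space M)" by auto
  fix B :: "real set" assume B: "B \<in> sets borel"
  have "L q -` B \<inter> space M = (\<lambda>\<omega>. (X q \<omega>, L q \<omega>)) -` (UNIV \<times> B) \<inter> space M" by auto
  also have "\<dots> \<in> ?G"
    using q B by (intro CollectI exI[of _ q] exI[of _ "UNIV \<times> B"]) auto
  finally show "L q -` B \<inter> space (generated_filtration M s X L q) \<in> sets (generated_filtration M s X L q)"
    unfolding generated_filtration_def space_measure_of[OF G] sets_measure_of[OF G] by (rule sigma_sets.Basic)
qed auto

text \<open>The test function is zero off branch \<open>j\<close>, so only that branch has a slope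
  at the junction and the sum over branches in the martingale problem reduces to the term with
  \<open>\<alpha> j\<close>.\<close>

lemma sine_martingale:
  "martingale M (generated_filtration M s X L) {s..T}
     (\<lambda>r \<omega>. exp (\<theta>\<^sup>2 * r / 2) * sin (\<theta> * branch_radius j (X r \<omega>)) -
        exp (\<theta>\<^sup>2 * s / 2) * sin (\<theta> * branch_radius j (point x i)) -
        (LINT u:{s..r}|stieltjes s r (\<lambda>u. L u \<omega>). \<alpha> j u (L u \<omega>) * (\<theta> * exp (\<theta>\<^sup>2 * u / 2))))"
proof -
  define f where "f k t y = (if k = j then exp (\<theta>\<^sup>2 * t / 2) * sin (\<theta> * y) else 0)" for k :: 'i and t y
  define ft where "ft k t y = (if k = j then \<theta>\<^sup>2 / 2 * (exp (\<theta>\<^sup>2 * t / 2) * sin (\<theta> * y)) else 0)" for k :: 'i and t y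
  define fx where "fx k t y = (if k = j then \<theta> * (exp (\<theta>\<^sup>2 * t / 2) * cos (\<theta> * y)) else 0)" for k :: 'i and t y
  define fxx where "fxx k t y = (if k = j then - \<theta>\<^sup>2 * (exp (\<theta>\<^sup>2 * t / 2) * sin (\<theta> * y)) else 0)" for k :: 'i and t y
  have C: "C12b T (f k) (ft k) (fx k) (fxx k)" for k
    using C12b_trig(1)[of T \<theta>] C12b_trig(3)[of T]
    by (cases "k = j") (simp_all add: f_def[abs_def] ft_def[abs_def] fx_def[abs_def] fxx_def[abs_def])
  have 0: "\<forall>k k'. \<forall>t\<in>{0..T}. f k t 0 = f k' t 0" by (auto simp: f_def)
  have m: "martingale M (generated_filtration M s X L) {s..T}
          (\<lambda>r \<omega>. on_network f r (X r \<omega>) - on_network f s (point x i)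
             - (LBINT u:{s..r}. on_network ft u (X u \<omega>) + 1/2 * on_network fxx u (X u \<omega>))
             - (\<Sum>j\<in>UNIV. LINT u:{s..r}|stieltjes s r (\<lambda>u. L u \<omega>). \<alpha> j u (L u \<omega>) * fx j u 0))"
    using spider C 0 unfolding brownian_spider_def by blast
  have d: "on_network ft u q + 1/2 * on_network fxx u q = 0" for u q
    by (simp add: on_network_def ft_def fxx_def)
  have o: "on_network f u q = exp (\<theta>\<^sup>2 * u / 2) * sin (\<theta> * branch_radius j q)" for u q
    unfolding f_def[abs_def] by (rule on_network_single) simp
  have "(\<Sum>k\<in>UNIV. LINT u:{s..r}|stieltjes s r (\<lambda>u. L u \<omega>). \<alpha> k u (L u \<omega>) * fx k u 0) =
     (\<Sum>k\<in>UNIV. if k = j then (LINT u:{s..r}|stieltjes s r (\<lambda>u. L u \<omega>). \<alpha> j u (L u \<omega>) * (\<theta> * exp (\<theta>\<^sup>2 * u / 2))) else 0)" for r \<omega>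
    by (intro sum.cong) (auto simp: fx_def set_lebesgue_integral_def)
  then have S: "(\<Sum>k\<in>UNIV. LINT u:{s..r}|stieltjes s r (\<lambda>u. L u \<omega>). \<alpha> k u (L u \<omega>) * fx k u 0) =
     (LINT u:{s..r}|stieltjes s r (\<lambda>u. L u \<omega>). \<alpha> j u (L u \<omega>) * (\<theta> * exp (\<theta>\<^sup>2 * u / 2)))" for r \<omega>
    by simp
  show ?thesis using m unfolding d o S by (simp add: set_lebesgue_integral_def)
qed

lemma cosine_martingale:
  "martingale M (generated_filtration M s X L) {s..T}
     (\<lambda>r \<omega>. exp (\<theta>\<^sup>2 * r / 2) * cos (\<theta> * radius (X r \<omega>)) - exp (\<theta>\<^sup>2 * s / 2) * cos (\<theta> * radius (point x i)))"
proof -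
  define f where "f k t y = exp (\<theta>\<^sup>2 * t / 2) * cos (\<theta> * y)" for k :: 'i and t y
  define ft where "ft k t y = \<theta>\<^sup>2 / 2 * (exp (\<theta>\<^sup>2 * t / 2) * cos (\<theta> * y))" for k :: 'i and t y
  define fx where "fx k t y = - \<theta> * (exp (\<theta>\<^sup>2 * t / 2) * sin (\<theta> * y))" for k :: 'i and t y
  define fxx where "fxx k t y = - \<theta>\<^sup>2 * (exp (\<theta>\<^sup>2 * t / 2) * cos (\<theta> * y))" for k :: 'i and t y
  have C: "C12b T (f k) (ft k) (fx k) (fxx k)" for k
    using C12b_trig(2)[of T \<theta>] by (simp add: f_def[abs_def] ft_def[abs_def] fx_def[abs_def] fxx_def[abs_def])
  have 0: "\<forall>k k'. \<forall>t\<in>{0..T}. f k t 0 = f k' t 0" by (auto simp: f_def)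
  have m: "martingale M (generated_filtration M s X L) {s..T}
          (\<lambda>r \<omega>. on_network f r (X r \<omega>) - on_network f s (point x i)
             - (LBINT u:{s..r}. on_network ft u (X u \<omega>) + 1/2 * on_network fxx u (X u \<omega>))
             - (\<Sum>j\<in>UNIV. LINT u:{s..r}|stieltjes s r (\<lambda>u. L u \<omega>). \<alpha> j u (L u \<omega>) * fx j u 0))"
    using spider C 0 unfolding brownian_spider_def by blast
  have d: "on_network ft u q + 1/2 * on_network fxx u q = 0" for u q
    by (simp add: on_network_def ft_def fxx_def)
  have o: "on_network f u q = exp (\<theta>\<^sup>2 * u / 2) * cos (\<theta> * radius q)" for u q
    by (simp add: on_network_def f_def)
  have z: "\<alpha> k u v * fx k u 0 = 0" for k u v by (simp add: fx_def)
  show ?thesis using m unfolding d o z by (simp add: set_lebesgue_integral_def)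
qed

end

section \<open>The clock of the spider\<close>

context spider_process
begin

text \<open>At the clock time of level \<open>v\<close> the local time is \<open>v\<close>, so the
  level replaces the random second argument of \<open>\<alpha>\<close>. The clock with horizon
  \<open>t\<close> serves for every \<open>r\<close> in \<open>{s..t}\<close>, so that integrals up
  to different times can later be subtracted.\<close>

lemma stieltjes_clock:
  assumes t: "s < t" "t \<le> T" and \<omega>: "\<omega> \<in> space M" "\<omega> \<notin> bad" and r: "r \<in> {s..t}" and c: "continuous_on {s..r} c"
  shows "(LINT u:{s..r}|stieltjes s r (\<lambda>u. L u \<omega>). \<alpha> j u (L u \<omega>) * c u) =
    (LBINT v:{l0<..rL r \<omega>}. ra j (local_time_paths.inverse_clock M s t l0 rL (\<omega>, v)) v * c (local_time_paths.inverse_clock M s t l0 rL (\<omega>, v)))"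
proof -
  interpret P: local_time_paths M s t l0 rL by (rule paths[OF t(1)])
  have sub: "{s..r} \<subseteq> {s..T}" using r t by auto
  have Lc: "continuous_on {s..r} (\<lambda>u. L u \<omega>)" by (rule continuous_on_subset[OF L_continuous[OF \<omega>(1)] sub])
  have gd: "good \<omega>" by (rule bad(2)[OF \<omega>])
  have Lm: "mono_on {s..r} (\<lambda>u. L u \<omega>)" using gd sub by (auto simp: good_def intro: mono_on_subset)
  have Ls: "L s \<omega> = l0" using gd by (simp add: good_def)
  have Lr: "L r \<omega> = rL r \<omega>" using r_eq(2)[OF \<omega>(2), of r] r t by auto
  have reg: "(\<omega>, v) \<in> P.clock_region" if "l0 < v" "v \<le> L r \<omega>" for v
    using that \<omega> P.L_bounds[OF \<omega>(1) r] Lr by (auto simp: P.clock_region_def space_pair_measure)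
  have ac: "continuous_on {s..r} (\<lambda>u. \<alpha> j u (L u \<omega>))"
  proof -
    have "continuous_on ({0..T} \<times> {0..}) (\<lambda>(t, l). \<alpha> j t l)" using spin by (auto simp: spinning_measure_def)
    then have "continuous_on {s..r} (\<lambda>u. (\<lambda>(t, l). \<alpha> j t l) (u, L u \<omega>))"
      by (rule continuous_on_compose2) (use Lc sub bounds L_nonneg[OF \<omega>(1)] in \<open>auto intro!: continuous_intros\<close>)
    then show ?thesis by simp
  qed
  have tm: "(\<lambda>v. P.inverse_clock (\<omega>, v)) \<in> borel_measurable borel"
    using measurable_compose[OF measurable_Pair1'[OF \<omega>(1), of lborel] P.inverse_clock_measurable] by simp
  have "(LINT u:{s..r}|stieltjes s r (\<lambda>u. L u \<omega>). \<alpha> j u (L u \<omega>) * c u) =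
    (LBINT v:{L s \<omega><..L r \<omega>}. \<alpha> j (P.inverse_clock (\<omega>, v)) (L (P.inverse_clock (\<omega>, v)) \<omega>) * c (P.inverse_clock (\<omega>, v)))"
  proof (rule integral_stieltjes[OF _ Lc Lm tm])
    show "s \<le> r" using r by simp
    fix v u assume v: "L s \<omega> < v" "v \<le> L r \<omega>" "s \<le> u" "u \<le> r"
    then have "u \<in> {s..t}" using r by auto
    then show "P.inverse_clock (\<omega>, v) \<le> u \<longleftrightarrow> v \<le> L u \<omega>"
      using P.inverse_clock_mem(3)[OF reg[of v], of u] v Ls r_eq(2)[OF \<omega>(2), of u] t by simp
  qed (intro continuous_on_mult ac c)
  also have "\<dots> = (LBINT v:{l0<..rL r \<omega>}. ra j (P.inverse_clock (\<omega>, v)) v * c (P.inverse_clock (\<omega>, v)))"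
    unfolding set_lebesgue_integral_def Ls Lr
  proof (rule Bochner_Integration.integral_cong[OF refl])
    fix v
    show "indicator {l0<..rL r \<omega>} v *\<^sub>R (\<alpha> j (P.inverse_clock (\<omega>, v)) (L (P.inverse_clock (\<omega>, v)) \<omega>) * c (P.inverse_clock (\<omega>, v))) =
      indicator {l0<..rL r \<omega>} v *\<^sub>R (ra j (P.inverse_clock (\<omega>, v)) v * c (P.inverse_clock (\<omega>, v)))"
    proof (cases "v \<in> {l0<..rL r \<omega>}")
      case True
      then have R: "(\<omega>, v) \<in> P.clock_region" using reg Lr by auto
      have m: "P.inverse_clock (\<omega>, v) \<in> {s..T}" using P.inverse_clock_mem(1)[OF R] t by auto
      then have "L (P.inverse_clock (\<omega>, v)) \<omega> = v"
        using P.L_inverse_clock[OF R] r_eq(2)[OF \<omega>(2) m] by simp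
      then show ?thesis using ra_eq[OF m, of v j] True bounds by simp
    qed simp
  qed
  finally show ?thesis .
qed

text \<open>The uniform lower bound on the spinning measure enters here. The compensator of the sine
  martingale with \<open>\<theta> = 1\<close> dominates a multiple of the increment of the local
  time, and it is integrable as the difference of a bounded variable and a martingale. Any branch
  \<open>j\<close> will do, since the lower bound holds for all of them.\<close>

lemma rL_integrable: "integrable M (rL T)"
proof -
  interpret P: local_time_paths M s T l0 rL by (rule paths[OF bounds(4)])
  obtain a where a: "0 < a" "\<And>j u v. a \<le> ra j u v" using ra_lower_bound by blast
  fix j :: 'i
  define A where "A \<omega> = (LINT u:{s..T}|stieltjes s T (\<lambda>u. L u \<omega>). \<alpha> j u (L u \<omega>) * (1 * exp (1\<^sup>2 * u / 2)))" for \<omega>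
  define W where "W \<omega> = exp (1\<^sup>2 * T / 2) * sin (1 * branch_radius j (X T \<omega>)) -
        exp (1\<^sup>2 * s / 2) * sin (1 * branch_radius j (point x i))" for \<omega>
  have Tm: "T \<in> {s..T}" using bounds by simp
  have WA: "integrable M (\<lambda>\<omega>. W \<omega> - A \<omega>)"
    using sine_martingale[of 1 j] Tm by (auto simp: martingale_def W_def A_def)
  have W: "integrable M W"
    unfolding W_def using X_measurable[OF Tm]
    by (intro Bochner_Integration.integrable_diff integrable_const integrable_mult_right integrable_const_bound[where B=1]) auto
  from Bochner_Integration.integrable_diff[OF W WA] have A: "integrable M A" by simp
  have "AE \<omega> in M. a * (rL T \<omega> - l0) \<le> A \<omega>"
    using AE_not_bad AE_space
  proof eventually_elim
    case (elim \<omega>)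
    let ?\<tau> = "\<lambda>v. P.inverse_clock (\<omega>, v)"
    have tm [measurable]: "?\<tau> \<in> borel_measurable borel"
      using measurable_compose[OF measurable_Pair1'[OF elim(2), of lborel] P.inverse_clock_measurable] by simp
    have ram [measurable]: "(\<lambda>v. ra j (?\<tau> v) v) \<in> borel_measurable borel"
      using measurable_compose[OF measurable_Pair[OF tm measurable_ident] ra_measurable[of j]] by (simp add: id_def)
    have l: "l0 \<le> rL T \<omega>" using P.L_bounds[OF elim(2), of T] bounds by auto
    have tb: "?\<tau> v \<in> {s..T}" for v
      using P.inverse_clock_mem(1)[of "(\<omega>, v)"] bounds by (cases "(\<omega>, v) \<in> P.clock_region") (auto simp: P.inverse_clock_def)
    have e: "A \<omega> = (LBINT v:{l0<..rL T \<omega>}. ra j (?\<tau> v) v * (1 * exp (1\<^sup>2 * ?\<tau> v / 2)))"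
      unfolding A_def using elim bounds by (intro stieltjes_clock) (auto intro!: continuous_intros)
    have "(LBINT v:{l0<..rL T \<omega>}. a) \<le> A \<omega>"
      unfolding e
    proof (rule set_integral_mono)
      show "set_integrable lborel {l0<..rL T \<omega>} (\<lambda>_. a)"
        unfolding set_integrable_def by (auto intro!: integrable_real_mult_indicator simp: l)
      show "set_integrable lborel {l0<..rL T \<omega>} (\<lambda>v. ra j (?\<tau> v) v * (1 * exp (1\<^sup>2 * ?\<tau> v / 2)))"
        unfolding set_integrable_def
      proof (rule Bochner_Integration.integrable_bound)
        show "integrable lborel (\<lambda>v. indicator {l0<..rL T \<omega>} v *\<^sub>R exp (T / 2))"
          using l by (simp add: integrable_real_mult_indicator)
        have "\<bar>ra j (?\<tau> v) v * exp (?\<tau> v / 2)\<bar> \<le> 1 * exp (T / 2)" for v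
          unfolding abs_mult using ra_nonneg ra_le_1 tb[of v] by (intro mult_mono) auto
        then show "AE v in lborel. norm (indicator {l0<..rL T \<omega>} v *\<^sub>R (ra j (?\<tau> v) v * (1 * exp (1\<^sup>2 * ?\<tau> v / 2)))) \<le> norm (indicator {l0<..rL T \<omega>} v *\<^sub>R exp (T / 2))"
          by (auto intro!: AE_I2 split: split_indicator)
      qed measurable
      show "a \<le> ra j (?\<tau> v) v * (1 * exp (1\<^sup>2 * ?\<tau> v / 2))" for v
      proof -
        \<comment> \<open>The exponential is at least 1 because clock times are at least
          \<open>s\<close>, which is nonnegative.\<close>
        have "a * 1 \<le> ra j (?\<tau> v) v * exp (?\<tau> v / 2)"
          using a tb[of v] bounds by (intro mult_mono) (auto intro: order_trans[OF less_imp_le[OF a(1)]])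
        then show ?thesis by simp
      qed
    qed
    then show ?case using l by (simp add: set_lebesgue_integral_def mult.commute)
  qed
  then have "integrable M (\<lambda>\<omega>. a * (rL T \<omega> - l0))"
    using A a(1) P.L_bounds[of _ T] bounds
    by (intro Bochner_Integration.integrable_bound[OF A]) (auto elim!: eventually_elim2[OF _ AE_space] intro!: order_trans[OF _ abs_ge_self])
  from integrable_mult_right[OF this, of "1 / a"]
  have "integrable M (\<lambda>\<omega>. rL T \<omega> - l0)" using a(1) by simp
  from Bochner_Integration.integrable_add[OF this integrable_const[of l0]] show ?thesis by simp
qed

lemma clock:
  assumes "s < t" "t \<le> T"
  shows "local_time_clock M s t l0 rL"
proof -
  interpret P: local_time_paths M s t l0 rL by (rule paths[OF assms(1)])
  interpret P': local_time_paths M s T l0 rL by (rule paths[OF bounds(4)])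
  have "integrable M (\<lambda>\<omega>. \<bar>rL T \<omega>\<bar> + \<bar>l0\<bar>)" using rL_integrable by simp
  then have "integrable M (rL t)"
  proof (rule Bochner_Integration.integrable_bound)
    have "\<bar>rL t \<omega>\<bar> \<le> \<bar>rL T \<omega>\<bar> + \<bar>l0\<bar>" if "\<omega> \<in> space M" for \<omega>
      using P'.L_bounds[OF that, of t] assms by auto
    then show "AE \<omega> in M. norm (rL t \<omega>) \<le> norm (\<bar>rL T \<omega>\<bar> + \<bar>l0\<bar>)" by (intro AE_I2) auto
  qed simp
  then show ?thesis by unfold_locales
qed

definition \<rho> :: "'i \<Rightarrow> real \<Rightarrow> 'w \<Rightarrow> real" where "\<rho> j u \<omega> = branch_radius j (rX u \<omega>)"

lemma rho_measurable [measurable]: "\<rho> j u \<in> borel_measurable M"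
  unfolding \<rho>_def[abs_def] by measurable

lemma rho_continuous: "\<omega> \<in> space M \<Longrightarrow> continuous_on A (\<lambda>u. \<rho> j u \<omega>)"
  unfolding \<rho>_def by (rule continuous_on_compose2[OF continuous_branch_radius rX_continuous]) auto

lemma sum_rho: "(\<Sum>j\<in>UNIV. \<rho> j u \<omega>) = radius (rX u \<omega>)"
  unfolding \<rho>_def by (rule sum_branch_radius)

text \<open>A level passed by time \<open>t\<close> is first reached at the same instant whatever
  the horizon. This transfers facts from the horizon \<open>T\<close>, at which the spider is
  defined, to earlier ones.\<close>

lemma inverse_clock_T:
  assumes t: "s < t" "t \<le> T" and z: "z \<in> local_time_paths.clock_region M t l0 rL"
  shows "z \<in> local_time_paths.clock_region M T l0 rL"
    "local_time_paths.inverse_clock M s t l0 rL z = local_time_paths.inverse_clock M s T l0 rL z"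
proof -
  interpret P: local_time_paths M s t l0 rL by (rule paths[OF t(1)])
  interpret Q: local_time_paths M s T l0 rL by (rule paths[OF bounds(4)])
  show zQ: "z \<in> Q.clock_region"
    using z rL_mono[of "fst z" t T] t by (auto simp: P.clock_region_def Q.clock_region_def space_pair_measure)
  have 1: "Q.inverse_clock z \<le> P.inverse_clock z"
    using Q.inverse_clock_mem(3)[OF zQ, of "P.inverse_clock z"] P.inverse_clock_mem(1,2)[OF z] t by auto
  then have "Q.inverse_clock z \<in> {s..t}" using P.inverse_clock_mem(1)[OF z] Q.inverse_clock_mem(1)[OF zQ] by auto
  then have "P.inverse_clock z \<le> Q.inverse_clock z"
    using P.inverse_clock_mem(3)[OF z] Q.inverse_clock_mem(2)[OF zQ] by auto
  with 1 show "P.inverse_clock z = Q.inverse_clock z" by simp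
qed

end

section \<open>Orthogonality relations from the martingale problem\<close>

context spider_process
begin

lemma rho_nonneg: "0 \<le> \<rho> j u \<omega>" by (simp add: \<rho>_def branch_radius_nonneg)

lemma rho_zero_iff: "(\<forall>j. \<rho> j u \<omega> = 0) \<longleftrightarrow> (\<Sum>j\<in>UNIV. \<rho> j u \<omega>) = 0"
  using rho_nonneg by (subst sum_nonneg_eq_0_iff) auto

text \<open>By definition of the spider, the \<open>dL\<close>-measure of the times spent away from
  the junction is 0. Transported to levels this becomes a statement about clock times. The radius at
  a clock time is jointly measurable by \<open>continuous_process_at_measurable\<close>, so the
  statement for almost every path integrates to one for \<open>clock_measure\<close>.\<close>

lemma rho_clock_T: "AE z in local_time_paths.clock_measure M T l0 rL. \<forall>j. \<rho> j (local_time_paths.inverse_clock M s T l0 rL z) (fst z) = 0"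
proof -
  interpret Q: local_time_clock M s T l0 rL by (rule clock[OF bounds(4)]) simp
  define W where "W u \<omega> = (\<Sum>j\<in>UNIV. \<rho> j u \<omega>)" for u \<omega>
  have Wm: "W u \<in> borel_measurable M" for u unfolding W_def[abs_def] by measurable
  have Wc: "continuous_on UNIV (\<lambda>u. W u \<omega>)" if "\<omega> \<in> space M" for \<omega>
    unfolding W_def by (intro continuous_on_sum rho_continuous that)
  define h where "h z = W (Q.inverse_clock z) (fst z)" for z
  have hm [measurable]: "h \<in> borel_measurable (M \<Otimes>\<^sub>M lborel)"
    unfolding h_def[abs_def] by (rule continuous_process_at_measurable[OF Wm Wc]) auto
  have im: "(\<lambda>z. indicator {0<..} (h z) :: ennreal) \<in> borel_measurable (M \<Otimes>\<^sub>M lborel)"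
    by measurable
  have "(\<integral>\<^sup>+z. indicator {0<..} (h z) \<partial>Q.clock_measure) = (\<integral>\<^sup>+\<omega>. (\<integral>\<^sup>+v\<in>{l0<..rL T \<omega>}. indicator {0<..} (h (\<omega>, v)) \<partial>lborel) \<partial>M)"
    by (rule Q.nn_integral_clock_measure[OF im])
  also have "\<dots> = (\<integral>\<^sup>+\<omega>. 0 \<partial>M)"
  proof (rule nn_integral_cong_AE)
    show "AE \<omega> in M. (\<integral>\<^sup>+v\<in>{l0<..rL T \<omega>}. indicator {0<..} (h (\<omega>, v)) \<partial>lborel) = 0"
      using AE_not_bad AE_space
    proof eventually_elim
      case (elim \<omega>)
      let ?\<tau> = "\<lambda>v. Q.inverse_clock (\<omega>, v)"
      have gd: "good \<omega>" by (rule bad(2)[OF elim(2,1)])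
      have tm [measurable]: "?\<tau> \<in> borel_measurable borel"
        using measurable_compose[OF measurable_Pair1'[OF elim(2), of lborel] Q.inverse_clock_measurable] by simp
      have eqL: "L u \<omega> = rL u \<omega>" if "u \<in> {s..T}" for u using r_eq(2)[OF elim(1) that] by simp
      have LT: "L T \<omega> = rL T \<omega>" "L s \<omega> = l0" using eqL[of T] gd bounds by (auto simp: good_def)
      have E: "stieltjes s T (\<lambda>u. L u \<omega>) = distr (density lborel (indicator {L s \<omega><..L T \<omega>})) borel ?\<tau>"
      proof (rule stieltjes_eq_distr[OF _ L_continuous[OF elim(2)] _ tm])
        show "mono_on {s..T} (\<lambda>u. L u \<omega>)" using gd by (simp add: good_def)
        fix v u assume v: "L s \<omega> < v" "v \<le> L T \<omega>" "s \<le> u" "u \<le> T"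
        then have "(\<omega>, v) \<in> Q.clock_region" using elim LT by (auto simp: Q.clock_region_def space_pair_measure)
        from Q.inverse_clock_mem(3)[OF this, of u] show "?\<tau> v \<le> u \<longleftrightarrow> v \<le> L u \<omega>"
          using v eqL[of u] by simp
      qed (use bounds in simp)
      have We: "W u \<omega> = radius (X u \<omega>)" if "u \<in> {s..T}" for u
        using sum_rho[of u \<omega>] r_eq(1)[OF elim(1) that] by (simp add: W_def)
      have Wb [measurable]: "(\<lambda>u. W u \<omega>) \<in> borel_measurable borel"
        by (rule borel_measurable_continuous_onI[OF Wc[OF elim(2)]])
      have "(\<integral>\<^sup>+v\<in>{l0<..rL T \<omega>}. indicator {0<..} (h (\<omega>, v)) \<partial>lborel) =
         (\<integral>\<^sup>+v. indicator {0<..} (W (?\<tau> v) \<omega>) \<partial>density lborel (indicator {L s \<omega><..L T \<omega>}))"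
        unfolding LT h_def by (subst nn_integral_density) (auto simp: mult.commute)
      also have "\<dots> = (\<integral>\<^sup>+u. indicator {0<..} (W u \<omega>) \<partial>stieltjes s T (\<lambda>u. L u \<omega>))"
        unfolding E by (subst nn_integral_distr) auto
      also have "\<dots> = (\<integral>\<^sup>+u. indicator {u \<in> {s..T}. 0 < radius (X u \<omega>)} u \<partial>stieltjes s T (\<lambda>u. L u \<omega>))"
      proof (rule nn_integral_cong_AE)
        have "AE v in density lborel (indicator {L s \<omega><..L T \<omega>}). ?\<tau> v \<in> {s..T}"
          using Q.inverse_clock_mem(1) bounds by (intro AE_I2) (auto simp: Q.inverse_clock_def)
        then have "AE u in stieltjes s T (\<lambda>u. L u \<omega>). u \<in> {s..T}"
          unfolding E by (subst AE_distr_iff) auto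
        then show "AE u in stieltjes s T (\<lambda>u. L u \<omega>). (indicator {0<..} (W u \<omega>) :: ennreal) = indicator {u \<in> {s..T}. 0 < radius (X u \<omega>)} u"
          by eventually_elim (auto simp: We split: split_indicator)
      qed
      also have "\<dots> = 0" using gd by (simp add: good_def)
      finally show ?case .
    qed
  qed
  finally have "(\<integral>\<^sup>+z. indicator {0<..} (h z) \<partial>Q.clock_measure) = 0" by simp
  then have "AE z in Q.clock_measure. indicator {0<..} (h z) = (0::ennreal)"
    by (subst (asm) nn_integral_0_iff_AE) (auto simp: measurable_cong_sets[OF Q.sets_clock_measure refl] im)
  then show ?thesis
  proof eventually_elim
    case (elim z)
    then have "h z \<le> 0" by (auto split: split_indicator_asm)
    moreover have "0 \<le> h z" by (simp add: h_def W_def sum_nonneg rho_nonneg)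
    ultimately show ?case unfolding rho_zero_iff by (simp add: h_def W_def)
  qed
qed

lemma rho_clock:
  assumes t: "s < t" "t \<le> T"
  shows "AE z in local_time_paths.clock_measure M t l0 rL. \<forall>j. \<rho> j (local_time_paths.inverse_clock M s t l0 rL z) (fst z) = 0"
proof -
  interpret P: local_time_paths M s t l0 rL by (rule paths[OF t(1)])
  interpret Q: local_time_paths M s T l0 rL by (rule paths[OF bounds(4)])
  have "AE z in M \<Otimes>\<^sub>M lborel. z \<in> Q.clock_region \<longrightarrow> (\<forall>j. \<rho> j (Q.inverse_clock z) (fst z) = 0)"
    using rho_clock_T unfolding Q.clock_measure_def by (subst (asm) AE_density) (auto elim!: eventually_mono split: split_indicator_asm)
  then show ?thesis
    unfolding P.clock_measure_def
    by (subst AE_density) (auto elim!: eventually_mono simp: inverse_clock_T[OF t] split: split_indicator_asm)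
qed

lemma weight_measurable:
  assumes "q \<in> {s..T}"
  shows "(\<lambda>\<omega>. exp (- n * (L q \<omega> - l0))) \<in> borel_measurable (generated_filtration M s X L q)"
  using L_filtration_measurable[OF assms] by measurable

text \<open>The bound is \<open>exp (n * l0)\<close> and not 1, because nonnegativity of
  \<open>L\<close> holds on every path whereas \<open>L\<close> stays above \<open>l0\<close> only
  almost surely.\<close>

lemma weight_le:
  assumes "0 \<le> n" "\<omega> \<in> space M" "q \<in> {s..T}"
  shows "\<bar>exp (- n * (L q \<omega> - l0))\<bar> \<le> exp (n * l0)"
  using assms L_nonneg[OF assms(2,3)] by (simp add: right_diff_distrib)

lemma integrable_weighted:
  assumes n: "0 \<le> n" and q: "q \<in> {s..T}" and f: "f \<in> borel_measurable M" "\<And>\<omega>. \<bar>f \<omega>\<bar> \<le> B"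
  shows "integrable M (\<lambda>\<omega>. exp (- n * (L q \<omega> - l0)) * f \<omega>)"
proof (rule integrable_const_bound[where B="exp (n * l0) * B"])
  show "AE \<omega> in M. norm (exp (- n * (L q \<omega> - l0)) * f \<omega>) \<le> exp (n * l0) * B"
  proof (rule AE_I2)
    fix \<omega> assume "\<omega> \<in> space M"
    from mult_mono[OF weight_le[OF n this q] f(2)[of \<omega>]]
    show "norm (exp (- n * (L q \<omega> - l0)) * f \<omega>) \<le> exp (n * l0) * B" by (simp add: abs_mult)
  qed
  show "(\<lambda>\<omega>. exp (- n * (L q \<omega> - l0)) * f \<omega>) \<in> borel_measurable M"
    using f(1) L_measurable[OF q] by measurable
qed

text \<open>The weight for the martingale argument is built from the unmodified \<open>L\<close>,
  which is adapted to the generated filtration. The regularised process is inserted only under the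
  integral, where null sets do not matter.\<close>

lemma cosine_orthogonal:
  assumes n: "0 \<le> n" and q: "s \<le> q" "q \<le> r" "r \<le> T"
  shows "(\<integral>\<omega>. exp (- n * (rL q \<omega> - l0)) * (exp (\<theta>\<^sup>2 * r / 2) * cos (\<theta> * (\<Sum>j\<in>UNIV. \<rho> j r \<omega>)) -
        exp (\<theta>\<^sup>2 * q / 2) * cos (\<theta> * (\<Sum>j\<in>UNIV. \<rho> j q \<omega>))) \<partial>M) = 0"
proof -
  have qm: "q \<in> {s..T}" "r \<in> {s..T}" using q by auto
  define Y where "Y \<omega> = exp (- n * (L q \<omega> - l0))" for \<omega>
  define c where "c = exp (\<theta>\<^sup>2 * s / 2) * cos (\<theta> * radius (point x i))"
  define W where "W u \<omega> = exp (\<theta>\<^sup>2 * u / 2) * cos (\<theta> * radius (X u \<omega>))" for u \<omega>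
  have rm: "(\<lambda>\<omega>. radius (X u \<omega>)) \<in> borel_measurable M" if "u \<in> {s..T}" for u
    unfolding sum_branch_radius[symmetric] using X_measurable[OF that] by measurable
  have iW: "integrable M (\<lambda>\<omega>. Y \<omega> * W u \<omega>)" if "u \<in> {s..T}" for u
    unfolding Y_def
  proof (rule integrable_weighted[OF n qm(1), where B="exp (\<theta>\<^sup>2 * u / 2)"])
    show "W u \<in> borel_measurable M" unfolding W_def[abs_def] using rm[OF that] by measurable
    show "\<bar>W u \<omega>\<bar> \<le> exp (\<theta>\<^sup>2 * u / 2)" for \<omega> by (simp add: W_def abs_mult)
  qed
  have ic: "integrable M (\<lambda>\<omega>. Y \<omega> * c)"
    unfolding Y_def by (rule integrable_weighted[OF n qm(1), where B="\<bar>c\<bar>"]) auto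
  have "(\<integral>\<omega>. Y \<omega> * (W r \<omega> - c) \<partial>M) = (\<integral>\<omega>. Y \<omega> * (W q \<omega> - c) \<partial>M)"
    unfolding Y_def W_def c_def
    by (rule martingale_orthogonal(3)[OF prob_space_axioms cosine_martingale subalgebra_filtration[OF _] qm q(2) weight_measurable[OF qm(1)] weight_le[OF n _ qm(1)]])
      (use q in auto)
  then have "(\<integral>\<omega>. Y \<omega> * W r \<omega> \<partial>M) = (\<integral>\<omega>. Y \<omega> * W q \<omega> \<partial>M)"
    using iW[OF qm(1)] iW[OF qm(2)] ic by (simp add: right_diff_distrib)
  then have z: "(\<integral>\<omega>. Y \<omega> * (W r \<omega> - W q \<omega>) \<partial>M) = 0"
    using iW[OF qm(1)] iW[OF qm(2)] by (simp add: right_diff_distrib)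
  have "(\<integral>\<omega>. exp (- n * (rL q \<omega> - l0)) * (exp (\<theta>\<^sup>2 * r / 2) * cos (\<theta> * (\<Sum>j\<in>UNIV. \<rho> j r \<omega>)) -
        exp (\<theta>\<^sup>2 * q / 2) * cos (\<theta> * (\<Sum>j\<in>UNIV. \<rho> j q \<omega>))) \<partial>M) = (\<integral>\<omega>. Y \<omega> * (W r \<omega> - W q \<omega>) \<partial>M)"
  proof (rule integral_cong_AE)
    show "AE \<omega> in M. exp (- n * (rL q \<omega> - l0)) * (exp (\<theta>\<^sup>2 * r / 2) * cos (\<theta> * (\<Sum>j\<in>UNIV. \<rho> j r \<omega>)) -
        exp (\<theta>\<^sup>2 * q / 2) * cos (\<theta> * (\<Sum>j\<in>UNIV. \<rho> j q \<omega>))) = Y \<omega> * (W r \<omega> - W q \<omega>)"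
      using AE_not_bad
      by eventually_elim (simp add: Y_def W_def sum_rho r_eq(1)[OF _ qm(1)] r_eq(1)[OF _ qm(2)] r_eq(2)[OF _ qm(1)])
    show "(\<lambda>\<omega>. Y \<omega> * (W r \<omega> - W q \<omega>)) \<in> borel_measurable M"
      using rm[OF qm(1)] rm[OF qm(2)] L_measurable[OF qm(1)] unfolding Y_def W_def by measurable
  qed measurable
  then show ?thesis using z by simp
qed

text \<open>Here a compensator is present: its increment from \<open>q\<close> to \<open>r\<close>
  is an integral over the levels between \<open>rL q\<close> and \<open>rL r\<close>, that is, over
  the levels with clock time in \<open>(q, r]\<close>.\<close>

lemma sine_orthogonal:
  assumes t: "s < t" "t \<le> T" and n: "0 \<le> n" and q: "s \<le> q" "q \<le> r" "r \<le> t"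
  shows "(\<integral>\<omega>. exp (- n * (rL q \<omega> - l0)) * (exp (\<theta>\<^sup>2 * r / 2) * sin (\<theta> * \<rho> j r \<omega>) - exp (\<theta>\<^sup>2 * q / 2) * sin (\<theta> * \<rho> j q \<omega>)) \<partial>M) =
      (\<integral>z. of_bool (q < local_time_paths.inverse_clock M s t l0 rL z \<and> local_time_paths.inverse_clock M s t l0 rL z \<le> r) * (exp (- n * (rL q (fst z) - l0)) *
        (ra j (local_time_paths.inverse_clock M s t l0 rL z) (snd z) * (\<theta> * exp (\<theta>\<^sup>2 * local_time_paths.inverse_clock M s t l0 rL z / 2)))) \<partial>local_time_paths.clock_measure M t l0 rL)"
proof -
  interpret P: local_time_clock M s t l0 rL by (rule clock[OF t])
  have qm: "q \<in> {s..T}" "r \<in> {s..T}" and qt: "q \<in> {s..t}" "r \<in> {s..t}" using q t by auto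
  define \<beta> where "\<beta> z = ra j (P.inverse_clock z) (snd z) * (\<theta> * exp (\<theta>\<^sup>2 * P.inverse_clock z / 2))" for z
  have ram: "(\<lambda>z. ra j (P.inverse_clock z) (snd z)) \<in> borel_measurable (M \<Otimes>\<^sub>M lborel)"
  proof -
    have "snd \<in> borel_measurable (M \<Otimes>\<^sub>M lborel)" by measurable
    from measurable_compose[OF measurable_Pair[OF P.inverse_clock_measurable this] ra_measurable[of j]] show ?thesis by simp
  qed
  have \<beta>m [measurable]: "\<beta> \<in> borel_measurable (M \<Otimes>\<^sub>M lborel)"
    unfolding \<beta>_def[abs_def] using ram by measurable
  have tle: "P.inverse_clock z \<le> t" for z
    using P.inverse_clock_mem(1)[of z] by (cases "z \<in> P.clock_region") (auto simp: P.inverse_clock_def)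
  define C where "C = \<bar>\<theta>\<bar> * exp (\<theta>\<^sup>2 * t / 2)"
  have \<beta>b: "\<bar>\<beta> z\<bar> \<le> C" for z
  proof -
    have "\<bar>\<beta> z\<bar> \<le> 1 * (\<bar>\<theta>\<bar> * exp (\<theta>\<^sup>2 * t / 2))"
      unfolding \<beta>_def abs_mult using ra_nonneg ra_le_1 tle[of z]
      by (intro mult_mono) (auto intro!: mult_left_mono divide_right_mono)
    then show ?thesis by (simp add: C_def)
  qed
  define Y where "Y \<omega> = exp (- n * (L q \<omega> - l0))" for \<omega>
  define c where "c = exp (\<theta>\<^sup>2 * s / 2) * sin (\<theta> * branch_radius j (point x i))"
  define W where "W u \<omega> = exp (\<theta>\<^sup>2 * u / 2) * sin (\<theta> * branch_radius j (X u \<omega>))" for u \<omega>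
  define A where "A u \<omega> = (LINT v:{s..u}|stieltjes s u (\<lambda>v. L v \<omega>). \<alpha> j v (L v \<omega>) * (\<theta> * exp (\<theta>\<^sup>2 * v / 2)))" for u \<omega>
  have Ym: "Y \<in> borel_measurable M" using L_measurable[OF qm(1)] unfolding Y_def by measurable
  have Wm: "W u \<in> borel_measurable M" if "u \<in> {s..T}" for u
    unfolding W_def[abs_def] using X_measurable[OF that] by measurable
  have iW: "integrable M (\<lambda>\<omega>. Y \<omega> * W u \<omega>)" if "u \<in> {s..T}" for u
    unfolding Y_def
    by (rule integrable_weighted[OF n qm(1) Wm[OF that], where B="exp (\<theta>\<^sup>2 * u / 2)"]) (simp add: W_def abs_mult)
  have ic: "integrable M (\<lambda>\<omega>. Y \<omega> * c)"
    unfolding Y_def by (rule integrable_weighted[OF n qm(1), where B="\<bar>c\<bar>"]) auto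
  note mo = martingale_orthogonal[OF prob_space_axioms sine_martingale subalgebra_filtration qm q(2) weight_measurable[OF qm(1)] weight_le[OF n _ qm(1)],
      of \<theta> j, folded Y_def W_def c_def A_def]
  have iZ: "integrable M (\<lambda>\<omega>. Y \<omega> * (W q \<omega> - c - A q \<omega>))" "integrable M (\<lambda>\<omega>. Y \<omega> * (W r \<omega> - c - A r \<omega>))"
    and eZ: "(\<integral>\<omega>. Y \<omega> * (W r \<omega> - c - A r \<omega>) \<partial>M) = (\<integral>\<omega>. Y \<omega> * (W q \<omega> - c - A q \<omega>) \<partial>M)"
    using mo q t by auto
  have iWc: "integrable M (\<lambda>\<omega>. Y \<omega> * W u \<omega> - Y \<omega> * c)" if "u \<in> {s..T}" for u
    using iW[OF that] ic by simp
  \<comment> \<open>No bound on the compensator is at hand; its weighted integrability follows by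
    subtracting the weighted martingale from bounded terms.\<close>
  have iA: "integrable M (\<lambda>\<omega>. Y \<omega> * A q \<omega>)" "integrable M (\<lambda>\<omega>. Y \<omega> * A r \<omega>)"
    using Bochner_Integration.integrable_diff[OF iWc[OF qm(1)] iZ(1)] Bochner_Integration.integrable_diff[OF iWc[OF qm(2)] iZ(2)]
    by (simp_all add: algebra_simps)
  have "(\<integral>\<omega>. Y \<omega> * W r \<omega> \<partial>M) - (\<integral>\<omega>. Y \<omega> * c \<partial>M) - (\<integral>\<omega>. Y \<omega> * A r \<omega> \<partial>M) =
     (\<integral>\<omega>. Y \<omega> * W q \<omega> \<partial>M) - (\<integral>\<omega>. Y \<omega> * c \<partial>M) - (\<integral>\<omega>. Y \<omega> * A q \<omega> \<partial>M)"
    using eZ iW[OF qm(1)] iW[OF qm(2)] ic iA by (simp add: right_diff_distrib)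
  then have "(\<integral>\<omega>. Y \<omega> * (W r \<omega> - W q \<omega>) \<partial>M) = (\<integral>\<omega>. Y \<omega> * (A r \<omega> - A q \<omega>) \<partial>M)"
    using iW[OF qm(1)] iW[OF qm(2)] iA by (simp add: right_diff_distrib)
  also have "\<dots> = (\<integral>\<omega>. (LBINT v:{l0<..rL t \<omega>}. of_bool (q < P.inverse_clock (\<omega>, v) \<and> P.inverse_clock (\<omega>, v) \<le> r) * (exp (- n * (rL q \<omega> - l0)) * \<beta> (\<omega>, v))) \<partial>M)"
  proof (rule integral_cong_AE)
    show "AE \<omega> in M. Y \<omega> * (A r \<omega> - A q \<omega>) = (LBINT v:{l0<..rL t \<omega>}. of_bool (q < P.inverse_clock (\<omega>, v) \<and> P.inverse_clock (\<omega>, v) \<le> r) * (exp (- n * (rL q \<omega> - l0)) * \<beta> (\<omega>, v)))"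
      using AE_not_bad AE_space
    proof eventually_elim
      case (elim \<omega>)
      have Ae: "A u \<omega> = (LBINT v:{l0<..rL u \<omega>}. \<beta> (\<omega>, v))" if "u \<in> {s..t}" for u
        unfolding A_def \<beta>_def using stieltjes_clock[OF t elim(2,1) that, of "\<lambda>v. \<theta> * exp (\<theta>\<^sup>2 * v / 2)" j]
        by (simp add: continuous_intros)
      have bm [measurable]: "(\<lambda>v. \<beta> (\<omega>, v)) \<in> borel_measurable borel"
        using measurable_compose[OF measurable_Pair1'[OF elim(2), of lborel] \<beta>m] by simp
      have bi: "integrable lborel (\<lambda>v. indicator {l0<..rL u \<omega>} v *\<^sub>R \<beta> (\<omega>, v))" if "u \<in> {s..t}" for u
      proof (rule Bochner_Integration.integrable_bound)
        show "integrable lborel (\<lambda>v. indicator {l0<..rL u \<omega>} v *\<^sub>R C)"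
          using P.L_bounds[OF elim(2) that] by (simp add: integrable_real_mult_indicator)
        show "AE v in lborel. norm (indicator {l0<..rL u \<omega>} v *\<^sub>R \<beta> (\<omega>, v)) \<le> norm (indicator {l0<..rL u \<omega>} v *\<^sub>R C)"
          using order_trans[OF \<beta>b abs_ge_self] by (intro AE_I2) (auto split: split_indicator)
      qed measurable
      have "A r \<omega> - A q \<omega> = (LBINT v. indicator {l0<..rL r \<omega>} v *\<^sub>R \<beta> (\<omega>, v) - indicator {l0<..rL q \<omega>} v *\<^sub>R \<beta> (\<omega>, v))"
        unfolding Ae[OF qt(1)] Ae[OF qt(2)] set_lebesgue_integral_def
        by (rule Bochner_Integration.integral_diff[OF bi[OF qt(2)] bi[OF qt(1)], symmetric])
      then have "Y \<omega> * (A r \<omega> - A q \<omega>) = (LBINT v. Y \<omega> * (indicator {l0<..rL r \<omega>} v *\<^sub>R \<beta> (\<omega>, v) - indicator {l0<..rL q \<omega>} v *\<^sub>R \<beta> (\<omega>, v)))"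
        by simp
      also have "\<dots> = (LBINT v:{l0<..rL t \<omega>}. of_bool (q < P.inverse_clock (\<omega>, v) \<and> P.inverse_clock (\<omega>, v) \<le> r) * (exp (- n * (rL q \<omega> - l0)) * \<beta> (\<omega>, v)))"
        unfolding set_lebesgue_integral_def
      proof (rule Bochner_Integration.integral_cong[OF refl])
        fix v :: real
        have Yr: "Y \<omega> = exp (- n * (rL q \<omega> - l0))" using r_eq(2)[OF elim(1) qm(1)] by (simp add: Y_def)
        have o: "l0 \<le> rL q \<omega>" "rL q \<omega> \<le> rL r \<omega>" "rL r \<omega> \<le> rL t \<omega>"
          using P.L_bounds[OF elim(2) qt(1)] rL_mono[OF elim(2), of q r] rL_mono[OF elim(2), of r t] q by auto
        show "Y \<omega> * (indicator {l0<..rL r \<omega>} v *\<^sub>R \<beta> (\<omega>, v) - indicator {l0<..rL q \<omega>} v *\<^sub>R \<beta> (\<omega>, v)) =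
          indicator {l0<..rL t \<omega>} v *\<^sub>R (of_bool (q < P.inverse_clock (\<omega>, v) \<and> P.inverse_clock (\<omega>, v) \<le> r) * (exp (- n * (rL q \<omega> - l0)) * \<beta> (\<omega>, v)))"
        proof (cases "(\<omega>, v) \<in> P.clock_region")
          case True
          then have v: "l0 < v" "v \<le> rL t \<omega>" by (auto simp: P.clock_region_def)
          show ?thesis
            unfolding P.inverse_clock_between[OF True qt] Yr using v o by (auto split: split_indicator)
        next
          case False
          then have "\<not> (l0 < v \<and> v \<le> rL t \<omega>)" using elim(2) by (auto simp: P.clock_region_def space_pair_measure)
          then show ?thesis using o by (auto split: split_indicator)
        qed
      qed
      finally show ?case .
    qed
    show "(\<lambda>\<omega>. Y \<omega> * (A r \<omega> - A q \<omega>)) \<in> borel_measurable M"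
      using borel_measurable_integrable[OF Bochner_Integration.integrable_diff[OF iA(2,1)]] by (simp add: right_diff_distrib)
    show "(\<lambda>\<omega>. LBINT v:{l0<..rL t \<omega>}. of_bool (q < P.inverse_clock (\<omega>, v) \<and> P.inverse_clock (\<omega>, v) \<le> r) * (exp (- n * (rL q \<omega> - l0)) * \<beta> (\<omega>, v))) \<in> borel_measurable M"
    proof -
      have m: "(\<lambda>z. indicator P.clock_region z *\<^sub>R (of_bool (q < P.inverse_clock z \<and> P.inverse_clock z \<le> r) * (exp (- n * (rL q (fst z) - l0)) * \<beta> z))) \<in> borel_measurable (M \<Otimes>\<^sub>M lborel)"
        by measurable
      have "(\<lambda>\<omega>. LBINT v. indicator P.clock_region (\<omega>, v) *\<^sub>R (of_bool (q < P.inverse_clock (\<omega>, v) \<and> P.inverse_clock (\<omega>, v) \<le> r) * (exp (- n * (rL q \<omega> - l0)) * \<beta> (\<omega>, v)))) \<in> borel_measurable M"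
        using lborel.borel_measurable_lebesgue_integral[of "\<lambda>\<omega> v. indicator P.clock_region (\<omega>, v) *\<^sub>R (of_bool (q < P.inverse_clock (\<omega>, v) \<and> P.inverse_clock (\<omega>, v) \<le> r) * (exp (- n * (rL q \<omega> - l0)) * \<beta> (\<omega>, v)))" M] m
        by (simp add: case_prod_beta)
      then show ?thesis unfolding set_lebesgue_integral_def
        by (rule measurable_cong[THEN iffD1, rotated])
          (auto intro!: Bochner_Integration.integral_cong simp: P.clock_region_def space_pair_measure split: split_indicator)
    qed
  qed
  also have "\<dots> = (\<integral>z. of_bool (q < P.inverse_clock z \<and> P.inverse_clock z \<le> r) * (exp (- n * (rL q (fst z) - l0)) * \<beta> z) \<partial>P.clock_measure)"
  proof (subst P.integral_clock_measure(2)[where C=C])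
    fix z assume z: "z \<in> P.clock_region"
    then have "fst z \<in> space M" by (auto simp: P.clock_region_def space_pair_measure)
    then have "exp (- n * (rL q (fst z) - l0)) \<le> 1" using P.L_bounds[OF _ qt(1)] n by simp
    then have "\<bar>exp (- n * (rL q (fst z) - l0)) * \<beta> z\<bar> \<le> 1 * C"
      unfolding abs_mult using \<beta>b by (intro mult_mono) auto
    moreover have "0 \<le> C" by (simp add: C_def)
    ultimately show "\<bar>of_bool (q < P.inverse_clock z \<and> P.inverse_clock z \<le> r) * (exp (- n * (rL q (fst z) - l0)) * \<beta> z)\<bar> \<le> C"
      by (simp add: of_bool_def)
  qed (auto, measurable)
  also have "(\<integral>\<omega>. Y \<omega> * (W r \<omega> - W q \<omega>) \<partial>M) =
     (\<integral>\<omega>. exp (- n * (rL q \<omega> - l0)) * (exp (\<theta>\<^sup>2 * r / 2) * sin (\<theta> * \<rho> j r \<omega>) - exp (\<theta>\<^sup>2 * q / 2) * sin (\<theta> * \<rho> j q \<omega>)) \<partial>M)"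
  proof (rule integral_cong_AE)
    show "AE \<omega> in M. Y \<omega> * (W r \<omega> - W q \<omega>) = exp (- n * (rL q \<omega> - l0)) * (exp (\<theta>\<^sup>2 * r / 2) * sin (\<theta> * \<rho> j r \<omega>) - exp (\<theta>\<^sup>2 * q / 2) * sin (\<theta> * \<rho> j q \<omega>))"
      using AE_not_bad
      by eventually_elim (simp add: Y_def W_def \<rho>_def r_eq(1)[OF _ qm(1)] r_eq(1)[OF _ qm(2)] r_eq(2)[OF _ qm(1)])
    show "(\<lambda>\<omega>. Y \<omega> * (W r \<omega> - W q \<omega>)) \<in> borel_measurable M"
      using Ym Wm[OF qm(1)] Wm[OF qm(2)] by measurable
  qed measurable
  finally show ?thesis unfolding \<beta>_def .
qed

lemma spider_clock:
  assumes t: "s < t" "t \<le> T"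
  shows "spider_clock M s t l0 rL \<rho> ra x i"
proof -
  interpret P: local_time_clock M s t l0 rL by (rule clock[OF t])
  have cos: "(\<integral>\<omega>. exp (- n * (rL q \<omega> - l0)) * (exp (\<theta>\<^sup>2 * r / 2) * cos (\<theta> * (\<Sum>j\<in>UNIV. \<rho> j r \<omega>)) -
        exp (\<theta>\<^sup>2 * q / 2) * cos (\<theta> * (\<Sum>j\<in>UNIV. \<rho> j q \<omega>))) \<partial>M) = 0"
    if "0 \<le> n" "s \<le> q" "q \<le> r" "r \<le> t" for n q r \<theta>
    using that t by (intro cosine_orthogonal) auto
  show ?thesis
  proof (unfold_locales)
    show "\<exists>k. \<forall>j. j \<noteq> k \<longrightarrow> \<rho> j u \<omega> = 0" for u \<omega>
      by (rule exI[of _ "branch (rX u \<omega>)"]) (auto simp: \<rho>_def branch_radius_eq_0)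
    show "\<rho> j s \<omega> = (if j = i then x else 0)" if "\<omega> \<in> space M" for j \<omega>
      using r_start(2)[OF that] bounds by (simp add: \<rho>_def branch_radius_point)
  qed ((rule sine_orthogonal[OF t]; assumption) | (rule cos; assumption) |
      simp add: rho_continuous rho_nonneg bounds rho_clock[OF t] ra_measurable ra_nonneg ra_sum)+
qed

text \<open>\<open>law_local_time\<close> speaks about the final time of a clock, so a separate
  clock with horizon \<open>u\<close> is used for each \<open>u\<close>. This supplies the
  hypothesis \<open>law\<close> of the earlier contexts.\<close>

lemma law_rL:
  assumes "s < u" "u \<le> T" "0 < m"
  shows "emeasure M {\<omega> \<in> space M. m \<le> rL u \<omega> - l0} = (\<integral>\<^sup>+v\<in>{0<..<u - s}. ennreal (hitting_density (x + m) v) \<partial>lborel)"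
  using spider_clock.law_local_time[OF spider_clock[OF assms(1,2)] assms(3)] .

lemma law_on_branch:
  assumes t: "s < t" "t \<le> T"
    and B: "B \<in> sets (borel \<Otimes>\<^sub>M borel)" "\<And>z. z \<in> B \<Longrightarrow> 0 < fst z"
  shows "emeasure M {\<omega> \<in> space M. (\<rho> j t \<omega>, rL t \<omega> - l0) \<in> B} =
    (\<integral>\<^sup>+y\<in>{0<..}. (\<integral>\<^sup>+m\<in>{0<..}. kernel_density (ra j) s t l0 x y m * indicator B (y, m) \<partial>lborel) \<partial>lborel) +
    (\<integral>\<^sup>+y\<in>{0<..}. of_bool (i = j) * ennreal (absorbed_density (t - s) x y) * indicator B (y, 0) \<partial>lborel)"
proof (rule spider_clock.endpoint_law_on_branch[OF spider_clock[OF t] _ B])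
  show "emeasure M {\<omega> \<in> space M. m \<le> rL u \<omega> - l0} = (\<integral>\<^sup>+v\<in>{0<..<u - s}. ennreal (hitting_density (x + m) v) \<partial>lborel)"
    if "s < u" "u \<le> t" "0 < m" for u m
    using that t by (intro law_rL) auto
qed

end

section \<open>The transition kernel\<close>

lemma continuous_point: "continuous_on A (\<lambda>y. point y j)"
proof (rule continuous_on_subset)
  have "dist (point y j) (point y' j) \<le> 1 * dist y y'" for y y'
    unfolding dist_network_def dist_real_def by transfer auto
  then have "1-lipschitz_on UNIV (\<lambda>y. point y j)" by (intro lipschitz_onI) auto
  then show "continuous_on UNIV (\<lambda>y. point y j)" by (rule lipschitz_on_continuous_on)
qed simp

lemma point_measurable [measurable]: "(\<lambda>y. point y j) \<in> measurable borel borel"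
  by (rule borel_measurable_continuous_onI[OF continuous_point])

lemma point_radius_branch: "point (radius q) (branch q) = q"
  unfolding branch_def by transfer auto

lemma g_eq_hitting_density:
  assumes "0 < v" "v < r" "0 < y" "0 < l"
  shows "g r y l v = 2 * hitting_density l v * hitting_density y (r - v)"
  using assms by (simp add: g_def hitting_density_def)

section \<open>From the kernel density to the stated densities\<close>

context
  fixes a :: "real \<Rightarrow> real \<Rightarrow> real"
  assumes a_meas: "(\<lambda>z. a (fst z) (snd z)) \<in> borel_measurable (borel \<Otimes>\<^sub>M borel)"
    and a: "\<And>u l. 0 \<le> a u l" "\<And>u l. a u l \<le> 1"
begin

lemma compose_weight_measurable:
  assumes "f \<in> borel_measurable N" "h \<in> borel_measurable N"
  shows "(\<lambda>z. a (f z) (h z)) \<in> borel_measurable N"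
  using measurable_compose[OF measurable_Pair[OF assms] a_meas] by simp

text \<open>Finiteness from \<open>kernel_density_le\<close> turns the nonnegative integral into a
  Lebesgue integral. The closed time interval of \<open>junction_density\<close> causes no
  difference, as \<open>g\<close> vanishes at its ends, and so \<open>a\<close> has to match
  \<open>\<alpha> j\<close> only inside.\<close>

lemma kernel_density_eq_junction_density:
  assumes eq: "\<And>u. 0 < u \<Longrightarrow> u < t - s \<Longrightarrow> a (s + u) (l0 + m) = \<alpha> j (s + u) (l0 + m)"
    and st: "s < t" and ym: "0 < y" "0 < m"
  shows "kernel_density a s t l0 0 y m = ennreal (junction_density \<alpha> s t l0 j y m)" "0 \<le> junction_density \<alpha> s t l0 j y m"
proof -
  note compose_weight_measurable [measurable (raw)]
  define f where "f u = indicator {0<..<t - s} u * (a (s + u) (l0 + m) * (2 * hitting_density y (t - s - u)) * hitting_density m u)" for u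
  have fm [measurable]: "f \<in> borel_measurable borel" unfolding f_def[abs_def] by measurable
  have f0: "0 \<le> f u" for u
    using a ym by (auto simp: f_def intro!: mult_nonneg_nonneg hitting_density_nonneg split: split_indicator)
  have k: "kernel_density a s t l0 0 y m = (\<integral>\<^sup>+u. ennreal (f u) \<partial>lborel)"
    unfolding kernel_density_def by (intro nn_integral_cong) (auto simp: f_def split: split_indicator)
  have "(\<integral>\<^sup>+u. ennreal (f u) \<partial>lborel) < \<infinity>"
  proof -
    have "kernel_density a s t l0 0 y m \<le> ennreal (2 * hitting_density (0 + m + y) (t - s))"
      by (rule kernel_density_le[OF a ym(1) _ st]) (use ym in simp)
    from le_less_trans[OF this ennreal_less_top] show ?thesis unfolding k by simp
  qed
  then have fi: "integrable lborel f"
    by (intro integrableI_nonneg) (auto simp: f0)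
  have J: "junction_density \<alpha> s t l0 j y m = (LBINT u. f u)"
    unfolding junction_density_def set_lebesgue_integral_def
  proof (rule Bochner_Integration.integral_cong[OF refl])
    fix u
    show "indicator {0..t - s} u *\<^sub>R (\<alpha> j (s + u) (l0 + m) * g (t - s) y m u) = f u"
    proof (cases "0 < u \<and> u < t - s")
      case True
      then show ?thesis using ym eq[of u] by (simp add: f_def g_eq_hitting_density)
    next
      case False
      then show ?thesis by (auto simp: f_def g_def split: split_indicator)
    qed
  qed
  show "kernel_density a s t l0 0 y m = ennreal (junction_density \<alpha> s t l0 j y m)"
    unfolding k J by (rule nn_integral_eq_integral[OF fi]) (simp add: f0)
  show "0 \<le> junction_density \<alpha> s t l0 j y m"
    unfolding J by (rule Bochner_Integration.integral_nonneg) (rule f0)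
qed

lemma kernel_density_measurable_start:
  "(\<lambda>u. kernel_density a (s + u) t l0 0 y m) \<in> borel_measurable borel"
proof -
  note compose_weight_measurable [measurable (raw)]
  have "kernel_density a (s + u) t l0 0 y m =
    (\<integral>\<^sup>+v. (if 0 < v \<and> v < t - (s + u) then ennreal (a (s + u + v) (l0 + m) * (2 * hitting_density y (t - (s + u) - v)) * hitting_density (0 + m) v) else 0) \<partial>lborel)" for u
    unfolding kernel_density_def by (intro nn_integral_cong) (auto split: split_indicator)
  then show ?thesis by simp
qed

text \<open>The path from \<open>x\<close> is split at its first visit of the junction, at time \<open>s + u\<close>.\<close>
lemma kernel_density_first_passage:
  assumes x: "0 < x" and st: "s < t" and ym: "0 < y" "0 < m"
  shows "kernel_density a s t l0 x y m =
    (\<integral>\<^sup>+u\<in>{0<..<t - s}. ennreal (hitting_density x u) * kernel_density a (s + u) t l0 0 y m \<partial>lborel)"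
proof -
  note compose_weight_measurable [measurable (raw)]
  define b where "b w = ennreal (a (s + w) (l0 + m) * (2 * hitting_density y (t - s - w)))" for w
  \<comment> \<open>\<open>u\<close> is the time of the first visit of the junction and
    \<open>w\<close> the time at which the level \<open>l0 + m\<close> is reached, both counted from
    \<open>s\<close>. Integrating over \<open>w\<close> first gives the first-passage formula;
    integrating over \<open>u\<close> first gives a convolution in which \<open>x\<close> and
    \<open>m\<close> merge into \<open>x + m\<close>.\<close>
  define F where "F u w = indicator {0<..} u * indicator {u<..<t - s} w * (ennreal (hitting_density x u * hitting_density m (w - u)) * b w)" for u w
  have bm [measurable]: "b \<in> borel_measurable borel" unfolding b_def[abs_def] by measurable
  have Fm: "(\<lambda>z. F (fst z) (snd z)) \<in> borel_measurable (lborel \<Otimes>\<^sub>M lborel)"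
  proof -
    have "F u w = (if 0 < u \<and> u < w \<and> w < t - s then ennreal (hitting_density x u * hitting_density m (w - u)) * b w else 0)" for u w
      by (auto simp: F_def split: split_indicator)
    then show ?thesis by simp
  qed
  have "(\<integral>\<^sup>+u\<in>{0<..<t - s}. ennreal (hitting_density x u) * kernel_density a (s + u) t l0 0 y m \<partial>lborel) = (\<integral>\<^sup>+u. (\<integral>\<^sup>+w. F u w \<partial>lborel) \<partial>lborel)"
  proof (rule nn_integral_cong)
    fix u :: real
    show "ennreal (hitting_density x u) * kernel_density a (s + u) t l0 0 y m * indicator {0<..<t - s} u = (\<integral>\<^sup>+w. F u w \<partial>lborel)"
    proof (cases "u \<in> {0<..<t - s}")
      case True
      have "(\<integral>\<^sup>+w. F u w \<partial>lborel) = ennreal \<bar>1\<bar> * (\<integral>\<^sup>+v. F u (u + 1 * v) \<partial>lborel)"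
        by (rule nn_integral_real_affine) (use measurable_compose[OF measurable_Pair1'[of u lborel lborel] Fm] in auto)
      also have "\<dots> = (\<integral>\<^sup>+v. ennreal (hitting_density x u) * (ennreal (a (s + u + v) (l0 + m) * (2 * hitting_density y (t - (s + u) - v)) * hitting_density (0 + m) v) * indicator {0<..<t - (s + u)} v) \<partial>lborel)"
      proof -
        have "F u (u + v) = ennreal (hitting_density x u) * (ennreal (a (s + u + v) (l0 + m) * (2 * hitting_density y (t - (s + u) - v)) * hitting_density (0 + m) v) * indicator {0<..<t - (s + u)} v)" for v
        proof (cases "v \<in> {0<..<t - (s + u)}")
          case v: True
          have nn: "0 \<le> hitting_density x u" "0 \<le> hitting_density m v" "0 \<le> hitting_density y (t - (s + u) - v)"
            using True v x ym by (auto intro!: hitting_density_nonneg)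
          have eqs: "t - s - (u + v) = t - (s + u) - v" "s + (u + v) = s + u + v" by auto
          show ?thesis using True v nn a(1)[of "s + u + v" "l0 + m"]
            by (simp add: F_def b_def eqs ennreal_mult[symmetric] mult_ac)
        next
          case False
          then show ?thesis using True by (auto simp: F_def split: split_indicator)
        qed
        then show ?thesis by simp
      qed
      also have "\<dots> = ennreal (hitting_density x u) * kernel_density a (s + u) t l0 0 y m"
        unfolding kernel_density_def by (rule nn_integral_cmult) measurable
      finally show ?thesis using True by simp
    next
      case False
      then have "F u w = 0" for w by (auto simp: F_def split: split_indicator)
      then show ?thesis using False by simp
    qed
  qed
  also have "\<dots> = (\<integral>\<^sup>+w. (\<integral>\<^sup>+u. F u w \<partial>lborel) \<partial>lborel)"
    using lborel_pair.Fubini'[of "\<lambda>w u. F u w"] measurable_compose[OF measurable_pair_swap' Fm] by (simp add: case_prod_beta)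
  also have "\<dots> = kernel_density a s t l0 x y m"
    unfolding kernel_density_def
  proof (rule nn_integral_cong)
    fix w :: real
    show "(\<integral>\<^sup>+u. F u w \<partial>lborel) = ennreal (a (s + w) (l0 + m) * (2 * hitting_density y (t - s - w)) * hitting_density (x + m) w) * indicator {0<..<t - s} w"
    proof (cases "w \<in> {0<..<t - s}")
      case True
      have "(\<integral>\<^sup>+u. F u w \<partial>lborel) = (\<integral>\<^sup>+u. ennreal (hitting_density x u * hitting_density m (w - u)) * indicator {0<..<w} u * b w \<partial>lborel)"
        using True by (intro nn_integral_cong) (auto simp: F_def split: split_indicator)
      also have "\<dots> = (\<integral>\<^sup>+u. ennreal (hitting_density x u * hitting_density m (w - u)) * indicator {0<..<w} u \<partial>lborel) * b w"
        by (rule nn_integral_multc) measurable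
      also have "\<dots> = ennreal (hitting_density (x + m) w) * b w"
        using hitting_density_convolution[OF x ym(2), of w] True by simp
      also have "\<dots> = ennreal (a (s + w) (l0 + m) * (2 * hitting_density y (t - s - w)) * hitting_density (x + m) w)"
      proof -
        have "0 \<le> hitting_density (x + m) w" "0 \<le> hitting_density y (t - s - w)"
          using True x ym by (auto intro!: hitting_density_nonneg)
        then show ?thesis using a(1)[of "s + w" "l0 + m"] by (simp add: b_def ennreal_mult[symmetric] mult_ac)
      qed
      finally show ?thesis using True by simp
    next
      case False
      then have "F u w = 0" for u by (auto simp: F_def split: split_indicator)
      then show ?thesis using False by simp
    qed
  qed
  finally show ?thesis ..
qed

text \<open>When the first passage is split off, the inner integral is the junction density for the
  later starting time \<open>s + u\<close>. Passing to reals by \<open>enn2real\<close> loses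
  nothing, since that density is finite for \<open>u\<close> inside the interval.\<close>

lemma kernel_density_eq_branch_density:
  assumes eq: "\<And>u. 0 < u \<Longrightarrow> u < t - s \<Longrightarrow> a (s + u) (l0 + m) = \<alpha> j (s + u) (l0 + m)"
    and x: "0 < x" and st: "s < t" and ym: "0 < y" "0 < m"
  shows "kernel_density a s t l0 x y m = ennreal (branch_density \<alpha> s t x l0 j y m)"
proof -
  note compose_weight_measurable [measurable (raw)]
  note kernel_density_measurable_start [measurable]
  define J where "J u = enn2real (kernel_density a (s + u) t l0 0 y m)" for u
  define f where "f u = indicator {0<..<t - s} u * (hitting_density x u * J u)" for u
  have Jm [measurable]: "J \<in> borel_measurable borel" unfolding J_def[abs_def] by measurable
  have fm [measurable]: "f \<in> borel_measurable borel" unfolding f_def[abs_def] by measurable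
  have f0: "0 \<le> f u" for u
    using x by (auto simp: f_def J_def intro!: mult_nonneg_nonneg hitting_density_nonneg split: split_indicator)
  have jd: "kernel_density a (s + u) t l0 0 y m = ennreal (junction_density \<alpha> (s + u) t l0 j y m)" "0 \<le> junction_density \<alpha> (s + u) t l0 j y m"
    if u: "0 < u" "u < t - s" for u
  proof -
    have e: "a (s + u + v) (l0 + m) = \<alpha> j (s + u + v) (l0 + m)" if "0 < v" "v < t - (s + u)" for v
      using eq[of "u + v"] that u by (simp add: add.assoc)
    show "kernel_density a (s + u) t l0 0 y m = ennreal (junction_density \<alpha> (s + u) t l0 j y m)"
      by (rule kernel_density_eq_junction_density(1)) (use e u ym in auto)
    show "0 \<le> junction_density \<alpha> (s + u) t l0 j y m"
      by (rule kernel_density_eq_junction_density(2)) (use e u ym in auto)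
  qed
  have k: "kernel_density a s t l0 x y m = (\<integral>\<^sup>+u. ennreal (f u) \<partial>lborel)"
    unfolding kernel_density_first_passage[OF x st ym]
  proof (rule nn_integral_cong)
    fix u :: real
    show "ennreal (hitting_density x u) * kernel_density a (s + u) t l0 0 y m * indicator {0<..<t - s} u = ennreal (f u)"
    proof (cases "u \<in> {0<..<t - s}")
      case True
      then have "0 \<le> hitting_density x u" using x by (auto intro!: hitting_density_nonneg)
      then show ?thesis using True jd[of u] by (simp add: f_def J_def ennreal_mult)
    qed (simp add: f_def)
  qed
  have "(\<integral>\<^sup>+u. ennreal (f u) \<partial>lborel) < \<infinity>"
  proof -
    have "kernel_density a s t l0 x y m \<le> ennreal (2 * hitting_density (x + m + y) (t - s))"
      by (rule kernel_density_le[OF a ym(1) _ st]) (use ym x in simp)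
    from le_less_trans[OF this ennreal_less_top] show ?thesis unfolding k by simp
  qed
  then have fi: "integrable lborel f"
    by (intro integrableI_nonneg) (auto simp: f0)
  have "branch_density \<alpha> s t x l0 j y m = (LBINT u. f u)"
    unfolding branch_density_def set_lebesgue_integral_def[of lborel "{0..t - s}"]
  proof (rule Bochner_Integration.integral_cong[OF refl])
    fix u
    have h: "x * exp (- (x\<^sup>2 / (2 * u))) / sqrt (2 * pi * u ^ 3) = hitting_density x u" by (simp add: hitting_density_def)
    have i: "(LBINT v:{0..t - (s + u)}. \<alpha> j (s + u + v) (l0 + m) * g (t - s - u) y m v) = junction_density \<alpha> (s + u) t l0 j y m"
      by (simp add: junction_density_def diff_diff_eq)
    show "indicator {0..t - s} u *\<^sub>R (x * exp (- (x\<^sup>2 / (2 * u))) / sqrt (2 * pi * u ^ 3) *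
        (LBINT v:{0..t - (s + u)}. \<alpha> j (s + u + v) (l0 + m) * g (t - s - u) y m v)) = f u"
      unfolding h i
    proof (cases "0 < u \<and> u < t - s")
      case True
      then show "indicator {0..t - s} u *\<^sub>R (hitting_density x u * junction_density \<alpha> (s + u) t l0 j y m) = f u"
        using jd[of u] by (simp add: f_def J_def)
    next
      case False
      \<comment> \<open>At \<open>u = 0\<close> the hitting density is 0 by division by zero; at
        \<open>u = t - s\<close> no time is left and \<open>g\<close> vanishes.\<close>
      then consider "u < 0 \<or> t - s < u" | "u = 0" | "u = t - s" by linarith
      then show "indicator {0..t - s} u *\<^sub>R (hitting_density x u * junction_density \<alpha> (s + u) t l0 j y m) = f u"
      proof cases
        case 3
        have "junction_density \<alpha> (s + u) t l0 j y m = 0"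
        proof -
          have "g (t - (s + u)) y m v = 0" for v using 3 by (auto simp: g_def)
          then show ?thesis unfolding junction_density_def by (simp add: set_lebesgue_integral_def)
        qed
        then show ?thesis using 3 by (simp add: f_def)
      qed (auto simp: f_def hitting_density_def split: split_indicator)
    qed
  qed
  then show ?thesis
    unfolding k by (simp add: nn_integral_eq_integral[OF fi] f0)
qed

end

section \<open>Gluing the branches\<close>

context spider_process
begin

text \<open>The radius at time \<open>t\<close> is almost surely positive, so up to a null set the
  event is the disjoint union of its parts on the single branches, and \<open>law_on_branch\<close>
  applies to each part.\<close>

lemma law_at:
  assumes t: "s < t" "t \<le> T" and A: "A \<in> sets (borel \<Otimes>\<^sub>M borel)"
  shows "emeasure (distr M (borel \<Otimes>\<^sub>M borel) (\<lambda>\<omega>. (X t \<omega>, L t \<omega>))) A =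
    (\<Sum>j\<in>UNIV. (\<integral>\<^sup>+y\<in>{0<..}. (\<integral>\<^sup>+m\<in>{0<..}. kernel_density (ra j) s t l0 x y m * indicator A (point y j, l0 + m) \<partial>lborel) \<partial>lborel) +
      (\<integral>\<^sup>+y\<in>{0<..}. of_bool (i = j) * ennreal (absorbed_density (t - s) x y) * indicator A (point y j, l0) \<partial>lborel))"
proof -
  have tm: "t \<in> {s..T}" using t by auto
  interpret S: spider_clock M s t l0 rL \<rho> ra x i by (rule spider_clock[OF t])
  define B where "B j = {z. 0 < fst z \<and> (point (fst z) j, l0 + snd z) \<in> A}" for j :: 'i
  have Bm: "B j \<in> sets (borel \<Otimes>\<^sub>M borel)" for j
  proof -
    have p: "(\<lambda>z. (point (fst z) j, l0 + snd z)) \<in> measurable (borel \<Otimes>\<^sub>M borel) (borel \<Otimes>\<^sub>M borel)"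
      by measurable
    have "{z \<in> space (borel \<Otimes>\<^sub>M borel). 0 < fst z \<and> (point (fst z) j, l0 + snd z) \<in> A} =
        (fst -` {0<..} \<inter> space (borel \<Otimes>\<^sub>M borel)) \<inter> ((\<lambda>z. (point (fst z) j, l0 + snd z)) -` A \<inter> space (borel \<Otimes>\<^sub>M borel))"
      by (auto simp: space_pair_measure)
    also have "\<dots> \<in> sets (borel \<Otimes>\<^sub>M borel)"
      by (intro sets.Int measurable_sets[OF p A] measurable_sets[OF measurable_fst]) auto
    finally show ?thesis by (simp add: B_def space_pair_measure)
  qed
  let ?E = "\<lambda>j. {\<omega> \<in> space M. (\<rho> j t \<omega>, rL t \<omega> - l0) \<in> B j}"
  have Em: "?E j \<in> sets M" for j
  proof -
    have "(\<lambda>\<omega>. (\<rho> j t \<omega>, rL t \<omega> - l0)) \<in> measurable M (borel \<Otimes>\<^sub>M borel)" by measurable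
    from measurable_sets[OF this Bm[of j]] show ?thesis by (simp add: vimage_def Int_def conj_commute)
  qed
  have XL: "(\<lambda>\<omega>. (X t \<omega>, L t \<omega>)) \<in> measurable M (borel \<Otimes>\<^sub>M borel)"
    using X_measurable[OF tm] L_measurable[OF tm] by measurable
  have "emeasure (distr M (borel \<Otimes>\<^sub>M borel) (\<lambda>\<omega>. (X t \<omega>, L t \<omega>))) A = emeasure M ((\<lambda>\<omega>. (X t \<omega>, L t \<omega>)) -` A \<inter> space M)"
    by (rule emeasure_distr[OF XL A])
  also have "\<dots> = emeasure M (\<Union>j\<in>UNIV. ?E j)"
  proof (rule emeasure_eq_AE)
    show "AE \<omega> in M. (\<omega> \<in> (\<lambda>\<omega>. (X t \<omega>, L t \<omega>)) -` A \<inter> space M) = (\<omega> \<in> (\<Union>j\<in>UNIV. ?E j))"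
      using AE_not_bad S.AE_radius_pos AE_space
    proof eventually_elim
      case (elim \<omega>)
      let ?q = "rX t \<omega>"
      have r: "0 < radius ?q" using elim(2) by (simp add: S.R_def sum_rho)
      have "\<omega> \<in> ?E j \<longleftrightarrow> j = branch ?q \<and> (?q, rL t \<omega>) \<in> A" for j
      proof (cases "j = branch ?q")
        case True
        then show ?thesis using elim(3) r by (simp add: B_def \<rho>_def branch_radius_branch point_radius_branch)
      next
        case False
        then show ?thesis by (simp add: B_def \<rho>_def branch_radius_eq_0)
      qed
      then show ?case using elim(3) r_eq[OF elim(1) tm] by auto
    qed
    show "(\<lambda>\<omega>. (X t \<omega>, L t \<omega>)) -` A \<inter> space M \<in> sets M" by (rule measurable_sets[OF XL A])
    show "(\<Union>j\<in>UNIV. ?E j) \<in> sets M" using Em by (intro sets.finite_UN) auto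
  qed
  also have "\<dots> = (\<Sum>j\<in>UNIV. emeasure M (?E j))"
  proof (rule sum_emeasure[symmetric])
    show "disjoint_family_on ?E UNIV"
      unfolding disjoint_family_on_def
    proof (intro ballI impI)
      fix j k :: 'i assume "j \<noteq> k"
      have "\<not> (0 < \<rho> j t \<omega> \<and> 0 < \<rho> k t \<omega>)" for \<omega>
        using branch_radius_eq_0[of j "rX t \<omega>"] branch_radius_eq_0[of k "rX t \<omega>"] \<open>j \<noteq> k\<close>
        by (cases "j = branch (rX t \<omega>)") (auto simp: \<rho>_def)
      then show "?E j \<inter> ?E k = {}" by (auto simp: B_def)
    qed
  qed (use Em in auto)
  also have "\<dots> = (\<Sum>j\<in>UNIV. (\<integral>\<^sup>+y\<in>{0<..}. (\<integral>\<^sup>+m\<in>{0<..}. kernel_density (ra j) s t l0 x y m * indicator A (point y j, l0 + m) \<partial>lborel) \<partial>lborel) +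
      (\<integral>\<^sup>+y\<in>{0<..}. of_bool (i = j) * ennreal (absorbed_density (t - s) x y) * indicator A (point y j, l0) \<partial>lborel))"
  proof (rule sum.cong[OF refl])
    fix j :: 'i
    have ind: "indicator (B j) (y, m) = (indicator A (point y j, l0 + m) :: ennreal)" if "0 < y" for y m
      using that by (auto simp: B_def split: split_indicator)
    have "emeasure M (?E j) = (\<integral>\<^sup>+y\<in>{0<..}. (\<integral>\<^sup>+m\<in>{0<..}. kernel_density (ra j) s t l0 x y m * indicator (B j) (y, m) \<partial>lborel) \<partial>lborel) +
      (\<integral>\<^sup>+y\<in>{0<..}. of_bool (i = j) * ennreal (absorbed_density (t - s) x y) * indicator (B j) (y, 0) \<partial>lborel)"
      by (rule law_on_branch[OF t Bm]) (auto simp: B_def)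
    also have "(\<integral>\<^sup>+y\<in>{0<..}. (\<integral>\<^sup>+m\<in>{0<..}. kernel_density (ra j) s t l0 x y m * indicator (B j) (y, m) \<partial>lborel) \<partial>lborel) =
       (\<integral>\<^sup>+y\<in>{0<..}. (\<integral>\<^sup>+m\<in>{0<..}. kernel_density (ra j) s t l0 x y m * indicator A (point y j, l0 + m) \<partial>lborel) \<partial>lborel)"
    proof (rule nn_integral_cong)
      fix y :: real
      show "(\<integral>\<^sup>+m\<in>{0<..}. kernel_density (ra j) s t l0 x y m * indicator (B j) (y, m) \<partial>lborel) * indicator {0<..} y =
        (\<integral>\<^sup>+m\<in>{0<..}. kernel_density (ra j) s t l0 x y m * indicator A (point y j, l0 + m) \<partial>lborel) * indicator {0<..} y"
        by (cases "0 < y") (simp_all add: ind)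
    qed
    also have "(\<integral>\<^sup>+y\<in>{0<..}. of_bool (i = j) * ennreal (absorbed_density (t - s) x y) * indicator (B j) (y, 0) \<partial>lborel) =
      (\<integral>\<^sup>+y\<in>{0<..}. of_bool (i = j) * ennreal (absorbed_density (t - s) x y) * indicator A (point y j, l0) \<partial>lborel)"
    proof (rule nn_integral_cong)
      fix y :: real
      show "of_bool (i = j) * ennreal (absorbed_density (t - s) x y) * indicator (B j) (y, 0) * indicator {0<..} y =
        of_bool (i = j) * ennreal (absorbed_density (t - s) x y) * indicator A (point y j, l0) * indicator {0<..} y"
        by (cases "0 < y") (simp_all add: ind)
    qed
    finally show "emeasure M (?E j) = (\<integral>\<^sup>+y\<in>{0<..}. (\<integral>\<^sup>+m\<in>{0<..}. kernel_density (ra j) s t l0 x y m * indicator A (point y j, l0 + m) \<partial>lborel) \<partial>lborel) +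
      (\<integral>\<^sup>+y\<in>{0<..}. of_bool (i = j) * ennreal (absorbed_density (t - s) x y) * indicator A (point y j, l0) \<partial>lborel)" .
  qed
  finally show ?thesis .
qed

end

theorem proposition7p1:
  fixes T s t :: real
    and \<alpha> :: "'i::finite \<Rightarrow> real \<Rightarrow> real \<Rightarrow> real"
    and M :: "'w measure"
    and X :: "real \<Rightarrow> 'w \<Rightarrow> 'i network"
    and L :: "real \<Rightarrow> 'w \<Rightarrow> real"
  assumes "CARD('i) \<ge> 2" and "T > 0"
    and "spinning_measure T \<alpha>"
    and "0 \<le> s" and "s < t" and "t \<le> T"
  shows
    "(\<forall>k\<ge>0. brownian_spider M T \<alpha> s junction k X L \<longrightarrow>
       (\<forall>A\<in>sets (borel \<Otimes>\<^sub>M borel).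
          emeasure (distr M (borel \<Otimes>\<^sub>M borel) (\<lambda>\<omega>. (X t \<omega>, L t \<omega>))) A =
            (\<Sum>j\<in>UNIV. \<integral>\<^sup>+y\<in>{0<..}. (\<integral>\<^sup>+m\<in>{0<..}.
               ennreal (junction_density \<alpha> s t k j y m) * indicator A (point y j, k + m)
             \<partial>lborel) \<partial>lborel))) \<and>
     (\<forall>x>0. \<forall>i. \<forall>l\<ge>0. brownian_spider M T \<alpha> s (point x i) l X L \<longrightarrow>
       (\<forall>A\<in>sets (borel \<Otimes>\<^sub>M borel).
          emeasure (distr M (borel \<Otimes>\<^sub>M borel) (\<lambda>\<omega>. (X t \<omega>, L t \<omega>))) A =
            (\<Sum>j\<in>UNIV. \<integral>\<^sup>+y\<in>{0<..}. (
               (\<integral>\<^sup>+m\<in>{0<..}.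
                  ennreal (branch_density \<alpha> s t x l j y m) * indicator A (point y j, l + m)
                \<partial>lborel) +
               of_bool (i = j) * ennreal (absorbed_density (t - s) x y) *
                 (\<integral>\<^sup>+m. indicator A (point y j, l + m) \<partial>return borel 0))
             \<partial>lborel)))"
proof (intro conjI allI impI ballI)
  fix k :: real and A :: "('i network \<times> real) set"
  assume k: "0 \<le> k" and sp: "brownian_spider M T \<alpha> s junction k X L" and A: "A \<in> sets (borel \<Otimes>\<^sub>M borel)"
  \<comment> \<open>The junction is \<open>point 0 i\<close> for every \<open>i\<close>, so an
    arbitrary branch label may be supplied.\<close>
  interpret S: spider_process M T \<alpha> s 0 k undefined X L
    using sp k assms by unfold_locales auto
  have kd: "kernel_density (S.ra j) s t k 0 y m = ennreal (junction_density \<alpha> s t k j y m)" if "0 < y" "0 < m" for j y m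
    using that k assms
    by (intro kernel_density_eq_junction_density(1)[OF S.ra_measurable S.ra_nonneg S.ra_le_1] S.ra_eq) auto
  \<comment> \<open>For a start at the junction the two Gaussians in the absorbed density coincide,
    so the second summand of \<open>law_at\<close> disappears.\<close>
  have ab: "absorbed_density (t - s) 0 y = 0" for y by (simp add: absorbed_density_def)
  show "emeasure (distr M (borel \<Otimes>\<^sub>M borel) (\<lambda>\<omega>. (X t \<omega>, L t \<omega>))) A =
            (\<Sum>j\<in>UNIV. \<integral>\<^sup>+y\<in>{0<..}. (\<integral>\<^sup>+m\<in>{0<..}.
               ennreal (junction_density \<alpha> s t k j y m) * indicator A (point y j, k + m)
             \<partial>lborel) \<partial>lborel)"
    unfolding S.law_at[OF assms(5,6) A]
  proof (intro sum.cong refl)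
    fix j :: 'i
    have "(\<integral>\<^sup>+y\<in>{0<..}. (\<integral>\<^sup>+m\<in>{0<..}. kernel_density (S.ra j) s t k 0 y m * indicator A (point y j, k + m) \<partial>lborel) \<partial>lborel) =
      (\<integral>\<^sup>+y\<in>{0<..}. (\<integral>\<^sup>+m\<in>{0<..}. ennreal (junction_density \<alpha> s t k j y m) * indicator A (point y j, k + m) \<partial>lborel) \<partial>lborel)"
    proof (rule nn_integral_cong)
      fix y :: real
      have "(\<integral>\<^sup>+m\<in>{0<..}. kernel_density (S.ra j) s t k 0 y m * indicator A (point y j, k + m) \<partial>lborel) =
        (\<integral>\<^sup>+m\<in>{0<..}. ennreal (junction_density \<alpha> s t k j y m) * indicator A (point y j, k + m) \<partial>lborel)" if "0 < y"
      proof (rule nn_integral_cong)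
        fix m :: real
        show "kernel_density (S.ra j) s t k 0 y m * indicator A (point y j, k + m) * indicator {0<..} m =
          ennreal (junction_density \<alpha> s t k j y m) * indicator A (point y j, k + m) * indicator {0<..} m"
          by (cases "0 < m") (simp_all add: kd[OF that])
      qed
      then show "(\<integral>\<^sup>+m\<in>{0<..}. kernel_density (S.ra j) s t k 0 y m * indicator A (point y j, k + m) \<partial>lborel) * indicator {0<..} y =
        (\<integral>\<^sup>+m\<in>{0<..}. ennreal (junction_density \<alpha> s t k j y m) * indicator A (point y j, k + m) \<partial>lborel) * indicator {0<..} y"
        by (cases "0 < y") simp_all
    qed
    then show "(\<integral>\<^sup>+y\<in>{0<..}. (\<integral>\<^sup>+m\<in>{0<..}. kernel_density (S.ra j) s t k 0 y m * indicator A (point y j, k + m) \<partial>lborel) \<partial>lborel) +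
        (\<integral>\<^sup>+y\<in>{0<..}. of_bool (undefined = j) * ennreal (absorbed_density (t - s) 0 y) * indicator A (point y j, k) \<partial>lborel) =
      (\<integral>\<^sup>+y\<in>{0<..}. (\<integral>\<^sup>+m\<in>{0<..}. ennreal (junction_density \<alpha> s t k j y m) * indicator A (point y j, k + m) \<partial>lborel) \<partial>lborel)"
      by (simp add: ab)
  qed
next
  fix x l :: real and i :: 'i and A :: "('i network \<times> real) set"
  assume x: "0 < x" and l: "0 \<le> l" and sp: "brownian_spider M T \<alpha> s (point x i) l X L" and A: "A \<in> sets (borel \<Otimes>\<^sub>M borel)"
  interpret S: spider_process M T \<alpha> s x l i X L
    using sp x l assms by unfold_locales auto
  have kd: "kernel_density (S.ra j) s t l x y m = ennreal (branch_density \<alpha> s t x l j y m)" if "0 < y" "0 < m" for j y m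
    using that l x assms
    by (intro kernel_density_eq_branch_density[OF S.ra_measurable S.ra_nonneg S.ra_le_1] S.ra_eq) auto
  have pm: "(\<lambda>m. (point y j, l + m)) \<in> measurable borel (borel \<Otimes>\<^sub>M borel)" for y and j :: 'i
    by measurable
  \<comment> \<open>The unit mass at increment 0 turns the integral into an evaluation at
    \<open>l\<close>, the form in which \<open>law_at\<close> provides the absorbed part.\<close>
  have ret: "(\<integral>\<^sup>+m. indicator A (point y j, l + m) \<partial>return borel 0) = (indicator A (point y j, l) :: ennreal)" for y j
    using measurable_compose[OF pm borel_measurable_indicator[OF A]] by (subst nn_integral_return) auto
  show "emeasure (distr M (borel \<Otimes>\<^sub>M borel) (\<lambda>\<omega>. (X t \<omega>, L t \<omega>))) A =
            (\<Sum>j\<in>UNIV. \<integral>\<^sup>+y\<in>{0<..}. (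
               (\<integral>\<^sup>+m\<in>{0<..}.
                  ennreal (branch_density \<alpha> s t x l j y m) * indicator A (point y j, l + m)
                \<partial>lborel) +
               of_bool (i = j) * ennreal (absorbed_density (t - s) x y) *
                 (\<integral>\<^sup>+m. indicator A (point y j, l + m) \<partial>return borel 0))
             \<partial>lborel)"
    unfolding S.law_at[OF assms(5,6) A] ret
  proof (intro sum.cong refl)
    fix j :: 'i
    have Am [measurable]: "A \<in> sets (borel \<Otimes>\<^sub>M borel)" by (rule A)
    have ram: "(\<lambda>z. S.ra j (fst z) (snd z)) \<in> borel_measurable (borel \<Otimes>\<^sub>M borel)" by (rule S.ra_measurable)
    have "(\<integral>\<^sup>+y\<in>{0<..}. (\<integral>\<^sup>+m\<in>{0<..}. kernel_density (S.ra j) s t l x y m * indicator A (point y j, l + m) \<partial>lborel) \<partial>lborel) +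
       (\<integral>\<^sup>+y\<in>{0<..}. of_bool (i = j) * ennreal (absorbed_density (t - s) x y) * indicator A (point y j, l) \<partial>lborel) =
      (\<integral>\<^sup>+y. (\<integral>\<^sup>+m\<in>{0<..}. kernel_density (S.ra j) s t l x y m * indicator A (point y j, l + m) \<partial>lborel) * indicator {0<..} y +
       of_bool (i = j) * ennreal (absorbed_density (t - s) x y) * indicator A (point y j, l) * indicator {0<..} y \<partial>lborel)"
    proof (rule nn_integral_add[symmetric])
      have km [measurable (raw)]: "(\<lambda>z. S.ra j (f z) (h z)) \<in> borel_measurable N"
        if "f \<in> borel_measurable N" "h \<in> borel_measurable N" for f h and N :: "'z measure"
        using measurable_compose[OF measurable_Pair[OF that] ram] by simp
      show "(\<lambda>y. (\<integral>\<^sup>+m\<in>{0<..}. kernel_density (S.ra j) s t l x y m * indicator A (point y j, l + m) \<partial>lborel) * indicator {0<..} y) \<in> borel_measurable lborel"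
        unfolding kernel_density_def by measurable
      show "(\<lambda>y. of_bool (i = j) * ennreal (absorbed_density (t - s) x y) * indicator A (point y j, l) * indicator {0<..} y) \<in> borel_measurable lborel"
        unfolding absorbed_density_def by measurable
    qed
    also have "\<dots> = (\<integral>\<^sup>+y\<in>{0<..}. ((\<integral>\<^sup>+m\<in>{0<..}. ennreal (branch_density \<alpha> s t x l j y m) * indicator A (point y j, l + m) \<partial>lborel) +
        of_bool (i = j) * ennreal (absorbed_density (t - s) x y) * indicator A (point y j, l)) \<partial>lborel)"
    proof (rule nn_integral_cong)
      fix y :: real
      have eq: "(\<integral>\<^sup>+m\<in>{0<..}. kernel_density (S.ra j) s t l x y m * indicator A (point y j, l + m) \<partial>lborel) =
        (\<integral>\<^sup>+m\<in>{0<..}. ennreal (branch_density \<alpha> s t x l j y m) * indicator A (point y j, l + m) \<partial>lborel)" if "0 < y"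
      proof (rule nn_integral_cong)
        fix m :: real
        show "kernel_density (S.ra j) s t l x y m * indicator A (point y j, l + m) * indicator {0<..} m =
          ennreal (branch_density \<alpha> s t x l j y m) * indicator A (point y j, l + m) * indicator {0<..} m"
          by (cases "0 < m") (simp_all add: kd[OF that])
      qed
      show "(\<integral>\<^sup>+m\<in>{0<..}. kernel_density (S.ra j) s t l x y m * indicator A (point y j, l + m) \<partial>lborel) * indicator {0<..} y +
          of_bool (i = j) * ennreal (absorbed_density (t - s) x y) * indicator A (point y j, l) * indicator {0<..} y =
        ((\<integral>\<^sup>+m\<in>{0<..}. ennreal (branch_density \<alpha> s t x l j y m) * indicator A (point y j, l + m) \<partial>lborel) +
        of_bool (i = j) * ennreal (absorbed_density (t - s) x y) * indicator A (point y j, l)) * indicator {0<..} y"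
      proof (cases "0 < y")
        case True
        then have 1: "indicator {0<..} y = (1::ennreal)" by simp
        show ?thesis unfolding eq[OF True] 1 mult_1_right ..
      next
        case False
        then have 0: "indicator {0<..} y = (0::ennreal)" by simp
        show ?thesis unfolding 0 mult_zero_right add_0_right ..
      qed
    qed
    finally show "(\<integral>\<^sup>+y\<in>{0<..}. (\<integral>\<^sup>+m\<in>{0<..}. kernel_density (S.ra j) s t l x y m * indicator A (point y j, l + m) \<partial>lborel) \<partial>lborel) +
       (\<integral>\<^sup>+y\<in>{0<..}. of_bool (i = j) * ennreal (absorbed_density (t - s) x y) * indicator A (point y j, l) \<partial>lborel) = \<dots>" .
  qed
qed

end
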